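(* A totally real surface of the nearly Kähler $\mathbb{C}P^3$ that is also almost complex for Kähler $\mathbb{C}P^3$ has to be congruent to the following immersion of a sphere: $$[0,\pi]\times[0,2\pi]\to\mathbb{C}P^3:\ (u,v)\mapsto\pi\left(\cos u,\ \tfrac{\sqrt2}{\sqrt3}\,ie^{iv}\sin u,\ 0,\ \tfrac1{\sqrt3}e^{iv}\sin u\right).$$ In particular, it is the $\mathbb{C}P^1\cong\mathbb{S}^2$ inside the Lagrangian $\mathbb{S}^2\times\mathbb{S}^1$ of the nearly Kähler $\mathbb{C}P^3$ with Lagrangian angle $\theta^L=\pi/4$.
   Context: Identify $\mathbb{C}^4\cong\mathbb{H}^2$ by $(z_1,z_2,z_3,z_4)\leftrightarrow(z_1+z_2j,\ z_3+z_4j)$, with unit quaternions acting by left multiplication: left multiplication by $i$ is multiplication by the complex scalar $i$, left multiplication by $j$ is $(z_1,z_2,z_3,z_4)\mapsto(-\bar z_2,\bar z_1,-\bar z_4,\bar z_3)$, and $k=ij$. Let $\pi:\mathbb{S}^7\to\mathbb{C}P^3$ be the Hopf fibration ($p\sim e^{i\theta}p$), $g_\circ$ the Fubini–Study metric making $\pi$ a Riemannian submersion from the unit round sphere, and $J_\circ$ the standard complex structure of $\mathbb{C}P^3$. "Kähler $\mathbb{C}P^3$" means $(\mathbb{C}P^3,g_\circ,J_\circ)$. Let $\mathcal{D}_1^2$ be the rank-2 distribution $d\pi(\mathrm{Span}\{jp,kp\})$ at $\pi(p)$ (well defined) and $\mathcal{D}_2^4$ its $g_\circ$-orthogonal complement.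 Let $P$ be $-1$ on $\mathcal{D}_1^2$ and $+1$ on $\mathcal{D}_2^4$; put $J=PJ_\circ=J_\circ P$ and $g(X,Y)=\tfrac32 g_\circ(X,Y)+\tfrac12 g_\circ(X,PY)$. Then $(\mathbb{C}P^3,g,J)$ is the nearly Kähler $\mathbb{C}P^3$. A submanifold $M$ is totally real in the nearly Kähler $\mathbb{C}P^3$ if $J(TM)$ is $g$-orthogonal to $TM$; it is almost complex for Kähler $\mathbb{C}P^3$ if $J_\circ(TM)=TM$. A Lagrangian submanifold of the nearly Kähler $\mathbb{C}P^3$ is a totally real submanifold of dimension 3. The Lagrangian angle $\theta^L\in[0,\pi/4]$ of a Lagrangian submanifold $L$ is the function such that at each point there is a $g$-orthonormal basis $E_1,E_2,E_3$ of the tangent space of $L$ of the form $E_1=\cos\theta^L A+\sin\theta^L X$, $E_2=\sin\theta^L JA-\cos\theta^L JX$, $E_3\in\mathcal{D}_2^4$, with $A\in\mathcal{D}_1^2$ and $X\in\mathcal{D}_2^4$ of $g$-unit length; thus $\theta^L=0$ for the totally geodesic Lagrangian $\mathbb{R}P^3$, and $\theta^L=\pi/4$ means that $\mathrm{Span}\{E_1,E_2\}$ is $J_\circ$-invariant. Two submanifolds are congruent if some isometry of $(\mathbb{C}P^3,g)$ maps one to the other. *)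

theory Defs
  imports "HOL-Analysis.Analysis"
begin

lemma vector_4 [simp]:
  "(vector [a, b, c, d] :: 'a::zero^4) $ 1 = a"
  "(vector [a, b, c, d] :: 'a::zero^4) $ 2 = b"
  "(vector [a, b, c, d] :: 'a::zero^4) $ 3 = c"
  "(vector [a, b, c, d] :: 'a::zero^4) $ 4 = d"
  unfolding vector_def by auto

section \<open>Smooth maps between open subsets of normed spaces\<close>

primrec Ck_on :: "nat \<Rightarrow> ('a::real_normed_vector \<Rightarrow> 'b::real_normed_vector) \<Rightarrow> 'a set \<Rightarrow> bool"
  where
    "Ck_on 0 f U \<longleftrightarrow> continuous_on U f"
  | "Ck_on (Suc k) f U \<longleftrightarrow> (\<forall>x\<in>U. f differentiable (at x)) \<and>
       (\<forall>v. Ck_on k (\<lambda>x. frechet_derivative f (at x) v) U)"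

definition smooth_on :: "('a::real_normed_vector \<Rightarrow> 'b::real_normed_vector) \<Rightarrow> 'a set \<Rightarrow> bool"
  where "smooth_on f U \<longleftrightarrow> (\<forall>k. Ck_on k f U)"

section \<open>Complex projective space as the base of the Hopf fibration\<close>

text \<open>
  The real inner product \<open>\<bullet>\<close> of \<open>complex^4\<close> is the real part of the standard Hermitian product,
  so \<open>sphere 0 1\<close> is the unit round 7-sphere; \<open>c *s p\<close> is multiplication by a complex scalar.
  A point of \<open>cp3\<close> is a Hopf circle.
\<close>

typedef cp3 = "(\<lambda>p. range (\<lambda>\<theta>::real. cis \<theta> *s p)) ` sphere (0::complex^4) 1"
  by (auto intro!: exI[of _ "axis 1 1"])

text \<open>The Hopf fibration; its values outside the unit sphere are irrelevant.\<close>

definition hopf :: "complex^4 \<Rightarrow> cp3"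
  where "hopf p = Abs_cp3 (range (\<lambda>\<theta>::real. cis \<theta> *s p))"

lemma hopf_eq_iff:
  assumes "norm p = 1" "norm q = 1"
  shows "hopf p = hopf q \<longleftrightarrow> (\<exists>\<theta>::real. q = cis \<theta> *s p)"
proof -
  have "hopf p = hopf q \<longleftrightarrow> range (\<lambda>\<theta>::real. cis \<theta> *s p) = range (\<lambda>\<theta>::real. cis \<theta> *s q)"
    unfolding hopf_def using assms by (intro Abs_cp3_inject) auto
  also have "\<dots> \<longleftrightarrow> (\<exists>\<theta>::real. q = cis \<theta> *s p)"
  proof
    assume eq: "range (\<lambda>\<theta>::real. cis \<theta> *s p) = range (\<lambda>\<theta>::real. cis \<theta> *s q)"
    have "q = cis 0 *s q" by simp
    then have "q \<in> range (\<lambda>\<theta>::real. cis \<theta> *s q)" by blast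
    then show "\<exists>\<theta>::real. q = cis \<theta> *s p" using eq by blast
  next
    assume "\<exists>\<theta>::real. q = cis \<theta> *s p"
    then obtain t :: real where q: "q = cis t *s p" by blast
    have "cis s *s p = cis (s - t) *s q" for s
      by (simp add: q vec_eq_iff cis_mult flip: mult.assoc)
    moreover have "cis s *s q = cis (s + t) *s p" for s
      by (simp add: q vec_eq_iff cis_mult flip: mult.assoc)
    ultimately show "range (\<lambda>\<theta>::real. cis \<theta> *s p) = range (\<lambda>\<theta>::real. cis \<theta> *s q)"
      by blast
  qed
  finally show ?thesis .
qed

lemma hopf_surj: "\<exists>p. norm p = 1 \<and> hopf p = x"
  by (cases x) (auto simp: hopf_def)

instantiation cp3 :: topological_space
begin

text \<open>The quotient topology.\<close>

definition open_cp3 :: "cp3 set \<Rightarrow> bool"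
  where "open_cp3 U \<longleftrightarrow> openin (top_of_set (sphere 0 1)) {p \<in> sphere 0 1. hopf p \<in> U}"

instance
proof
  have "{p \<in> sphere (0::complex^4) 1. hopf p \<in> UNIV} = sphere 0 1" by auto
  then show "open (UNIV :: cp3 set)"
    unfolding open_cp3_def by (metis openin_subtopology_self)
next
  fix S T :: "cp3 set" assume "open S" "open T"
  then have "openin (top_of_set (sphere 0 1))
    ({p \<in> sphere 0 1. hopf p \<in> S} \<inter> {p \<in> sphere 0 1. hopf p \<in> T})"
    unfolding open_cp3_def by (rule openin_Int)
  also have "{p \<in> sphere 0 1. hopf p \<in> S} \<inter> {p \<in> sphere 0 1. hopf p \<in> T}
    = {p \<in> sphere 0 1. hopf p \<in> S \<inter> T}" by auto
  finally show "open (S \<inter> T)" by (simp add: open_cp3_def)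
next
  fix K :: "cp3 set set" assume K: "\<forall>S\<in>K. open S"
  then have "openin (top_of_set (sphere 0 1)) (\<Union>S\<in>K. {p \<in> sphere 0 1. hopf p \<in> S})"
    unfolding open_cp3_def by (intro openin_Union) auto
  also have "(\<Union>S\<in>K. {p \<in> sphere 0 1. hopf p \<in> S}) = {p \<in> sphere 0 1. hopf p \<in> \<Union>K}" by auto
  finally show "open (\<Union>K)" by (simp add: open_cp3_def)
qed

end

section \<open>The Kaehler and the nearly Kaehler structure\<close>

text \<open>
  A tangent vector of \<open>cp3\<close> at \<open>hopf p\<close> is represented by its horizontal lift at \<open>p\<close>, i.e. by a
  vector orthogonal to \<open>p\<close> and \<open>\<i>p\<close>. On horizontal lifts the Fubini-Study metric is \<open>\<bullet>\<close> (Hopf is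
  a Riemannian submersion) and its complex structure is \<open>\<lambda>v. \<i> *s v\<close>. All structures below are
  equivariant under \<open>(p, v) \<mapsto> (cis \<theta> *s p, cis \<theta> *s v)\<close>, hence do not depend on the choice of
  \<open>p\<close> in its Hopf circle.
\<close>

definition horizontal :: "complex^4 \<Rightarrow> (complex^4) set"
  where "horizontal p = {v. v \<bullet> p = 0 \<and> v \<bullet> (\<i> *s p) = 0}"

text \<open>
  Orthogonal projection onto the horizontal space at a unit vector \<open>p\<close>: for \<open>u\<close> tangent to the
  sphere at \<open>p\<close> it is the horizontal lift of the image of \<open>u\<close> under the differential of Hopf.
\<close>

definition horizontal_part :: "complex^4 \<Rightarrow> complex^4 \<Rightarrow> complex^4"
  where "horizontal_part p u = u - (u \<bullet> p) *\<^sub>R p - (u \<bullet> (\<i> *s p)) *\<^sub>R (\<i> *s p)"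

text \<open>
  Left multiplication by the quaternions \<open>j\<close> and \<open>k = ij\<close> under
  \<open>(z\<^sub>1, z\<^sub>2, z\<^sub>3, z\<^sub>4) \<leftrightarrow> (z\<^sub>1 + z\<^sub>2 j, z\<^sub>3 + z\<^sub>4 j)\<close>.
\<close>

definition quat_j :: "complex^4 \<Rightarrow> complex^4"
  where "quat_j p = vector [- cnj (p $ 2), cnj (p $ 1), - cnj (p $ 4), cnj (p $ 3)]"

definition quat_k :: "complex^4 \<Rightarrow> complex^4"
  where "quat_k p = \<i> *s quat_j p"

definition D1 :: "complex^4 \<Rightarrow> (complex^4) set"
  where "D1 p = span {quat_j p, quat_k p}"

definition D2 :: "complex^4 \<Rightarrow> (complex^4) set"
  where "D2 p = {v \<in> horizontal p. \<forall>w\<in>D1 p. v \<bullet> w = 0}"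

text \<open>
  For a unit vector \<open>p\<close> the vectors \<open>jp\<close>, \<open>kp\<close> are orthonormal, so \<open>nk_P p\<close> is the reflection
  that is -1 on \<open>D1 p\<close> and +1 on \<open>D2 p\<close>, as the lemmas below confirm.
\<close>

definition nk_P :: "complex^4 \<Rightarrow> complex^4 \<Rightarrow> complex^4"
  where "nk_P p v = v - 2 *\<^sub>R ((v \<bullet> quat_j p) *\<^sub>R quat_j p + (v \<bullet> quat_k p) *\<^sub>R quat_k p)"

lemma quat_orthonormal:
  assumes "norm p = 1"
  shows "quat_j p \<bullet> quat_j p = 1" "quat_k p \<bullet> quat_k p = 1" "quat_j p \<bullet> quat_k p = 0"
    "quat_k p \<bullet> quat_j p = 0"
proof -
  have "p \<bullet> p = 1" using assms by (simp add: dot_square_norm)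
  then show "quat_j p \<bullet> quat_j p = 1" "quat_k p \<bullet> quat_k p = 1" "quat_j p \<bullet> quat_k p = 0"
    "quat_k p \<bullet> quat_j p = 0"
    by (simp_all add: quat_k_def quat_j_def inner_vec_def sum_4 inner_complex_def)
qed

lemma D1_subset_horizontal: "D1 p \<subseteq> horizontal p"
  unfolding D1_def
proof (rule span_minimal)
  show "{quat_j p, quat_k p} \<subseteq> horizontal p"
    by (simp add: horizontal_def quat_k_def quat_j_def inner_vec_def sum_4 inner_complex_def)
  show "subspace (horizontal p)"
    by (simp add: subspace_def horizontal_def inner_left_distrib)
qed

lemma nk_P_D1:
  assumes "norm p = 1" "v \<in> D1 p" shows "nk_P p v = - v"
proof -
  obtain a b where v: "v = a *\<^sub>R quat_j p + b *\<^sub>R quat_k p"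
    using assms(2) unfolding D1_def span_insert span_singleton
    by (auto simp: algebra_simps)
  show ?thesis
    using quat_orthonormal[OF assms(1)]
    by (simp add: nk_P_def v inner_left_distrib algebra_simps flip: scaleR_left_distrib)
qed

lemma nk_P_D2:
  assumes "v \<in> D2 p" shows "nk_P p v = v"
  using assms by (simp add: D2_def D1_def nk_P_def span_base)

definition nk_J :: "complex^4 \<Rightarrow> complex^4 \<Rightarrow> complex^4"
  where "nk_J p v = nk_P p (\<i> *s v)"

definition nk_metric :: "complex^4 \<Rightarrow> complex^4 \<Rightarrow> complex^4 \<Rightarrow> real"
  where "nk_metric p v w = 3/2 * (v \<bullet> w) + 1/2 * (v \<bullet> nk_P p w)"

section \<open>Immersed submanifolds\<close>

text \<open>
  \<open>F\<close> is a smooth map into the unit sphere, that is, a local lift of a smooth map into \<open>cp3\<close>.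
  The differential at \<open>x\<close> of the latter map, its values being represented by horizontal lifts
  at \<open>F x\<close>:
\<close>

definition hopf_differential ::
    "('a::real_normed_vector \<Rightarrow> complex^4) \<Rightarrow> 'a \<Rightarrow> 'a \<Rightarrow> complex^4"
  where "hopf_differential F x v = horizontal_part (F x) (frechet_derivative F (at x) v)"

abbreviation tangent_space :: "('a::real_normed_vector \<Rightarrow> complex^4) \<Rightarrow> 'a \<Rightarrow> (complex^4) set"
  where "tangent_space F x \<equiv> range (hopf_differential F x)"

text \<open>
  An immersion \<open>f\<close> of an \<open>n\<close>-manifold \<open>M\<close> into \<open>cp3\<close> is given with an atlas of \<open>M\<close> by triples
  \<open>(V, \<phi>, F)\<close>: \<open>\<phi>\<close> is a parametrization of an open subset of \<open>M\<close> by the open set \<open>V\<close> of \<open>\<real>\<^sup>n\<close> and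
  \<open>F\<close> a smooth lift of \<open>f \<circ> \<phi>\<close> to the 7-sphere. Since all \<open>f \<circ> \<phi>\<close> are immersions and the \<open>\<phi>\<close> are
  homeomorphisms, the transition maps are automatically smooth, and any smooth immersion of a
  smooth manifold arises in this way because Hopf has smooth local sections.
\<close>

type_synonym ('m, 'n) lifted_chart =
  "(real^'n) set \<times> (real^'n \<Rightarrow> 'm) \<times> (real^'n \<Rightarrow> complex^4)"

definition lifted_chart ::
    "'m::topological_space set \<Rightarrow> ('m \<Rightarrow> cp3) \<Rightarrow> ('m, 'n::finite) lifted_chart \<Rightarrow> bool"
  where "lifted_chart M f = (\<lambda>(V, \<phi>, F).
     open V \<and> openin (top_of_set M) (\<phi> ` V) \<and> (\<exists>\<psi>. homeomorphism V (\<phi> ` V) \<phi> \<psi>) \<and>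
     smooth_on F V \<and>
     (\<forall>x\<in>V. norm (F x) = 1 \<and> hopf (F x) = f (\<phi> x) \<and> inj (hopf_differential F x)))"

definition immersed_submanifold ::
    "'m::{t2_space, second_countable_topology} set \<Rightarrow> ('m \<Rightarrow> cp3) \<Rightarrow>
      ('m, 'n::finite) lifted_chart set \<Rightarrow> bool"
  where "immersed_submanifold M f \<A> \<longleftrightarrow>
     (\<forall>c\<in>\<A>. lifted_chart M f c) \<and> M = (\<Union>(V, \<phi>, F)\<in>\<A>. \<phi> ` V)"

definition totally_real :: "('m, 'n::finite) lifted_chart set \<Rightarrow> bool"
  where "totally_real \<A> \<longleftrightarrow> (\<forall>(V, \<phi>, F)\<in>\<A>. \<forall>x\<in>V.
     \<forall>X\<in>tangent_space F x. \<forall>Y\<in>tangent_space F x. nk_metric (F x) (nk_J (F x) X) Y = 0)"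

definition kaehler_almost_complex :: "('m, 'n::finite) lifted_chart set \<Rightarrow> bool"
  where "kaehler_almost_complex \<A> \<longleftrightarrow> (\<forall>(V, \<phi>, F)\<in>\<A>. \<forall>x\<in>V.
     (\<lambda>v. \<i> *s v) ` tangent_space F x = tangent_space F x)"

definition lagrangian_submanifold ::
    "'m::{t2_space, second_countable_topology} set \<Rightarrow> ('m \<Rightarrow> cp3) \<Rightarrow>
      ('m, 3) lifted_chart set \<Rightarrow> bool"
  where "lagrangian_submanifold M f \<A> \<longleftrightarrow> immersed_submanifold M f \<A> \<and> totally_real \<A>"

definition nk_orthonormal_basis ::
    "complex^4 \<Rightarrow> (complex^4) set \<Rightarrow> complex^4 \<Rightarrow> complex^4 \<Rightarrow> complex^4 \<Rightarrow> bool"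
  where "nk_orthonormal_basis p T E1 E2 E3 \<longleftrightarrow>
     span {E1, E2, E3} = T \<and>
     nk_metric p E1 E1 = 1 \<and> nk_metric p E2 E2 = 1 \<and> nk_metric p E3 E3 = 1 \<and>
     nk_metric p E1 E2 = 0 \<and> nk_metric p E1 E3 = 0 \<and> nk_metric p E2 E3 = 0"

definition has_lagrangian_angle :: "('m, 3) lifted_chart set \<Rightarrow> ('m \<Rightarrow> real) \<Rightarrow> bool"
  where "has_lagrangian_angle \<A> \<theta> \<longleftrightarrow> (\<forall>(V, \<phi>, F)\<in>\<A>. \<forall>x\<in>V.
     \<theta> (\<phi> x) \<in> {0..pi/4} \<and>
     (\<exists>A\<in>D1 (F x). \<exists>X\<in>D2 (F x). \<exists>E3\<in>D2 (F x).
        nk_metric (F x) A A = 1 \<and> nk_metric (F x) X X = 1 \<and>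
        nk_orthonormal_basis (F x) (tangent_space F x)
          (cos (\<theta> (\<phi> x)) *\<^sub>R A + sin (\<theta> (\<phi> x)) *\<^sub>R X)
          (sin (\<theta> (\<phi> x)) *\<^sub>R nk_J (F x) A - cos (\<theta> (\<phi> x)) *\<^sub>R nk_J (F x) X)
          E3))"

section \<open>Congruence\<close>

text \<open>
  A Riemannian isometry of \<open>cp3\<close> with the nearly Kaehler metric: a bijection with smooth local
  lifts \<open>G\<close> to the 7-sphere whose differential preserves the metric (so the inverse is smooth, too).
\<close>

definition nk_isometry :: "(cp3 \<Rightarrow> cp3) \<Rightarrow> bool"
  where "nk_isometry \<Phi> \<longleftrightarrow> bij \<Phi> \<and>
     (\<forall>p\<in>sphere 0 1. \<exists>W G. open W \<and> p \<in> W \<and> smooth_on G W \<and>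
        (\<forall>q\<in>W \<inter> sphere 0 1. norm (G q) = 1 \<and> hopf (G q) = \<Phi> (hopf q) \<and>
           (\<forall>v\<in>horizontal q. \<forall>w\<in>horizontal q.
              nk_metric (G q) (hopf_differential G q v) (hopf_differential G q w)
                = nk_metric q v w)))"

definition nk_congruent :: "cp3 set \<Rightarrow> cp3 set \<Rightarrow> bool"
  where "nk_congruent A B \<longleftrightarrow> (\<exists>\<Phi>. nk_isometry \<Phi> \<and> \<Phi> ` A = B)"

section \<open>The model sphere\<close>

definition model_immersion :: "real \<times> real \<Rightarrow> cp3"
  where "model_immersion = (\<lambda>(u, v). hopf (vector
     [complex_of_real (cos u),
      complex_of_real (sqrt 2 / sqrt 3) * \<i> * cis v * complex_of_real (sin u),
      0,
      complex_of_real (1 / sqrt 3) * cis v * complex_of_real (sin u)]))"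

text \<open>
  As a map on the rectangle this is not injective (already \<open>(u, v)\<close> and \<open>(\<pi> - u, v \<plusminus> \<pi>)\<close> have
  the same image) and it degenerates along \<open>u = 0, \<pi>/2, \<pi>\<close>; the immersed sphere is its image.
\<close>

definition model_sphere :: "cp3 set"
  where "model_sphere = model_immersion ` ({0..pi} \<times> {0..2*pi})"

end

theory Submission
  imports Defs "HOL-Complex_Analysis.Conformal_Mappings"
begin

text \<open>
  On horizontal vectors the distribution \<open>D2\<close> is the kernel of a holomorphic symplectic form \<open>\<omega>\<close>
  on \<open>complex^4\<close>, and a complex tangent line spanned by a unit vector \<open>X\<close> at \<open>p\<close> is totally real
  precisely if \<open>\<bar>\<omega>(X, p)\<bar>\<^sup>2 = 2/3\<close>. For a holomorphic affine lift \<open>H\<close> of the surface this makes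
  \<open>(H \<and> H') / \<omega>(H', H)\<close> a holomorphic map of constant norm, so it is constant by the maximum
  principle and the surface lies in a projective line. The group Sp(2) acts by isometries and
  transitively on the lines with this value of \<open>\<omega>\<close>. Moving the model line by a suitable
  one-parameter subgroup of Sp(2) sweeps out the Lagrangian: its velocity spans the only direction
  in \<open>D2\<close> orthogonal to the line, up to a phase that the subgroup fixes.
\<close>

section \<open>Hermitian and contact forms\<close>

text \<open>Both \<open>quat_j\<close> and the second slot of \<open>herm\<close> are antilinear, so
  \<open>contact_form\<close> is complex bilinear: \<omega> is holomorphic along a holomorphic lift.
  The value 2/3 comes from the weights of the metric: on a complex tangent line the fundamental form
  is proportional to 3|\<omega>(X, p)|^2 - 2|X|^2. The quotient of H \<and> H' by \<omega>(H', H) is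
  unchanged when H is rescaled or reparametrized: it is the Pluecker vector of the tangent line,
  normalized by \<omega>, so its constancy says that the tangent line never moves. The surface comes
  with real charts only, so a complex parameter must be constructed: an affine coordinate serves, by
  the real inverse function theorem. The line found in one chart is carried along the connected M,
  because two points of an overlap determine it. This gives a relatively open piece of the line;
  compactness is what makes it the whole line. For the Lagrangian, complex 4-space is treated as a
  tensor product of two planes, in which \<omega> factors into a determinant and a symmetric form.
  The two factors give the sphere and the circle.\<close>

lemmas scaleR_complex = scaleR_conv_of_real [where 'a = complex]

definition herm :: "complex^'n \<Rightarrow> complex^'n::finite \<Rightarrow> complex"
  where "herm u v = (\<Sum>k\<in>UNIV. u $ k * cnj (v $ k))"

definition contact_form :: "complex^4 \<Rightarrow> complex^4 \<Rightarrow> complex"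
  where "contact_form u v = herm u (quat_j v)"

lemma contact_form_expand:
  "contact_form u v = u$2 * v$1 - u$1 * v$2 + u$4 * v$3 - u$3 * v$4"
  by (simp add: contact_form_def herm_def sum_4 quat_j_def)

lemma herm_linear [simp]:
  "herm (u + v) w = herm u w + herm v w" "herm (u - v) w = herm u w - herm v w"
  "herm (c *s u) w = c * herm u w" "herm (r *\<^sub>R u) w = of_real r * herm u w"
  "herm (- u) w = - herm u w" "herm 0 w = 0"
  "herm w (u + v) = herm w u + herm w v" "herm w (u - v) = herm w u - herm w v"
  "herm w (c *s u) = cnj c * herm w u" "herm w (r *\<^sub>R u) = of_real r * herm w u"
  "herm w (- u) = - herm w u" "herm w 0 = 0"
  by (simp_all add: herm_def sum.distrib sum_subtractf sum_negf algebra_simps sum_distrib_left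
      scaleR_complex)

lemma herm_commute: "herm v u = cnj (herm u v)"
  by (simp add: herm_def mult.commute)

lemma inner_herm: "u \<bullet> v = Re (herm u v)"
  by (simp add: herm_def inner_vec_def inner_complex_def)

lemma herm_self: "herm u u = of_real ((norm u)\<^sup>2)"
  by (simp add: complex_eq_iff herm_def power2_norm_eq_inner inner_vec_def inner_complex_def)

lemma herm_self_1: "norm p = 1 \<Longrightarrow> herm p p = 1"
  by (simp add: herm_self)

lemma herm_eq: "herm u v = Complex (u \<bullet> v) (u \<bullet> (\<i> *s v))"
  by (simp add: complex_eq_iff inner_herm)

lemma of_real_cmod_square: "(complex_of_real (cmod z))\<^sup>2 = z * cnj z"
  by (simp add: complex_norm_square[symmetric])

lemma norm_smult_vec [simp]: "norm (c *s u) = cmod c * norm (u :: complex^'n::finite)"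
proof -
  have "of_real ((norm (c *s u))\<^sup>2) = (c * cnj c) * herm u u"
    unfolding herm_self[symmetric] by simp
  also have "\<dots> = of_real ((cmod c * norm u)\<^sup>2)"
    by (simp add: herm_self power_mult_distrib of_real_cmod_square)
  finally have "(norm (c *s u))\<^sup>2 = (cmod c * norm u)\<^sup>2" unfolding of_real_eq_iff .
  then show ?thesis by simp
qed

lemma scaleR_smult: "r *\<^sub>R u = complex_of_real r *s (u :: complex^'n)"
  by (simp add: vec_eq_iff scaleR_complex)

lemma quat_j_linear [simp]:
  "quat_j (u + v) = quat_j u + quat_j v" "quat_j (c *s u) = cnj c *s quat_j u"
  "quat_j (r *\<^sub>R u) = r *\<^sub>R quat_j u"
  by (simp_all add: quat_j_def vec_eq_iff forall_4)

lemma quat_j_quat_j [simp]: "quat_j (quat_j u) = - u"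
  by (simp add: quat_j_def vec_eq_iff forall_4)

lemma herm_quat_j_quat_j: "herm (quat_j u) (quat_j v) = herm v u"
  by (simp add: quat_j_def herm_def sum_4 algebra_simps)

lemma contact_form_linear [simp]:
  "contact_form (u + v) w = contact_form u w + contact_form v w"
  "contact_form (u - v) w = contact_form u w - contact_form v w"
  "contact_form (c *s u) w = c * contact_form u w"
  "contact_form (r *\<^sub>R u) w = of_real r * contact_form u w"
  "contact_form w (u + v) = contact_form w u + contact_form w v"
  "contact_form w (c *s u) = c * contact_form w u"
  "contact_form w (r *\<^sub>R u) = of_real r * contact_form w u"
  "contact_form w w = 0"
  by (simp_all add: contact_form_expand scaleR_complex algebra_simps)

lemma contact_form_quat_j_left: "contact_form (quat_j u) v = herm v u"
  by (simp add: contact_form_def herm_quat_j_quat_j)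

lemma horizontal_part_herm: "horizontal_part p u = u - herm u p *s p"
  by (simp add: horizontal_part_def herm_eq vec_eq_iff algebra_simps scaleR_complex Complex_eq)

lemma horizontal_herm: "v \<in> horizontal p \<longleftrightarrow> herm v p = 0"
  by (simp add: horizontal_def herm_eq complex_eq_iff)

text \<open>Since k p = i (j p), the real plane is a complex line, and the single complex number
  \<open>contact_form v p\<close> measures the component of v in it.\<close>

lemma D1_eq: "D1 p = range (\<lambda>z. z *s quat_j p)"
proof -
  have "D1 p = {a *\<^sub>R quat_j p + b *\<^sub>R quat_k p | a b. True}"
    unfolding D1_def span_insert span_singleton by (auto simp: algebra_simps)
  also have "\<dots> = range (\<lambda>z. z *s quat_j p)"
  proof (intro equalityI subsetI)
    fix x assume "x \<in> {a *\<^sub>R quat_j p + b *\<^sub>R quat_k p | a b. True}"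
    then obtain a b where "x = a *\<^sub>R quat_j p + b *\<^sub>R quat_k p" by blast
    then have "x = Complex a b *s quat_j p"
      by (simp add: quat_k_def vec_eq_iff Complex_eq scaleR_complex algebra_simps)
    then show "x \<in> range (\<lambda>z. z *s quat_j p)" by blast
  next
    fix x assume "x \<in> range (\<lambda>z. z *s quat_j p)"
    then obtain z where x: "x = z *s quat_j p" by blast
    have "x = Re z *\<^sub>R quat_j p + Im z *\<^sub>R quat_k p"
      by (subst x, subst complex_eq[of z])
        (simp add: quat_k_def vec_eq_iff scaleR_complex algebra_simps)
    then show "x \<in> {a *\<^sub>R quat_j p + b *\<^sub>R quat_k p | a b. True}" by blast
  qed
  finally show ?thesis .
qed

lemma D2_eq: "v \<in> D2 p \<longleftrightarrow> herm v p = 0 \<and> contact_form v p = 0"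
proof -
  have "(\<forall>w\<in>D1 p. v \<bullet> w = 0) \<longleftrightarrow> (\<forall>z. Re (cnj z * contact_form v p) = 0)"
    by (simp add: D1_eq inner_herm contact_form_def)
  also have "\<dots> \<longleftrightarrow> contact_form v p = 0"
  proof
    assume *: "\<forall>z. Re (cnj z * contact_form v p) = 0"
    have "Re (cnj (contact_form v p) * contact_form v p) = 0" using * by blast
    then show "contact_form v p = 0" by (simp add: sum_squares_eq_zero_iff complex_eq_iff)
  qed simp
  finally show ?thesis by (auto simp: D2_def horizontal_herm)
qed

lemma nk_P_contact_form: "nk_P p v = v - (2 * contact_form v p) *s quat_j p"
proof -
  have "contact_form v p = of_real (v \<bullet> quat_j p) + of_real (v \<bullet> quat_k p) * \<i>"
    by (simp add: complex_eq_iff inner_herm contact_form_def quat_k_def)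
  then show ?thesis
    by (simp add: nk_P_def quat_k_def vec_eq_iff scaleR_complex algebra_simps)
qed

text \<open>P subtracts twice the \<open>D1\<close> component. So g is 3/2 + 1/2 = 2 times the
  Fubini-Study metric, diminished once on \<open>D1\<close>: the factor is 2 on \<open>D2\<close>
  and 1 on \<open>D1\<close>.\<close>

lemma nk_metric_herm:
  "nk_metric p v w = 2 * Re (herm v w) - Re (contact_form v p * cnj (contact_form w p))"
  by (simp add: nk_metric_def inner_herm nk_P_contact_form contact_form_def algebra_simps)

lemma contact_form_quat_j_self: "norm p = 1 \<Longrightarrow> contact_form (quat_j p) p = 1"
  by (simp add: contact_form_quat_j_left herm_self)

lemma herm_quat_j_left: "herm (quat_j p) w = cnj (contact_form w p)"
  by (subst herm_commute) (simp add: contact_form_def)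

lemma contact_form_nk_J:
  "norm p = 1 \<Longrightarrow> contact_form (nk_J p v) p = - \<i> * contact_form v p"
  by (simp add: nk_J_def nk_P_contact_form contact_form_quat_j_self)

text \<open>J is i on \<open>D2\<close> and -i on \<open>D1\<close>. The metric factor 2 on
  \<open>D2\<close> gives -2 Im. On \<open>D1\<close> the Hermitian product equals the product of
  the contact values, and the total there must be +1 = 3 - 2.\<close>

lemma nk_metric_nk_J:
  assumes "norm p = 1"
  shows "nk_metric p (nk_J p v) w
    = 3 * Im (contact_form v p * cnj (contact_form w p)) - 2 * Im (herm v w)"
  by (simp add: nk_metric_herm contact_form_nk_J[OF assms])
    (simp add: nk_J_def nk_P_contact_form herm_quat_j_left algebra_simps)

section \<open>Points as complex lines; the Hausdorff quotient topology\<close>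

definition proj :: "complex^4 \<Rightarrow> cp3"
  where "proj v = hopf (v /\<^sub>R norm v)"

lemma hopf_eq_proj: "norm p = 1 \<Longrightarrow> hopf p = proj p"
  by (simp add: proj_def)

text \<open>Every nonzero vector represents a point, so linear formulas can be projected without
  normalizing. The modulus of k is absorbed by the norms; only its phase remains, and that is the
  Hopf action.\<close>

lemma proj_eq_iff:
  assumes "v \<noteq> 0" "w \<noteq> 0"
  shows "proj v = proj w \<longleftrightarrow> (\<exists>k. w = k *s v)"
proof -
  have n: "norm (v /\<^sub>R norm v) = 1" "norm (w /\<^sub>R norm w) = 1" using assms by simp_all
  have "proj v = proj w \<longleftrightarrow> (\<exists>t::real. w /\<^sub>R norm w = cis t *s (v /\<^sub>R norm v))"
    unfolding proj_def by (rule hopf_eq_iff[OF n])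
  also have "\<dots> \<longleftrightarrow> (\<exists>k. w = k *s v)"
  proof
    assume "\<exists>t::real. w /\<^sub>R norm w = cis t *s (v /\<^sub>R norm v)"
    then obtain t :: real where t: "w /\<^sub>R norm w = cis t *s (v /\<^sub>R norm v)" by blast
    have "w = norm w *\<^sub>R (w /\<^sub>R norm w)" using assms by simp
    also have "\<dots> = (of_real (norm w) * cis t * of_real (inverse (norm v))) *s v"
      unfolding t by (simp add: scaleR_smult algebra_simps)
    finally show "\<exists>k. w = k *s v" by blast
  next
    assume "\<exists>k. w = k *s v"
    then obtain k where k: "w = k *s v" by blast
    then have k0: "k \<noteq> 0" using assms by auto
    have "w /\<^sub>R norm w = (k / of_real (cmod k)) *s (v /\<^sub>R norm v)"
      using assms k0 by (simp add: k scaleR_smult divide_simps)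
    moreover have "k / of_real (cmod k) = cis (Arg k)"
      using k0 cis_Arg[of k] by (simp add: sgn_div_norm scaleR_complex divide_inverse mult.commute)
    ultimately show "\<exists>t::real. w /\<^sub>R norm w = cis t *s (v /\<^sub>R norm v)" by auto
  qed
  finally show ?thesis .
qed

lemma proj_smult: "k \<noteq> 0 \<Longrightarrow> v \<noteq> 0 \<Longrightarrow> proj (k *s v) = proj v"
  by (metis proj_eq_iff vector_mul_eq_0)

lemma proj_surj: "\<exists>v. v \<noteq> 0 \<and> proj v = x"
  by (metis hopf_surj hopf_eq_proj norm_zero zero_neq_one)

lemma continuous_on_hopf: "continuous_on (sphere 0 1) hopf"
proof -
  have "openin (top_of_set (sphere 0 1)) (sphere 0 1 \<inter> hopf -` U)" if "open U" for U
  proof -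
    have "sphere 0 1 \<inter> hopf -` U = {p \<in> sphere 0 1. hopf p \<in> U}" by auto
    then show ?thesis using that open_cp3_def by auto
  qed
  then show ?thesis by (simp add: continuous_on_open_gen[where T=UNIV])
qed

text \<open>The quotient topology tests the unit sphere only, so \<Omega> need not contain a whole
  complex line with each of its points.\<close>

lemma open_cp3I:
  assumes "open \<Omega>" "\<And>v. v \<in> \<Omega> \<Longrightarrow> v \<noteq> 0 \<Longrightarrow> proj v \<in> U"
    and "\<And>v. norm v = 1 \<Longrightarrow> proj v \<in> U \<Longrightarrow> v \<in> \<Omega>"
  shows "open U"
proof -
  have "{p \<in> sphere 0 1. hopf p \<in> U} = sphere 0 1 \<inter> \<Omega>"
    using assms(2,3) by (auto simp: hopf_eq_proj) (metis norm_zero zero_neq_one)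
  then show ?thesis unfolding open_cp3_def using assms(1) by (simp add: openin_open_Int)
qed

lemma continuous_on_herm [continuous_intros]:
  "continuous_on S g \<Longrightarrow> continuous_on S h \<Longrightarrow> continuous_on S (\<lambda>x. herm (g x) (h x))"
  unfolding herm_def by (intro continuous_intros)

text \<open>Pythagoras: 1 - |herm p q|^2 is the squared distance from p to the complex line of q,
  and it vanishes only if both give the same point.\<close>

lemma norm_herm_less:
  assumes "norm p = 1" "norm q = 1" "hopf p \<noteq> hopf q"
  shows "cmod (herm p q) < 1"
proof -
  define d where "d = p - herm p q *s q"
  have "d \<noteq> 0"
  proof
    assume "d = 0"
    then have "p = herm p q *s q" by (simp add: d_def)
    then have "proj q = proj p" using assms(1,2) by (metis norm_zero zero_neq_one proj_eq_iff)
    then show False using assms by (simp add: hopf_eq_proj)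
  qed
  moreover have "(norm d)\<^sup>2 = 1 - (cmod (herm p q))\<^sup>2"
  proof -
    have "of_real ((norm d)\<^sup>2) = 1 - herm p q * cnj (herm p q)"
      unfolding herm_self[symmetric]
      by (simp add: d_def herm_self_1 assms herm_commute[of q p] algebra_simps)
    also have "\<dots> = of_real (1 - (cmod (herm p q))\<^sup>2)" by (simp add: of_real_cmod_square)
    finally show ?thesis unfolding of_real_eq_iff .
  qed
  ultimately have "(cmod (herm p q))\<^sup>2 < 1\<^sup>2" by (smt (verit) zero_less_norm_iff zero_less_power one_power2)
  then show ?thesis by (rule power_less_imp_less_base) simp
qed

text \<open>The points are separated by comparing |herm v p| with r |v|, where r lies strictly
  between the ratio |herm q p| at q and the ratio 1 at p. Both conditions are homogeneous in v and
  descend. The Hausdorff property later makes a compact image closed.\<close>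

instance cp3 :: t2_space
proof
  fix x y :: cp3 assume "x \<noteq> y"
  obtain p q where p: "norm p = 1" "hopf p = x" and q: "norm q = 1" "hopf q = y"
    using hopf_surj by metis
  define r where "r = (1 + cmod (herm q p)) / 2"
  have r: "cmod (herm q p) < r" "r < 1"
    using norm_herm_less[OF q(1) p(1)] \<open>x \<noteq> y\<close> p q by (auto simp: r_def)
  define A where "A = {v. r * norm v < cmod (herm v p)}"
  define B where "B = {v. cmod (herm v p) < r * norm v}"
  have oA: "open A" and oB: "open B" unfolding A_def B_def
    by (intro open_Collect_less continuous_intros)+
  have inv: "k *s v \<in> A \<longleftrightarrow> v \<in> A" "k *s v \<in> B \<longleftrightarrow> v \<in> B" if "k \<noteq> 0" for k v
    using that by (auto simp: A_def B_def norm_mult mult.left_commute[of r])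
  define U where "U = proj ` (A - {0})"
  define V where "V = proj ` (B - {0})"
  have sat: "v \<in> C" if sat: "\<forall>k v. k \<noteq> 0 \<longrightarrow> (k *s v \<in> C \<longleftrightarrow> v \<in> C)" "norm v = 1" "proj v \<in> proj ` (C - {0})" for v C
  proof -
    obtain w where w: "w \<in> C" "w \<noteq> 0" "proj w = proj v" using sat(3) by (smt (verit) DiffE imageE singletonI)
    have "v \<noteq> 0" using sat(2) by auto
    then obtain k where "v = k *s w" using w proj_eq_iff by blast
    moreover have "k \<noteq> 0" using \<open>v \<noteq> 0\<close> calculation by auto
    ultimately show ?thesis using sat(1) w(1) by blast
  qed
  have satA: "v \<in> A" if "norm v = 1" "proj v \<in> U" for v
    by (rule sat) (use inv(1) that U_def in \<open>blast+\<close>)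
  have satB: "v \<in> B" if "norm v = 1" "proj v \<in> V" for v
    by (rule sat) (use inv(2) that V_def in \<open>blast+\<close>)
  have "open U" using oA by (rule open_cp3I) (simp add: U_def, rule satA)
  moreover have "open V" using oB by (rule open_cp3I) (simp add: V_def, rule satB)
  moreover have "x \<in> U"
  proof -
    have "p \<in> A - {0}" using p r by (auto simp: A_def herm_self)
    then show ?thesis unfolding U_def using p by (metis hopf_eq_proj imageI)
  qed
  moreover have "y \<in> V"
  proof -
    have "q \<in> B - {0}" using q r by (auto simp: B_def)
    then show ?thesis unfolding V_def using q by (metis hopf_eq_proj imageI)
  qed
  moreover have "U \<inter> V = {}"
  proof (rule ccontr)
    assume "U \<inter> V \<noteq> {}"
    then obtain v w where vw: "v \<in> A" "v \<noteq> 0" "w \<in> B" "w \<noteq> 0" "proj v = proj w"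
      unfolding U_def V_def by fastforce
    then obtain k where "w = k *s v" using proj_eq_iff by blast
    moreover have "k \<noteq> 0" using vw calculation by auto
    ultimately have "v \<in> B" using inv vw by blast
    then show False using vw by (auto simp: A_def B_def)
  qed
  ultimately show "\<exists>U V. open U \<and> open V \<and> x \<in> U \<and> y \<in> V \<and> U \<inter> V = {}" by blast
qed

section \<open>Holomorphic curves of constant contact angle\<close>

text \<open>Equality case of Cauchy-Schwarz: the Hermitian product \<phi> with the fixed value at z0
  is holomorphic, has modulus at most K and equals K at z0. The maximum principle makes it constant,
  and then the squared distance 2 K - 2 Re \<phi> of the two values is zero.\<close>

lemma holomorphic_constant_norm:
  fixes G :: "'i \<Rightarrow> complex \<Rightarrow> complex"
  assumes "finite I" "open S" "connected S"
    and hol: "\<And>i. i \<in> I \<Longrightarrow> G i holomorphic_on S"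
    and norm: "\<And>z. z \<in> S \<Longrightarrow> (\<Sum>i\<in>I. (cmod (G i z))\<^sup>2) = K"
    and "z \<in> S" "z0 \<in> S" "i \<in> I"
  shows "G i z = G i z0"
proof -
  define \<phi> where "\<phi> z = (\<Sum>i\<in>I. G i z * cnj (G i z0))" for z
  have split: "(\<Sum>i\<in>I. (cmod (G i z - G i z0))\<^sup>2) = 2 * K - 2 * Re (\<phi> z)" if "z \<in> S" for z
  proof -
    have "(cmod (G i z - G i z0))\<^sup>2 = (cmod (G i z))\<^sup>2 + (cmod (G i z0))\<^sup>2 - 2 * Re (G i z * cnj (G i z0))" for i
      unfolding cmod_power2 by (simp add: power2_eq_square algebra_simps)
    then show ?thesis using norm[OF that] norm[OF \<open>z0 \<in> S\<close>]
      by (simp add: sum.distrib sum_subtractf \<phi>_def flip: sum_distrib_left)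
  qed
  have phi0: "\<phi> z0 = of_real K"
    using norm[OF \<open>z0 \<in> S\<close>] by (auto simp: \<phi>_def simp flip: of_real_sum complex_norm_square of_real_power)
  have "K \<ge> 0" using norm[OF \<open>z0 \<in> S\<close>] by (auto intro: sum_nonneg)
  have "cmod (\<phi> z) \<le> cmod (\<phi> z0)" if "z \<in> S" for z
  proof -
    have "cmod (\<phi> z) \<le> (\<Sum>i\<in>I. cmod (G i z) * cmod (G i z0))"
      unfolding \<phi>_def by (rule order_trans[OF norm_sum]) (simp add: norm_mult)
    also have "\<dots> \<le> L2_set (\<lambda>i. cmod (G i z)) I * L2_set (\<lambda>i. cmod (G i z0)) I"
      using L2_set_mult_ineq[of "\<lambda>i. cmod (G i z)" "\<lambda>i. cmod (G i z0)" I] by simp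
    also have "\<dots> = K" using norm[OF that] norm[OF \<open>z0 \<in> S\<close>] \<open>K \<ge> 0\<close> by (simp add: L2_set_def)
    finally show ?thesis using phi0 \<open>K \<ge> 0\<close> by simp
  qed
  moreover have "\<phi> holomorphic_on S" unfolding \<phi>_def by (intro holomorphic_intros hol)
  ultimately have "\<phi> constant_on S"
    using maximum_modulus_principle[of \<phi> S S z0] assms by blast
  then have "\<phi> z = of_real K" using phi0 \<open>z \<in> S\<close> \<open>z0 \<in> S\<close> by (metis constant_on_def)
  then have "(\<Sum>i\<in>I. (cmod (G i z - G i z0))\<^sup>2) = 0" using split[OF \<open>z \<in> S\<close>] by simp
  then show ?thesis using \<open>finite I\<close> \<open>i \<in> I\<close> by (simp add: sum_nonneg_eq_0_iff)
qed

definition wedge :: "complex^4 \<Rightarrow> complex^4 \<Rightarrow> 4 \<Rightarrow> 4 \<Rightarrow> complex"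
  where "wedge u v c d = u $ c * v $ d - u $ d * v $ c"

text \<open>The sum runs over ordered pairs, so each Pluecker coordinate counts twice. For unit p
  and orthogonal X this gives 2 |X|^2, which is 3 |\<omega>(X, p)|^2 on a totally real complex line:
  the constant 3 below.\<close>

definition wedge_norm2 :: "complex^4 \<Rightarrow> complex^4 \<Rightarrow> real"
  where "wedge_norm2 u v = (\<Sum>(c, d)\<in>UNIV. (cmod (wedge u v c d))\<^sup>2)"

lemma Lagrange_identity:
  "wedge_norm2 u v = 2 * ((norm u)\<^sup>2 * (norm v)\<^sup>2 - (cmod (herm u v))\<^sup>2)"
proof -
  have "complex_of_real (wedge_norm2 u v)
      = (\<Sum>c\<in>UNIV. \<Sum>d\<in>UNIV. wedge u v c d * cnj (wedge u v c d))"
    by (simp add: wedge_norm2_def of_real_cmod_square UNIV_Times_UNIV[symmetric]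
        sum.cartesian_product[symmetric] del: UNIV_Times_UNIV)
  also have "\<dots> = 2 * (herm u u * herm v v - herm u v * cnj (herm u v))"
    by (simp add: herm_def wedge_def sum_4 algebra_simps)
  also have "\<dots> = complex_of_real (2 * ((norm u)\<^sup>2 * (norm v)\<^sup>2 - (cmod (herm u v))\<^sup>2))"
    by (simp add: herm_self of_real_cmod_square)
  finally show ?thesis unfolding of_real_eq_iff .
qed

text \<open>The squared modulus of \<open>contact_form\<close> picks up the same factor |k l|^2, so
  the angle equation passes from a unit lift and a horizontal tangent vector to any affine lift and
  its derivative.\<close>

lemma wedge_norm2_transform:
  "wedge_norm2 (k *s u) (l *s v + m *s u) = (cmod (k * l))\<^sup>2 * wedge_norm2 u v"
proof -
  have "wedge (k *s u) (l *s v + m *s u) c d = k * l * wedge u v c d" for c d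
    by (simp add: wedge_def algebra_simps)
  then show ?thesis
    by (simp add: wedge_norm2_def norm_mult power_mult_distrib sum_distrib_left case_prod_beta)
qed

text \<open>
  Normalizing the wedge of a curve and its derivative by the contact form gives a holomorphic map
  of constant norm.
\<close>

lemma holomorphic_curve_is_line:
  fixes H H' :: "complex \<Rightarrow> complex^4"
  assumes S: "open S" "convex S" and z0: "z0 \<in> S"
    and der: "\<And>z c. z \<in> S \<Longrightarrow> ((\<lambda>z. H z $ c) has_field_derivative H' z $ c) (at z)"
    and coord: "\<And>z. z \<in> S \<Longrightarrow> H z $ a = 1" "\<And>z. z \<in> S \<Longrightarrow> H z $ b = z"
    and angle: "\<And>z. z \<in> S \<Longrightarrow> wedge_norm2 (H z) (H' z) = 3 * (cmod (contact_form (H' z) (H z)))\<^sup>2"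
    and z: "z \<in> S"
  shows "H' z = H' z0" "H z = H z0 + (z - z0) *s H' z0"
proof -
  have holH: "(\<lambda>z. H z $ c) holomorphic_on S" for c
    using der S(1) by (auto simp: holomorphic_on_open)
  have holH': "(\<lambda>z. H' z $ c) holomorphic_on S" for c
  proof -
    have "deriv (\<lambda>z. H z $ c) holomorphic_on S" using holH S(1) by (rule holomorphic_deriv)
    moreover have "deriv (\<lambda>z. H z $ c) w = H' w $ c" if "w \<in> S" for w
      using der[OF that] by (rule DERIV_imp_deriv)
    ultimately show ?thesis by (simp cong: holomorphic_cong)
  qed
  have H'ab: "H' z $ a = 0" "H' z $ b = 1" if z: "z \<in> S" for z
  proof -
    have "((\<lambda>z. H z $ a) has_field_derivative 0) (at z)"
      by (rule has_field_derivative_transform_within_open[OF DERIV_const S(1) z])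
        (simp add: coord)
    then show "H' z $ a = 0" using der[OF z] DERIV_unique by blast
    have "((\<lambda>z. H z $ b) has_field_derivative 1) (at z)"
      by (rule has_field_derivative_transform_within_open[OF DERIV_ident S(1) z])
        (simp add: coord)
    then show "H' z $ b = 1" using der[OF z] DERIV_unique by blast
  qed
  define \<omega> where "\<omega> z = contact_form (H' z) (H z)" for z
  define G where "G cd z = wedge (H z) (H' z) (fst cd) (snd cd) / \<omega> z" for cd z
  \<comment> \<open>Coordinate \<open>a\<close> of H is 1 and that of H' is 0, so row
    \<open>a\<close> of the wedge is H' itself; this row alone carries the conclusion.\<close>
  have Wab: "wedge (H z) (H' z) a d = H' z $ d" if "z \<in> S" for z d
    using coord H'ab that by (simp add: wedge_def)
  have \<omega>0: "\<omega> z \<noteq> 0" if "z \<in> S" for z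
  proof
    assume "\<omega> z = 0"
    then have "(\<Sum>cd\<in>UNIV. (cmod (wedge (H z) (H' z) (fst cd) (snd cd)))\<^sup>2) = 0"
      using angle[OF that] by (simp add: \<omega>_def wedge_norm2_def case_prod_beta)
    then have "\<forall>cd. wedge (H z) (H' z) (fst cd) (snd cd) = 0"
      by (simp add: sum_nonneg_eq_0_iff)
    then have "wedge (H z) (H' z) a b = 0" by simp
    then show False using Wab[OF that] H'ab[OF that] by simp
  qed
  have "G cd holomorphic_on S" for cd
    unfolding G_def wedge_def \<omega>_def contact_form_expand
    by (intro holomorphic_intros holH holH') (use \<omega>0 in \<open>simp add: \<omega>_def contact_form_expand\<close>)
  moreover have "(\<Sum>cd\<in>UNIV. (cmod (G cd z))\<^sup>2) = 3" if "z \<in> S" for z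
    using angle[OF that] \<omega>0[OF that]
    by (simp add: G_def \<omega>_def wedge_norm2_def case_prod_beta norm_divide power_divide
        flip: sum_divide_distrib)
  ultimately have G: "G cd z = G cd w" if "z \<in> S" "w \<in> S" for cd z w
    using holomorphic_constant_norm[of UNIV S G 3 z w cd] S that by (simp add: convex_connected)
  have Gd: "H' z $ d / \<omega> z = H' w $ d / \<omega> w" if "z \<in> S" "w \<in> S" for z w d
    using G[OF that, of "(a, d)"] Wab[OF that(1), of d] Wab[OF that(2), of d] by (simp only: G_def fst_conv snd_conv)
  \<comment> \<open>Coordinate \<open>b\<close> of H' is 1, so the entry (a, b) of the quotient is
    1/\<omega>. This separates \<omega> from H' and makes each of them constant.\<close>
  have "\<omega> z = \<omega> w" if "z \<in> S" "w \<in> S" for z w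
    using Gd[OF that, of b] H'ab(2)[OF that(1)] H'ab(2)[OF that(2)] by simp
  then have H'const: "H' z = H' w" if "z \<in> S" "w \<in> S" for z w
    using Gd[OF that] \<omega>0[OF that(2)] that unfolding vec_eq_iff by (metis divide_cancel_right)
  show "H' z = H' z0" using H'const z z0 by blast
  show "H z = H z0 + (z - z0) *s H' z0"
  proof -
    have "\<exists>k. \<forall>z\<in>S. H z $ c - z * H' z0 $ c = k" for c
    proof (rule has_field_derivative_zero_constant)
      fix w assume "w \<in> S"
      have "((\<lambda>z. H z $ c - z * H' z0 $ c) has_field_derivative (H' w $ c - H' z0 $ c)) (at w within S)"
        by (auto intro!: derivative_eq_intros has_field_derivative_at_within[OF der[OF \<open>w \<in> S\<close>]])
      then show "((\<lambda>z. H z $ c - z * H' z0 $ c) has_field_derivative 0) (at w within S)"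
        using H'const[OF z0 \<open>w \<in> S\<close>] by simp
    qed (use S in auto)
    then have "H z $ c - z * H' z0 $ c = H z0 $ c - z0 * H' z0 $ c" for c
      using z z0 by metis
    then show ?thesis by (simp add: vec_eq_iff algebra_simps)
  qed
qed

section \<open>From a smooth real surface to a holomorphic curve\<close>

lemma smooth_on_has_derivative:
  assumes "smooth_on F V" "x \<in> V"
  shows "(F has_derivative frechet_derivative F (at x)) (at x)"
  using assms unfolding smooth_on_def by (metis Ck_on.simps(2) frechet_derivative_works)

lemma smooth_on_continuous: "smooth_on F V \<Longrightarrow> continuous_on V F"
  unfolding smooth_on_def by (metis Ck_on.simps(1))

lemma smooth_on_continuous_derivative:
  "smooth_on F V \<Longrightarrow> continuous_on V (\<lambda>x. frechet_derivative F (at x) v)"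
  unfolding smooth_on_def by (metis Ck_on.simps)

lemma linear_horizontal_part: "linear (horizontal_part p)"
  by (rule linearI) (simp_all add: horizontal_part_def inner_left_distrib algebra_simps)

lemma linear_hopf_differential:
  assumes "smooth_on F V" "x \<in> V"
  shows "linear (hopf_differential F x)"
  using linear_compose[OF has_derivative_linear[OF smooth_on_has_derivative[OF assms]]
      linear_horizontal_part[of "F x"]]
  by (simp add: hopf_differential_def[abs_def] o_def)

text \<open>The image \<xi> of one basis vector and its multiple i \<xi> are both in the range.
  Their preimages define a real isomorphism from the complex numbers to the plane that D turns into
  z \<mapsto> z \<xi>; L is its inverse.\<close>

lemma complex_line_param:
  fixes D :: "real^2 \<Rightarrow> complex^4"
  assumes D: "linear D" "inj D" and inv: "(\<lambda>v. \<i> *s v) ` range D = range D"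
  obtains \<xi> L where "linear L" "bij L" "\<And>v. D v = L v *s \<xi>" "\<xi> \<noteq> 0"
proof -
  define e :: "real^2" where "e = axis 1 1"
  define \<xi> where "\<xi> = D e"
  have "e \<noteq> 0" by (simp add: e_def axis_eq_0_iff)
  then have \<xi>0: "\<xi> \<noteq> 0" unfolding \<xi>_def using D by (metis linear_injective_0)
  have "\<i> *s \<xi> \<in> range D" using inv unfolding \<xi>_def by blast
  then obtain u where u: "D u = \<i> *s \<xi>" by auto
  define M where "M z = Re z *\<^sub>R e + Im z *\<^sub>R u" for z
  have lM: "linear M" by (rule linearI) (simp_all add: M_def algebra_simps)
  have DM: "D (M z) = z *s \<xi>" for z
  proof -
    have "D (M z) = Re z *\<^sub>R \<xi> + Im z *\<^sub>R (\<i> *s \<xi>)"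
      by (simp add: M_def linear_add[OF D(1)] linear_scale[OF D(1)] u \<xi>_def)
    also have "\<dots> = (of_real (Re z) + of_real (Im z) * \<i>) *s \<xi>"
      by (simp add: scaleR_smult vec_eq_iff algebra_simps)
    also have "of_real (Re z) + of_real (Im z) * \<i> = z" by (simp add: complex_eq_iff)
    finally show ?thesis .
  qed
  have injM: "inj M"
    unfolding linear_injective_0[OF lM] using DM \<xi>0 linear_0[OF D(1)]
    by (metis vector_mul_eq_0)
  have "dim (range M) = DIM(real^2)"
    using dim_image_eq[OF lM, of UNIV] injM by simp
  moreover have "subspace (range M)" using lM linear_subspace_image subspace_UNIV by blast
  ultimately have surjM: "surj M" using dim_eq_full[of "range M"] span_eq_iff[of "range M"] by simp
  have bijM: "bij M" using injM surjM by (rule bijI)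
  show thesis
  proof
    have MI: "M (inv M v) = v" for v using surjM by (rule surj_f_inv_f)
    show "linear (inv M)"
      by (rule linearI; rule injD[OF injM]) (simp_all add: MI linear_add[OF lM] linear_scale[OF lM])
    show "bij (inv M)" using bijM by (rule bij_imp_bij_inv)
    show "D v = inv M v *s \<xi>" for v using DM[of "inv M v"] surjM by (simp add: surj_f_inv_f)
  qed (rule \<xi>0)
qed

text \<open>With F_a nonzero near x0, the affine coordinates F_c / F_a have differentials L
  \<eta>_c, with one real isomorphism L for all c. So they are complex multiples of each other, and
  with coordinate \<open>b\<close> as parameter the other coordinates are holomorphic. The pair P, Q
  then comes from \<open>holomorphic_curve_is_line\<close>.\<close>

lemma line_chart:
  fixes F :: "real^2 \<Rightarrow> complex^4"
  assumes V: "open V" "x0 \<in> V" and F: "smooth_on F V"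
    and norm: "\<And>x. x \<in> V \<Longrightarrow> norm (F x) = 1"
    and inj: "\<And>x. x \<in> V \<Longrightarrow> inj (hopf_differential F x)"
    and cpx: "\<And>x. x \<in> V \<Longrightarrow> (\<lambda>v. \<i> *s v) ` tangent_space F x = tangent_space F x"
    and real: "\<And>x X Y. x \<in> V \<Longrightarrow> X \<in> tangent_space F x \<Longrightarrow> Y \<in> tangent_space F x
      \<Longrightarrow> nk_metric (F x) (nk_J (F x) X) Y = 0"
  obtains N S P Q a b where "open N" "x0 \<in> N" "N \<subseteq> V" "open S"
    "P $ a = 1" "P $ b = 0" "Q $ a = 0" "Q $ b = 1"
    "(\<lambda>x. hopf (F x)) ` N = (\<lambda>z. proj (P + z *s Q)) ` S"
    "wedge_norm2 P Q = 3 * (cmod (contact_form Q P))\<^sup>2"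
proof -
  let ?D = "\<lambda>x. frechet_derivative F (at x)"
  have der: "(F has_derivative ?D x) (at x)" if "x \<in> V" for x
    using smooth_on_has_derivative[OF F that] .
  have derc: "((\<lambda>x. F x $ c) has_derivative (\<lambda>v. ?D x v $ c)) (at x)" if "x \<in> V" for x c
    using bounded_linear.has_derivative[OF bounded_linear_vec_nth der[OF that]] .
  have contD: "continuous_on V (\<lambda>x. ?D x v)" for v
    by (rule smooth_on_continuous_derivative[OF F])
  have contF: "continuous_on V F" by (rule smooth_on_continuous[OF F])
  have "F x0 \<noteq> 0" using norm[OF V(2)] by auto
  then obtain a where a: "F x0 $ a \<noteq> 0" by (auto simp: vec_eq_iff)
  define V1 where "V1 = {x \<in> V. F x $ a \<noteq> 0}"
  have oV1: "open V1"
  proof -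
    have "open (V \<inter> (\<lambda>x. F x $ a) -` (- {0}))"
      by (rule continuous_open_preimage) (intro continuous_intros contF V | simp)+
    moreover have "V1 = V \<inter> (\<lambda>x. F x $ a) -` (- {0})" by (auto simp: V1_def)
    ultimately show ?thesis by simp
  qed
  have x0: "x0 \<in> V1" using a V(2) by (simp add: V1_def)
  have V1V: "x \<in> V" if "x \<in> V1" for x using that by (simp add: V1_def)
  define w where "w c x = F x $ c / F x $ a" for c x
  define w' where "w' c x v = (?D x v $ c - ?D x v $ a * w c x) / F x $ a" for c x v
  have derw: "(w c has_derivative w' c x) (at x)" if "x \<in> V1" for c x
  proof -
    have nz: "F x $ a \<noteq> 0" using that by (simp add: V1_def)
    show ?thesis unfolding w_def[abs_def] w'_def[abs_def]
      by (rule has_derivative_eq_rhs[OF has_derivative_divide'[OF derc derc]])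
        (use nz V1V[OF that] in \<open>auto simp: field_simps power2_eq_square\<close>)
  qed
  have "\<exists>\<xi> L. linear L \<and> bij L \<and> (\<forall>v. hopf_differential F x v = L v *s \<xi>) \<and> \<xi> \<noteq> 0"
    if "x \<in> V" for x
    using complex_line_param[OF linear_hopf_differential[OF F that] inj[OF that] cpx[OF that]]
    by metis
  then obtain \<xi> L where L: "\<And>x. x \<in> V \<Longrightarrow> linear (L x)" "\<And>x. x \<in> V \<Longrightarrow> bij (L x)"
    and \<xi>: "\<And>x v. x \<in> V \<Longrightarrow> hopf_differential F x v = L x v *s \<xi> x"
    and \<xi>0: "\<And>x. x \<in> V \<Longrightarrow> \<xi> x \<noteq> 0" by metis
  have \<xi>T: "z *s \<xi> x \<in> tangent_space F x" if "x \<in> V" for x z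
    using \<xi>[OF that, of "inv (L x) z"] L(2)[OF that] by (metis bij_inv_eq_iff rangeI)
  have \<xi>F: "herm (\<xi> x) (F x) = 0" if "x \<in> V" for x
  proof -
    have "\<xi> x \<in> range (hopf_differential F x)" using \<xi>T[OF that, of 1] by simp
    then obtain v where "\<xi> x = hopf_differential F x v" by blast
    then show ?thesis using norm[OF that]
      by (simp add: hopf_differential_def horizontal_part_herm herm_self_1)
  qed
  have \<xi>angle: "2 * (norm (\<xi> x))\<^sup>2 = 3 * (cmod (contact_form (\<xi> x) (F x)))\<^sup>2" if "x \<in> V" for x
  proof -
    have "nk_metric (F x) (nk_J (F x) (\<i> *s \<xi> x)) (\<xi> x) = 0"
      using real[OF that \<xi>T[OF that, of "\<i>"] \<xi>T[OF that, of 1]] by simp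
    then show ?thesis
      by (simp add: nk_metric_nk_J[OF norm[OF that]] herm_self cmod_power2)
        (simp add: power2_eq_square)
  qed
  \<comment> \<open>The derivative of F / F_a in the direction \<xi>. The vertical part of dF is a
    multiple of F and cancels in the quotient, so only the horizontal vector \<xi> enters.\<close>
  define \<eta> where "\<eta> x = (1 / F x $ a) *s (\<xi> x - (\<xi> x $ a / F x $ a) *s F x)" for x
  have w'L: "w' c x v = L x v * \<eta> x $ c" if "x \<in> V1" for c x v
  proof -
    have nz: "F x $ a \<noteq> 0" using that by (simp add: V1_def)
    have "?D x v = L x v *s \<xi> x + herm (?D x v) (F x) *s F x"
      using \<xi>[OF V1V[OF that], of v]
      by (simp add: hopf_differential_def horizontal_part_herm diff_eq_eq)
    then have "?D x v $ i = L x v * \<xi> x $ i + herm (?D x v) (F x) * F x $ i" for i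
      by (metis vector_add_component vector_smult_component)
    then show ?thesis using nz by (simp add: w'_def w_def \<eta>_def field_simps)
  qed
  have "\<eta> x0 \<noteq> 0"
  proof
    assume "\<eta> x0 = 0"
    then have "\<xi> x0 - (\<xi> x0 $ a / F x0 $ a) *s F x0 = 0"
      using a unfolding \<eta>_def vector_mul_eq_0 by simp
    then obtain k where k: "\<xi> x0 = k *s F x0" by auto
    then have "k = 0" using \<xi>F[OF V(2)] norm[OF V(2)] by (simp add: herm_self_1)
    then have "\<xi> x0 = 0" using k by simp
    then show False using \<xi>0[OF V(2)] by simp
  qed
  then obtain b where b: "\<eta> x0 $ b \<noteq> 0" by (auto simp: vec_eq_iff)
  \<comment> \<open>\<open>e\<close> and \<open>e'\<close> identify the complex plane with
    \<real>^2, so that coordinate \<open>b\<close> becomes a self-map of \<real>^2, to which the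
    inverse function theorem applies.\<close>
  define e :: "complex \<Rightarrow> real^2" where "e z = vector [Re z, Im z]" for z
  define e' :: "real^2 \<Rightarrow> complex" where "e' y = Complex (y $ 1) (y $ 2)" for y
  have ee': "e (e' y) = y" "e' (e z) = z" for y z
    by (simp_all add: e_def e'_def vec_eq_iff forall_2)
  have le: "linear e" by (rule linearI) (simp_all add: e_def vec_eq_iff forall_2)
  have le': "linear e'" by (rule linearI) (simp_all add: e'_def complex_eq_iff)
  have ble: "bounded_linear e" "bounded_linear e'" using le le' by (simp_all add: linear_conv_bounded_linear)
  have bije: "bij e" by (rule bij_betw_byWitness[where f'=e']) (simp_all add: ee')
  define f where "f x = e (w b x)" for x
  define f' where "f' x = Blinfun (\<lambda>v. e (w' b x v))" for x
  have derf0: "(f has_derivative (\<lambda>v. e (w' b x v))) (at x)" if "x \<in> V1" for x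
    unfolding f_def[abs_def] by (rule bounded_linear.has_derivative[OF ble(1) derw[OF that]])
  have f': "blinfun_apply (f' x) = (\<lambda>v. e (w' b x v))" if "x \<in> V1" for x
    unfolding f'_def by (rule bounded_linear_Blinfun_apply[OF has_derivative_bounded_linear[OF derf0[OF that]]])
  have derf: "(f has_derivative blinfun_apply (f' x)) (at x)" if "x \<in> V1" for x
    using derf0[OF that] f'[OF that] by simp
  have contf: "continuous_on V1 f'"
  proof (rule continuous_on_blinfun_componentwise)
    fix i :: "real^2"
    have "continuous_on V1 (\<lambda>x. e (w' b x i))"
      unfolding w'_def w_def
      by (intro continuous_intros bounded_linear.continuous_on[OF ble(1)]
          continuous_on_subset[OF contD] continuous_on_subset[OF contF]) (auto simp: V1_def)
    then show "continuous_on V1 (\<lambda>x. blinfun_apply (f' x) i)"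
      using f' by (simp cong: continuous_on_cong)
  qed
  have bijf': "bij (blinfun_apply (f' x0))"
  proof -
    have "bij (\<lambda>z. z * \<eta> x0 $ b)"
      using b by (intro bij_betw_byWitness[where f'="\<lambda>z. z / \<eta> x0 $ b"]) auto
    then have "bij (e \<circ> (\<lambda>z. z * \<eta> x0 $ b) \<circ> L x0)"
      using L(2)[OF V(2)] bije by (intro bij_comp)
    then show ?thesis by (simp add: f'[OF x0] w'L[OF x0] o_def)
  qed
  define invf where "invf = Blinfun (inv (blinfun_apply (f' x0)))"
  have "bounded_linear (inv (blinfun_apply (f' x0)))"
    using inj_linear_imp_inv_linear[OF _ bij_is_inj[OF bijf']]
    by (simp add: linear_conv_bounded_linear blinfun.bounded_linear_right)
  then have "invf o\<^sub>L f' x0 = id_blinfun"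
    using bijf' by (intro blinfun_eqI) (simp add: invf_def bounded_linear_Blinfun_apply inv_f_f bij_is_inj)
  then obtain U' S' g g' where U': "open U'" "U' \<subseteq> V1" "x0 \<in> U'" and S': "open S'" "f x0 \<in> S'"
    and hom: "homeomorphism U' S' f g"
    and derg: "\<And>y. y \<in> S' \<Longrightarrow> (g has_derivative g' y) (at y)"
    and g': "\<And>y. y \<in> S' \<Longrightarrow> g' y = inv (blinfun_apply (f' (g y)))"
    and bijg: "\<And>y. y \<in> S' \<Longrightarrow> bij (blinfun_apply (f' (g y)))"
    using inverse_function_theorem[OF oV1 derf contf x0] by blast
  have "open (e -` S')"
    using S'(1) bounded_linear.continuous_on[OF ble(1) continuous_on_id]
    by (simp add: open_vimage)
  moreover have "e' (f x0) \<in> e -` S'" using S'(2) by (simp add: ee')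
  ultimately obtain r where r: "r > 0" "ball (e' (f x0)) r \<subseteq> e -` S'"
    by (meson openE)
  \<comment> \<open>A ball, because the holomorphic argument needs a convex parameter
    domain.\<close>
  define S where "S = ball (e' (f x0)) r"
  have SS': "e z \<in> S'" if "z \<in> S" for z using r that by (auto simp: S_def)
  define H where "H z = (\<chi> c. w c (g (e z)))" for z
  define H' where "H' z = (1 / \<eta> (g (e z)) $ b) *s \<eta> (g (e z))" for z
  have gU: "g (e z) \<in> U'" and fg: "f (g (e z)) = e z" if "z \<in> S" for z
    using hom SS'[OF that] by (auto simp: homeomorphism_def)
  have gV1: "g (e z) \<in> V1" if "z \<in> S" for z using gU[OF that] U'(2) by auto
  have gg': "w' b (g (e z)) (g' (e z) (e t)) = t" if "z \<in> S" for z t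
  proof -
    have "e (w' b (g (e z)) (g' (e z) (e t))) = e t"
      using bijg[OF SS'[OF that]] g'[OF SS'[OF that]] f'[OF gV1[OF that]]
      by (metis bij_is_surj surj_f_inv_f)
    then show ?thesis by (metis ee'(2))
  qed
  have \<eta>b: "\<eta> (g (e z)) $ b \<noteq> 0" if "z \<in> S" for z
    using gg'[OF that, of 1] w'L[OF gV1[OF that]] by (metis mult_zero_right zero_neq_one)
  \<comment> \<open>By \<open>gg'\<close> the factor L equals t / \<eta>_b on the vector that
    belongs to t. Hence coordinate c has derivative (\<eta>_c / \<eta>_b) t, complex linear in t:
    the Cauchy-Riemann equations.\<close>
  have derH: "((\<lambda>z. H z $ c) has_field_derivative H' z $ c) (at z)" if "z \<in> S" for z c
  proof -
    have "((\<lambda>z. w c (g (e z))) has_derivative (\<lambda>t. w' c (g (e z)) (g' (e z) (e t)))) (at z)"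
      using has_derivative_compose[OF has_derivative_compose[OF bounded_linear.has_derivative[OF ble(1) has_derivative_ident] derg[OF SS'[OF that]]] derw[OF gV1[OF that], of c]] .
    moreover have "w' c (g (e z)) (g' (e z) (e t)) = H' z $ c * t" for t
      using gg'[OF that, of t] \<eta>b[OF that]
      by (simp add: w'L[OF gV1[OF that]] H'_def field_simps)
    ultimately show ?thesis by (simp add: has_field_derivative_def H_def)
  qed
  have Ha: "H z $ a = 1" if "z \<in> S" for z
    using gV1[OF that] by (simp add: H_def w_def V1_def)
  have Hb: "H z $ b = z" if "z \<in> S" for z
    using fg[OF that] by (simp add: H_def f_def) (metis ee'(2))
  have angle: "wedge_norm2 (H z) (H' z) = 3 * (cmod (contact_form (H' z) (H z)))\<^sup>2" if "z \<in> S" for z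
  proof -
    define x where "x = g (e z)"
    have x: "x \<in> V" "F x $ a \<noteq> 0" "\<eta> x $ b \<noteq> 0"
      using gV1[OF that] \<eta>b[OF that] by (simp_all add: x_def V1_def)
    define k where "k = 1 / F x $ a"
    define l where "l = 1 / (F x $ a * \<eta> x $ b)"
    define m where "m = - l * \<xi> x $ a / F x $ a"
    have H: "H z = k *s F x" by (simp add: H_def w_def vec_eq_iff k_def flip: x_def)
    have H': "H' z = l *s \<xi> x + m *s F x"
      by (simp add: H'_def l_def m_def \<eta>_def vec_eq_iff algebra_simps flip: x_def)
    have "wedge_norm2 (H z) (H' z) = (cmod (k * l))\<^sup>2 * wedge_norm2 (F x) (\<xi> x)"
      unfolding H H' by (rule wedge_norm2_transform)
    also have "wedge_norm2 (F x) (\<xi> x) = 2 * (norm (\<xi> x))\<^sup>2"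
      using \<xi>F[OF x(1)] herm_commute[of "F x" "\<xi> x"] by (simp add: Lagrange_identity norm[OF x(1)])
    also have "\<dots> = 3 * (cmod (contact_form (\<xi> x) (F x)))\<^sup>2" by (rule \<xi>angle[OF x(1)])
    also have "(cmod (k * l))\<^sup>2 * \<dots> = 3 * (cmod (contact_form (H' z) (H z)))\<^sup>2"
      unfolding H H' by (simp add: norm_mult power_mult_distrib)
    finally show ?thesis .
  qed
  have S: "open S" "convex S" "e' (f x0) \<in> S" using r by (simp_all add: S_def)
  define Q where "Q = H' (e' (f x0))"
  \<comment> \<open>The value at 0 of the affine function that continues H; the parameter 0 itself
    need not lie in S.\<close>
  define P where "P = H (e' (f x0)) - e' (f x0) *s Q"
  have H'Q: "H' z = Q" if "z \<in> S" for z
    unfolding Q_def by (rule holomorphic_curve_is_line(1)[OF S derH Ha Hb angle that])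
  have HPQ: "H z = P + z *s Q" if "z \<in> S" for z
    using holomorphic_curve_is_line(2)[OF S derH Ha Hb angle that]
    by (simp add: P_def Q_def vec_eq_iff algebra_simps)
  have gP: "hopf (F (g (e z))) = proj (P + z *s Q)" if "z \<in> S" for z
  proof -
    have nz: "F (g (e z)) $ a \<noteq> 0" using gV1[OF that] by (simp add: V1_def)
    have "P + z *s Q = (1 / F (g (e z)) $ a) *s F (g (e z))"
      using HPQ[OF that] by (simp add: H_def w_def vec_eq_iff)
    moreover have "F (g (e z)) \<noteq> 0" using nz by auto
    ultimately show ?thesis
      using nz norm[OF V1V[OF gV1[OF that]]] by (simp add: proj_smult hopf_eq_proj)
  qed
  define N where "N = U' \<inter> f -` (e' -` S)"
  have contf': "continuous_on U' f" using hom by (simp add: homeomorphism_def)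
  have "open (e' -` S)"
    using S(1) bounded_linear.continuous_on[OF ble(2) continuous_on_id]
    by (simp add: open_vimage)
  then have oN: "open N" unfolding N_def using contf' U'(1) by (intro continuous_open_preimage)
  have geN: "g (e z) \<in> N" if "z \<in> S" for z
    using gU[OF that] fg[OF that] that by (simp add: N_def ee')
  have Ng: "x = g (e (e' (f x)))" "e' (f x) \<in> S" if "x \<in> N" for x
    using that hom by (auto simp: N_def ee' homeomorphism_def)
  define z0 where "z0 = e' (f x0)"
  have z0: "z0 \<in> S" using S(3) by (simp add: z0_def)
  show thesis
  proof (rule that[of N S P a b Q])
    show "open N" by (rule oN)
    show "x0 \<in> N" using U'(3) S(3) by (simp add: N_def)
    show "N \<subseteq> V" using U'(2) V1V by (auto simp: N_def)
    show "open S" by (rule S(1))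
    have Qab: "Q $ a = 0" "Q $ b = 1"
    proof -
      have "\<eta> (g (e z0)) $ a = 0" using gV1[OF z0] by (simp add: \<eta>_def V1_def)
      then show "Q $ a = 0" by (simp add: Q_def H'_def flip: z0_def)
      show "Q $ b = 1" using \<eta>b[OF z0] by (simp add: Q_def H'_def flip: z0_def)
    qed
    then show "Q $ a = 0" "Q $ b = 1" by simp_all
    show "P $ a = 1" "P $ b = 0"
      using Ha[OF z0] Hb[OF z0] Qab by (simp_all add: P_def flip: z0_def)
    show "(\<lambda>x. hopf (F x)) ` N = (\<lambda>z. proj (P + z *s Q)) ` S"
    proof (intro equalityI subsetI)
      fix y assume "y \<in> (\<lambda>x. hopf (F x)) ` N"
      then obtain x where x: "x \<in> N" "y = hopf (F x)" by blast
      then show "y \<in> (\<lambda>z. proj (P + z *s Q)) ` S"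
        using Ng[OF x(1)] gP[OF Ng(2)[OF x(1)]] by auto
    next
      fix y assume "y \<in> (\<lambda>z. proj (P + z *s Q)) ` S"
      then obtain z where z: "z \<in> S" "y = proj (P + z *s Q)" by blast
      then show "y \<in> (\<lambda>x. hopf (F x)) ` N" using gP[OF z(1)] geN[OF z(1)] by (metis imageI)
    qed
    have "wedge_norm2 (H z0) (H' z0) = wedge_norm2 P Q"
    proof -
      have "wedge (H z0) (H' z0) c d = wedge P Q c d" for c d
        using HPQ[OF z0] H'Q[OF z0] by (simp add: wedge_def algebra_simps)
      then show ?thesis by (simp add: wedge_norm2_def)
    qed
    moreover have "contact_form (H' z0) (H z0) = contact_form Q P"
      using HPQ[OF z0] H'Q[OF z0] by simp
    ultimately show "wedge_norm2 P Q = 3 * (cmod (contact_form Q P))\<^sup>2"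
      using angle[OF z0] by metis
  qed
qed

section \<open>Smooth maps and unitary symplectic isometries\<close>

lemma Ck_on_cong:
  assumes "open U" "\<And>x. x \<in> U \<Longrightarrow> f x = g x" "Ck_on k f U"
  shows "Ck_on k g U"
  using assms(2,3)
proof (induction k arbitrary: f g)
  case 0
  then show ?case by (simp cong: continuous_on_cong)
next
  case (Suc k)
  have d: "(g has_derivative frechet_derivative f (at x)) (at x)" if "x \<in> U" for x
    using Suc.prems that assms(1)
    by (metis Ck_on.simps(2) frechet_derivative_works has_derivative_transform_within_open)
  have e: "frechet_derivative f (at x) = frechet_derivative g (at x)" if "x \<in> U" for x
    by (rule frechet_derivative_at[OF d[OF that]])
  show ?case unfolding Ck_on.simps
  proof (intro conjI ballI allI)
    show "g differentiable at x" if "x \<in> U" for x using d[OF that] by (auto simp: differentiable_def)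
    show "Ck_on k (\<lambda>x. frechet_derivative g (at x) v) U" for v
      by (rule Suc.IH[of "\<lambda>x. frechet_derivative f (at x) v"]) (use Suc.prems e in auto)
  qed
qed

text \<open>\<open>Ck_on\<close> speaks of \<open>frechet_derivative\<close>; on an open set this
  can be replaced by any derivative known in closed form.\<close>

lemma Ck_on_SucI:
  assumes "open U" "\<And>x. x \<in> U \<Longrightarrow> (f has_derivative f' x) (at x)" "\<And>v. Ck_on k (\<lambda>x. f' x v) U"
  shows "Ck_on (Suc k) f U"
  unfolding Ck_on.simps
proof (intro conjI ballI allI)
  show "f differentiable at x" if "x \<in> U" for x using assms(2)[OF that] by (auto simp: differentiable_def)
  show "Ck_on k (\<lambda>x. frechet_derivative f (at x) v) U" for v
    by (rule Ck_on_cong[OF assms(1) _ assms(3)[of v]]) (metis assms(2) frechet_derivative_at)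
qed

lemma Ck_on_Suc_has_derivative:
  "Ck_on (Suc k) f U \<Longrightarrow> x \<in> U \<Longrightarrow> (f has_derivative frechet_derivative f (at x)) (at x)"
  by (simp add: frechet_derivative_works)

lemma Ck_on_Suc_D: "Ck_on (Suc k) f U \<Longrightarrow> Ck_on k f U"
proof (induction k arbitrary: f)
  case 0
  then show ?case
    by (auto intro!: continuous_at_imp_continuous_on differentiable_imp_continuous_within)
qed simp

lemma Ck_on_const: "open U \<Longrightarrow> Ck_on k (\<lambda>x. c) U"
  by (induction k arbitrary: c) (auto intro!: Ck_on_SucI[where f'="\<lambda>x v. 0"] simp del: Ck_on.simps(2))

lemma Ck_on_bounded_linear_compose:
  assumes "open U" "bounded_linear L"
  shows "Ck_on k f U \<Longrightarrow> Ck_on k (\<lambda>x. L (f x)) U"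
proof (induction k arbitrary: f)
  case 0
  then show ?case using bounded_linear.continuous_on[OF assms(2)] by simp
next
  case (Suc k)
  show ?case
    by (rule Ck_on_SucI[OF assms(1) bounded_linear.has_derivative[OF assms(2) Ck_on_Suc_has_derivative[OF Suc.prems]]])
      (use Suc in auto)
qed

lemma Ck_on_add:
  assumes "open U"
  shows "Ck_on k f U \<Longrightarrow> Ck_on k g U \<Longrightarrow> Ck_on k (\<lambda>x. f x + g x) U"
proof (induction k arbitrary: f g)
  case 0
  then show ?case by (simp add: continuous_on_add)
next
  case (Suc k)
  show ?case
    by (rule Ck_on_SucI[OF assms has_derivative_add[OF Ck_on_Suc_has_derivative Ck_on_Suc_has_derivative]])
      (use Suc in auto)
qed

lemma Ck_on_bounded_bilinear:
  assumes "open U" "bounded_bilinear h"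
  shows "Ck_on k f U \<Longrightarrow> Ck_on k g U \<Longrightarrow> Ck_on k (\<lambda>x. h (f x) (g x)) U"
proof (induction k arbitrary: f g)
  case 0
  then show ?case using bounded_bilinear.continuous_on[OF assms(2)] by simp
next
  case (Suc k)
  show ?case
  proof (rule Ck_on_SucI[OF assms(1) bounded_bilinear.FDERIV[OF assms(2)]])
    show "(f has_derivative frechet_derivative f (at x)) (at x)"
      "(g has_derivative frechet_derivative g (at x)) (at x)" if "x \<in> U" for x
      using Ck_on_Suc_has_derivative Suc.prems that by blast+
    show "Ck_on k (\<lambda>x. h (f x) (frechet_derivative g (at x) v) + h (frechet_derivative f (at x) v) (g x)) U" for v
    proof (rule Ck_on_add[OF assms(1) Suc.IH Suc.IH])
      show "Ck_on k f U" "Ck_on k g U" using Suc.prems by (blast intro: Ck_on_Suc_D)+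
      show "Ck_on k (\<lambda>x. frechet_derivative f (at x) v) U" "Ck_on k (\<lambda>x. frechet_derivative g (at x) v) U"
        using Suc.prems by simp_all
    qed
  qed
qed

text \<open>The induction runs over all exponents at once, because differentiation lowers the
  exponent by one. The case of interest is -1/2, which normalizes a lift.\<close>

lemma Ck_on_powr:
  fixes q :: "'a::real_normed_vector \<Rightarrow> real"
  assumes "open U" "\<And>x. x \<in> U \<Longrightarrow> q x > 0" "Ck_on k q U"
  shows "Ck_on k (\<lambda>x. q x powr a) U"
  using assms(3)
proof (induction k arbitrary: a)
  case 0
  then show ?case using assms(2) by (force intro!: continuous_intros)
next
  case (Suc k)
  show ?case
  proof (rule Ck_on_SucI[OF assms(1)])
    fix x assume "x \<in> U"
    show "((\<lambda>x. q x powr a) has_derivative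
        (\<lambda>v. (a * q x powr (a - 1)) * frechet_derivative q (at x) v)) (at x)"
      using Ck_on_Suc_has_derivative[OF Suc.prems \<open>x \<in> U\<close>] assms(2)[OF \<open>x \<in> U\<close>]
      by (auto intro!: derivative_eq_intros simp: powr_diff)
  next
    show "Ck_on k (\<lambda>x. (a * q x powr (a - 1)) * frechet_derivative q (at x) v) U" for v
      by (intro Ck_on_bounded_bilinear[OF assms(1) bounded_bilinear_mult] Ck_on_const assms(1)
          Suc.IH Ck_on_Suc_D[OF Suc.prems]) (use Suc.prems in simp)
  qed
qed

lemma smooth_on_const: "open U \<Longrightarrow> smooth_on (\<lambda>x. c) U"
  by (simp add: smooth_on_def Ck_on_const)

lemma smooth_on_bounded_linear_compose:
  "open U \<Longrightarrow> bounded_linear L \<Longrightarrow> smooth_on f U \<Longrightarrow> smooth_on (\<lambda>x. L (f x)) U"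
  by (simp add: smooth_on_def Ck_on_bounded_linear_compose)

lemma smooth_on_id: "open U \<Longrightarrow> smooth_on (\<lambda>x. x) U"
  unfolding smooth_on_def
proof
  show "Ck_on k (\<lambda>x. x) U" if "open U" for k
    by (cases k) (auto intro!: Ck_on_SucI[OF that has_derivative_ident] Ck_on_const that simp del: Ck_on.simps(2))
qed

lemma smooth_on_bounded_linear: "open U \<Longrightarrow> bounded_linear L \<Longrightarrow> smooth_on L U"
  using smooth_on_bounded_linear_compose smooth_on_id by blast

lemma smooth_on_add:
  "open U \<Longrightarrow> smooth_on f U \<Longrightarrow> smooth_on g U \<Longrightarrow> smooth_on (\<lambda>x. f x + g x) U"
  by (simp add: smooth_on_def Ck_on_add)

lemma smooth_on_bounded_bilinear:
  "open U \<Longrightarrow> bounded_bilinear h \<Longrightarrow> smooth_on f U \<Longrightarrow> smooth_on g U \<Longrightarrow> smooth_on (\<lambda>x. h (f x) (g x)) U"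
  by (simp add: smooth_on_def Ck_on_bounded_bilinear)

lemmas smooth_on_mult = smooth_on_bounded_bilinear[OF _ bounded_bilinear_mult]
lemmas smooth_on_scaleR = smooth_on_bounded_bilinear[OF _ bounded_bilinear_scaleR]

lemma smooth_on_powr:
  "open U \<Longrightarrow> (\<And>x. x \<in> U \<Longrightarrow> q x > 0) \<Longrightarrow> smooth_on q U \<Longrightarrow> smooth_on (\<lambda>x. q x powr (a::real)) U"
  by (simp add: smooth_on_def Ck_on_powr)

section \<open>The group Sp(2) and its action by isometries\<close>

definition symplectic_unitary :: "(complex^4 \<Rightarrow> complex^4) \<Rightarrow> bool"
  where "symplectic_unitary A \<longleftrightarrow> (\<forall>u v. A (u + v) = A u + A v) \<and> (\<forall>c u. A (c *s u) = c *s A u) \<and>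
    (\<forall>u v. herm (A u) (A v) = herm u v) \<and> (\<forall>u. A (quat_j u) = quat_j (A u))"

lemma symplectic_unitary_linear:
  assumes "symplectic_unitary A"
  shows "linear A"
  using assms by (intro linearI) (simp_all add: symplectic_unitary_def scaleR_smult)

lemma symplectic_unitary_norm:
  assumes "symplectic_unitary A"
  shows "norm (A u) = norm u"
  using assms by (simp add: norm_eq_sqrt_inner inner_herm symplectic_unitary_def)

lemma symplectic_unitary_bij:
  assumes "symplectic_unitary A"
  shows "bij A"
proof -
  have l: "linear A" by (rule symplectic_unitary_linear[OF assms])
  have "inj A" unfolding linear_injective_0[OF l]
    by (metis assms norm_eq_zero symplectic_unitary_norm)
  then show ?thesis using l by (simp add: bij_def linear_injective_imp_surjective)
qed

lemma symplectic_unitary_inv: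
  assumes "symplectic_unitary A"
  shows "symplectic_unitary (inv A)"
proof -
  have b: "A (inv A v) = v" for v
    using symplectic_unitary_bij[OF assms] by (simp add: bij_is_surj surj_f_inv_f)
  have i: "A u = A v \<longleftrightarrow> u = v" for u v
    using symplectic_unitary_bij[OF assms] by (simp add: bij_is_inj inj_eq)
  have A: "A (u + v) = A u + A v" "A (c *s u) = c *s A u" "herm (A u) (A v) = herm u v"
    "A (quat_j u) = quat_j (A u)" for u v c
    using assms by (simp_all add: symplectic_unitary_def)
  have "herm (inv A u) (inv A v) = herm u v" for u v
    using A(3)[of "inv A u" "inv A v"] by (simp add: b)
  then show ?thesis unfolding symplectic_unitary_def by (simp add: A b flip: i)
qed

text \<open>The metric is an expression in \<open>herm\<close> and \<open>quat_j\<close>, and A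
  respects both. Being linear, A is its own derivative and maps horizontal vectors to horizontal
  ones, so A is a smooth lift on the whole space.\<close>

lemma symplectic_unitary_nk_isometry:
  assumes A: "symplectic_unitary A"
  obtains \<Phi> where "nk_isometry \<Phi>" "\<And>v. v \<noteq> 0 \<Longrightarrow> \<Phi> (proj v) = proj (A v)"
proof -
  have A': "A (u + v) = A u + A v" "A (c *s u) = c *s A u" "herm (A u) (A v) = herm u v"
    "A (quat_j u) = quat_j (A u)" for u v c
    using A by (simp_all add: symplectic_unitary_def)
  have Ai: "A u = A v \<longleftrightarrow> u = v" for u v
    using symplectic_unitary_bij[OF A] by (simp add: bij_is_inj inj_eq)
  have A0: "A v = 0 \<longleftrightarrow> v = 0" for v by (metis A norm_eq_zero symplectic_unitary_norm)
  have nA: "norm (A v) = norm v" for v by (rule symplectic_unitary_norm[OF A])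
  \<comment> \<open>An arbitrary representative is taken; complex linearity of A makes the image
    independent of it.\<close>
  define \<Phi> where "\<Phi> x = proj (A (SOME v. v \<noteq> 0 \<and> proj v = x))" for x
  have \<Phi>: "\<Phi> (proj v) = proj (A v)" if v0: "v \<noteq> 0" for v
  proof -
    define w where "w = (SOME w. w \<noteq> 0 \<and> proj w = proj v)"
    have w: "w \<noteq> 0 \<and> proj w = proj v" unfolding w_def by (rule someI[of _ v]) (use v0 in simp)
    then obtain k where "v = k *s w" using v0 proj_eq_iff by blast
    then show ?thesis unfolding \<Phi>_def w_def[symmetric] using w v0 A0 A'(2) proj_eq_iff by metis
  qed
  have "bij \<Phi>"
  proof (rule bijI)
    show "inj \<Phi>"
    proof (rule injI)
      fix x y assume eq: "\<Phi> x = \<Phi> y"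
      obtain v w where vw: "v \<noteq> 0" "proj v = x" "w \<noteq> 0" "proj w = y" using proj_surj by metis
      then have "proj (A v) = proj (A w)" using eq \<Phi> by metis
      then obtain k where "A w = k *s A v" using vw A0 proj_eq_iff by metis
      then have "w = k *s v" by (simp add: Ai flip: A'(2))
      then show "x = y" using vw proj_eq_iff by metis
    qed
    show "surj \<Phi>"
    proof (rule surjI)
      fix y
      define v where "v = inv A (SOME v. v \<noteq> 0 \<and> proj v = y)"
      have "(SOME v. v \<noteq> 0 \<and> proj v = y) \<noteq> 0 \<and> proj (SOME v. v \<noteq> 0 \<and> proj v = y) = y"
        by (rule someI_ex[OF proj_surj])
      moreover have "A v = (SOME v. v \<noteq> 0 \<and> proj v = y)"
        unfolding v_def using symplectic_unitary_bij[OF A] by (simp add: bij_is_surj surj_f_inv_f)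
      ultimately show "\<Phi> (proj (inv A (SOME v. v \<noteq> 0 \<and> proj v = y))) = y"
        using \<Phi>[of v] A0 unfolding v_def by metis
    qed
  qed
  moreover have bl: "bounded_linear A"
    using symplectic_unitary_linear[OF A] by (simp add: linear_conv_bounded_linear)
  have "\<exists>W G. open W \<and> p \<in> W \<and> smooth_on G W \<and>
        (\<forall>q\<in>W \<inter> sphere 0 1. norm (G q) = 1 \<and> hopf (G q) = \<Phi> (hopf q) \<and>
           (\<forall>v\<in>horizontal q. \<forall>w\<in>horizontal q.
              nk_metric (G q) (hopf_differential G q v) (hopf_differential G q w)
                = nk_metric q v w))" for p
  proof (rule exI[of _ UNIV], rule exI[of _ A], intro conjI ballI)
    fix q v w assume q: "q \<in> UNIV \<inter> sphere (0::complex^4) 1" and v: "v \<in> horizontal q" and w: "w \<in> horizontal q"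
    have "frechet_derivative A (at q) = A"
      by (rule frechet_derivative_at[symmetric], rule bounded_linear_imp_has_derivative[OF bl])
    then have "hopf_differential A q u = A u" if "u \<in> horizontal q" for u
      using that by (simp add: hopf_differential_def horizontal_part_herm horizontal_herm A'(3))
    then show "nk_metric (A q) (hopf_differential A q v) (hopf_differential A q w) = nk_metric q v w"
      using v w by (simp add: nk_metric_herm contact_form_def A'(3) flip: A'(4))
  next
    fix q assume q: "q \<in> UNIV \<inter> sphere (0::complex^4) 1"
    then have "norm q = 1" by simp
    moreover from this have "q \<noteq> 0" by auto
    ultimately show "norm (A q) = 1" "hopf (A q) = \<Phi> (hopf q)" using \<Phi>[of q] by (simp_all add: nA hopf_eq_proj)
  qed (use bl in \<open>auto intro: smooth_on_bounded_linear\<close>)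
  ultimately have "nk_isometry \<Phi>" unfolding nk_isometry_def by blast
  then show thesis using that \<Phi> by blast
qed

section \<open>From the local to the global line\<close>

lemma bounded_bilinear_smult: "bounded_bilinear (\<lambda>c v. c *s (v :: complex^'n::finite))"
  by (rule bounded_bilinear.intro)
    (auto simp: scaleR_complex vec_eq_iff algebra_simps intro: exI[of _ 1])

lemmas continuous_on_smult [continuous_intros] = bounded_bilinear.continuous_on[OF bounded_bilinear_smult]

definition cspan2 :: "complex^4 \<Rightarrow> complex^4 \<Rightarrow> (complex^4) set"
  where "cspan2 P Q = {\<alpha> *s P + \<beta> *s Q | \<alpha> \<beta>. True}"

definition projline :: "complex^4 \<Rightarrow> complex^4 \<Rightarrow> cp3 set"
  where "projline P Q = proj ` (cspan2 P Q - {0})"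

lemma cspan2_smult: "v \<in> cspan2 P Q \<Longrightarrow> k *s v \<in> cspan2 P Q"
proof -
  assume "v \<in> cspan2 P Q"
  then obtain \<alpha> \<beta> where "v = \<alpha> *s P + \<beta> *s Q" unfolding cspan2_def by blast
  then have "k *s v = (k * \<alpha>) *s P + (k * \<beta>) *s Q" by (simp add: algebra_simps)
  then show ?thesis unfolding cspan2_def by blast
qed

lemma cspan2_mono:
  assumes "v \<in> cspan2 P Q" "w \<in> cspan2 P Q"
  shows "cspan2 v w \<subseteq> cspan2 P Q"
proof -
  obtain a b c d where v: "v = a *s P + b *s Q" and w: "w = c *s P + d *s Q"
    using assms unfolding cspan2_def by blast
  have "\<alpha> *s v + \<beta> *s w = (\<alpha> * a + \<beta> * c) *s P + (\<alpha> * b + \<beta> * d) *s Q" for \<alpha> \<beta>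
    by (simp add: v w vec_eq_iff algebra_simps)
  then show ?thesis unfolding cspan2_def by blast
qed

lemma proj_in_projline:
  assumes "v \<noteq> 0"
  shows "proj v \<in> projline P Q \<longleftrightarrow> v \<in> cspan2 P Q"
proof
  assume "proj v \<in> projline P Q"
  then obtain w where w: "w \<in> cspan2 P Q" "w \<noteq> 0" "proj w = proj v" unfolding projline_def by force
  then obtain k where "v = k *s w" using assms proj_eq_iff by blast
  then show "v \<in> cspan2 P Q" using w cspan2_smult by blast
qed (use assms in \<open>auto simp: projline_def\<close>)

text \<open>Cramer's rule: \<delta> is the determinant of v and w in terms of P and Q. If it were
  zero, v and w would be proportional and give the same point.\<close>

lemma cspan2_eq:
  assumes v: "v \<in> cspan2 P Q" "v \<noteq> 0" and w: "w \<in> cspan2 P Q" "w \<noteq> 0" and ne: "proj v \<noteq> proj w"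
  shows "cspan2 P Q = cspan2 v w"
proof
  show "cspan2 v w \<subseteq> cspan2 P Q" by (rule cspan2_mono[OF v(1) w(1)])
  obtain a b c d where v': "v = a *s P + b *s Q" and w': "w = c *s P + d *s Q"
    using v w unfolding cspan2_def by blast
  define \<delta> where "\<delta> = a * d - b * c"
  have P: "d *s v + (- b) *s w = \<delta> *s P" and Q: "(- c) *s v + a *s w = \<delta> *s Q"
    by (simp_all add: v' w' \<delta>_def vec_eq_iff algebra_simps)
  have "\<delta> \<noteq> 0"
  proof
    assume \<delta>: "\<delta> = 0"
    have eq: "d *s v = b *s w" "c *s v = a *s w"
      using P Q unfolding \<delta> by (simp_all add: vec_eq_iff)
    have "d \<noteq> 0 \<or> c \<noteq> 0" using w(2) w' by auto
    then have "\<exists>k. v = k *s w"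
    proof
      assume "d \<noteq> 0"
      then have "v = (1 / d) *s (d *s v)" by simp
      then show ?thesis unfolding eq(1) by auto
    next
      assume "c \<noteq> 0"
      then have "v = (1 / c) *s (c *s v)" by simp
      then show ?thesis unfolding eq(2) by auto
    qed
    then show False using ne proj_eq_iff[OF w(2) v(2)] by simp
  qed
  have "P = (d / \<delta>) *s v + (- b / \<delta>) *s w" "Q = (- c / \<delta>) *s v + (a / \<delta>) *s w"
  proof -
    have "P = (1 / \<delta>) *s (\<delta> *s P)" "Q = (1 / \<delta>) *s (\<delta> *s Q)" using \<open>\<delta> \<noteq> 0\<close> by simp_all
    then show "P = (d / \<delta>) *s v + (- b / \<delta>) *s w" "Q = (- c / \<delta>) *s v + (a / \<delta>) *s w"
      unfolding P[symmetric] Q[symmetric] by (simp_all add: vec_eq_iff algebra_simps)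
  qed
  then have "P \<in> cspan2 v w" "Q \<in> cspan2 v w" unfolding cspan2_def by blast+
  then show "cspan2 P Q \<subseteq> cspan2 v w" by (rule cspan2_mono)
qed

lemma projline_unique:
  assumes "x \<in> projline P Q" "y \<in> projline P Q" "x \<in> projline P' Q'" "y \<in> projline P' Q'" "x \<noteq> y"
  shows "projline P Q = projline P' Q'"
proof -
  obtain v w where vw: "v \<noteq> 0" "proj v = x" "w \<noteq> 0" "proj w = y" using proj_surj by metis
  then have "v \<in> cspan2 P Q" "w \<in> cspan2 P Q" "v \<in> cspan2 P' Q'" "w \<in> cspan2 P' Q'"
    using assms proj_in_projline by blast+
  then have "cspan2 P Q = cspan2 P' Q'" using cspan2_eq vw assms(5) by metis
  then show ?thesis by (simp add: projline_def)
qed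

section \<open>Lifted charts, local pieces of lines and their continuation\<close>

lemma smooth_on_subset:
  assumes "smooth_on F U" "V \<subseteq> U"
  shows "smooth_on F V"
proof -
  have "Ck_on k G V" if "Ck_on k G U" for k and G :: "'a \<Rightarrow> 'b"
    using that by (induction k arbitrary: G) (use assms(2) continuous_on_subset in auto)
  then show ?thesis using assms(1) by (simp add: smooth_on_def)
qed

lemma lifted_chart_openin:
  assumes "lifted_chart M f (V, \<phi>, F)" "open V'" "V' \<subseteq> V"
  shows "openin (top_of_set M) (\<phi> ` V')"
proof -
  obtain \<psi> where V: "openin (top_of_set M) (\<phi> ` V)" "homeomorphism V (\<phi> ` V) \<phi> \<psi>"
    using assms(1) by (auto simp: lifted_chart_def)
  have "openin (top_of_set V) V'" using assms(2,3) by (simp add: openin_open_eq openin_subset open_subset)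
  then have "openin (top_of_set (\<phi> ` V)) (\<phi> ` V')" using V(2) homeomorphism_imp_open_map by blast
  then show ?thesis using V(1) openin_trans by blast
qed

lemma lifted_chart_continuous:
  assumes "lifted_chart M f (V, \<phi>, F)"
  shows "continuous_on V \<phi>" "continuous_on V (\<lambda>x. hopf (F x))"
proof -
  show "continuous_on V \<phi>" using assms by (auto simp: lifted_chart_def homeomorphism_def)
  have "continuous_on V F" using assms by (auto simp: lifted_chart_def intro: smooth_on_continuous)
  moreover have "F ` V \<subseteq> sphere 0 1" using assms by (auto simp: lifted_chart_def)
  ultimately show "continuous_on V (\<lambda>x. hopf (F x))"
    using continuous_on_compose2[OF continuous_on_hopf] by blast
qed

lemma immersed_submanifold_chart:
  assumes "immersed_submanifold M f \<A>" "m \<in> M"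
  obtains V \<phi> F x where "(V, \<phi>, F) \<in> \<A>" "lifted_chart M f (V, \<phi>, F)" "x \<in> V" "\<phi> x = m"
proof -
  have M: "\<forall>c\<in>\<A>. lifted_chart M f c" "M = (\<Union>(V, \<phi>, F)\<in>\<A>. \<phi> ` V)"
    using assms(1) unfolding immersed_submanifold_def by blast+
  have "m \<in> (\<Union>(V, \<phi>, F)\<in>\<A>. \<phi> ` V)" by (subst M(2)[symmetric]) (rule assms(2))
  then obtain V \<phi> F x where c: "(V, \<phi>, F) \<in> \<A>" "x \<in> V" "\<phi> x = m" by auto
  show thesis by (rule that[OF c(1) bspec[OF M(1) c(1)] c(2,3)])
qed

text \<open>Continuity of f is inherited from its local lifts: in a chart f is the Hopf projection
  of the continuous F, read through a homeomorphism. It is needed for compactness of the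
  image.\<close>

lemma immersed_submanifold_continuous:
  assumes M: "immersed_submanifold M f \<A>"
  shows "continuous_on M f"
proof -
  have "openin (top_of_set M) (M \<inter> f -` W)" if W: "open W" for W
  proof (subst openin_subopen, intro ballI)
    fix m assume m: "m \<in> M \<inter> f -` W"
    then have "m \<in> M" by simp
    obtain V \<phi> F x where "(V, \<phi>, F) \<in> \<A>" and c: "lifted_chart M f (V, \<phi>, F)" "x \<in> V" "\<phi> x = m"
      by (rule immersed_submanifold_chart[OF M \<open>m \<in> M\<close>])
    define V' where "V' = V \<inter> (\<lambda>x. hopf (F x)) -` W"
    have oV: "open V" using c(1) by (simp add: lifted_chart_def)
    have "open V'" unfolding V'_def by (rule continuous_open_preimage[OF lifted_chart_continuous(2)[OF c(1)] oV W])
    then have o: "openin (top_of_set M) (\<phi> ` V')"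
      using lifted_chart_openin[OF c(1)] by (simp add: V'_def)
    have ff: "hopf (F y) = f (\<phi> y)" if "y \<in> V" for y using c(1) that by (simp add: lifted_chart_def)
    have "m \<in> \<phi> ` V'" using c m ff by (auto simp: V'_def)
    moreover have "\<phi> ` V' \<subseteq> M \<inter> f -` W" using openin_imp_subset[OF o] ff by (auto simp: V'_def)
    ultimately show "\<exists>T. openin (top_of_set M) T \<and> m \<in> T \<and> T \<subseteq> M \<inter> f -` W" using o by blast
  qed
  then show ?thesis by (simp add: continuous_on_open_gen[where T=UNIV])
qed

text \<open>The normalization of P and Q makes coordinate \<open>a\<close> equal to 1 and coordinate
  \<open>b\<close> equal to the parameter z. So z can be recovered from the point as a quotient of
  coordinates.\<close>

definition affine_patch :: "cp3 set \<Rightarrow> complex^4 \<Rightarrow> complex^4 \<Rightarrow> bool"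
  where "affine_patch X P Q \<longleftrightarrow> (\<exists>a b S. open S \<and> S \<noteq> {} \<and> P $ a = 1 \<and> P $ b = 0 \<and> Q $ a = 0 \<and> Q $ b = 1
    \<and> X = (\<lambda>z. proj (P + z *s Q)) ` S)"

lemma affine_patch_subset: "affine_patch X P Q \<Longrightarrow> X \<subseteq> projline P Q"
proof -
  assume "affine_patch X P Q"
  then obtain a b S where a: "P $ a = 1" "Q $ a = 0" and X: "X = (\<lambda>z. proj (P + z *s Q)) ` S"
    unfolding affine_patch_def by blast
  have "proj (P + z *s Q) \<in> projline P Q" for z
  proof -
    have "(P + z *s Q) $ a = 1" using a by simp
    then have "P + z *s Q \<noteq> 0" by (metis zero_index zero_neq_one)
    moreover have "P + z *s Q = 1 *s P + z *s Q" by simp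
    ultimately show ?thesis unfolding proj_in_projline[OF \<open>P + z *s Q \<noteq> 0\<close>] cspan2_def by blast
  qed
  then show ?thesis using X by auto
qed

lemma affine_patch_two_points:
  assumes "affine_patch X P Q"
  shows "\<exists>x\<in>X. \<exists>y\<in>X. x \<noteq> y"
proof -
  obtain a b S where S: "open S" "S \<noteq> {}" and ab: "P $ a = 1" "P $ b = 0" "Q $ a = 0" "Q $ b = 1"
    and X: "X = (\<lambda>z. proj (P + z *s Q)) ` S"
    using assms unfolding affine_patch_def by blast
  obtain z where z: "z \<in> S" using S by blast
  then obtain e where e: "e > 0" "ball z e \<subseteq> S" using S by (meson openE)
  define w where "w = z + of_real (e / 2)"
  have w: "w \<in> S" "w \<noteq> z" using e by (auto simp: w_def dist_norm)
  have "proj (P + z *s Q) \<noteq> proj (P + w *s Q)"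
  proof
    assume eq: "proj (P + z *s Q) = proj (P + w *s Q)"
    have 1: "(P + y *s Q) $ a = 1" "(P + y *s Q) $ b = y" for y using ab by simp_all
    then have "P + y *s Q \<noteq> 0" for y by (metis zero_index zero_neq_one)
    then obtain k where k: "P + w *s Q = k *s (P + z *s Q)" using eq proj_eq_iff by blast
    have "k = 1" using arg_cong[OF k, of "\<lambda>v. v $ a"] ab by simp
    then have "w = z" using arg_cong[OF k, of "\<lambda>v. v $ b"] ab by simp
    then show False using w by simp
  qed
  then show ?thesis using z w X by blast
qed

lemma affine_patch_open:
  assumes "affine_patch X P Q"
  shows "\<exists>W. open W \<and> X = projline P Q \<inter> W"
proof -
  obtain a b S where S: "open S" "S \<noteq> {}" and ab: "P $ a = 1" "P $ b = 0" "Q $ a = 0" "Q $ b = 1"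
    and X: "X = (\<lambda>z. proj (P + z *s Q)) ` S"
    using assms unfolding affine_patch_def by blast
  \<comment> \<open>An open cone in 4-space that cuts out the patch: on the line the quotient of
    coordinates \<open>b\<close> and \<open>a\<close> is the parameter.\<close>
  define \<Omega> where "\<Omega> = {v::complex^4. v $ a \<noteq> 0 \<and> v $ b / v $ a \<in> S}"
  define W where "W = proj ` \<Omega>"
  have \<Omega>0: "v \<noteq> 0" if "v \<in> \<Omega>" for v using that by (auto simp: \<Omega>_def)
  have sat: "v \<in> \<Omega>" if v: "v \<noteq> 0" "proj v \<in> W" for v
  proof -
    obtain u where u: "u \<in> \<Omega>" "proj v = proj u" using v(2) by (auto simp: W_def)
    obtain k where k: "v = k *s u" using \<Omega>0[OF u(1)] v(1) u(2) proj_eq_iff by metis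
    then have "k \<noteq> 0" using v(1) by auto
    then show ?thesis using u(1) k by (simp add: \<Omega>_def)
  qed
  have "open \<Omega>"
  proof -
    have o: "open {v::complex^4. v $ a \<noteq> 0}" by (intro open_Collect_neq continuous_intros)
    have "open ({v::complex^4. v $ a \<noteq> 0} \<inter> (\<lambda>v. v $ b / v $ a) -` S)"
      by (rule continuous_open_preimage[OF _ o S(1)]) (intro continuous_intros, simp)
    moreover have "\<Omega> = {v::complex^4. v $ a \<noteq> 0} \<inter> (\<lambda>v. v $ b / v $ a) -` S" by (auto simp: \<Omega>_def)
    ultimately show ?thesis by simp
  qed
  then have "open W"
  proof (rule open_cp3I)
    show "proj v \<in> W" if "v \<in> \<Omega>" for v using that by (simp add: W_def)
    show "v \<in> \<Omega>" if "norm v = 1" "proj v \<in> W" for v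
    proof (rule sat[OF _ that(2)])
      show "v \<noteq> 0" using that(1) by auto
    qed
  qed
  moreover have "X = projline P Q \<inter> W"
  proof
    have "P + z *s Q \<in> \<Omega>" if "z \<in> S" for z using that ab by (simp add: \<Omega>_def)
    then show "X \<subseteq> projline P Q \<inter> W" using affine_patch_subset[OF assms] by (auto simp: X W_def)
    show "projline P Q \<inter> W \<subseteq> X"
    proof
      fix x assume x: "x \<in> projline P Q \<inter> W"
      then obtain v where v: "v \<in> cspan2 P Q" "v \<noteq> 0" "x = proj v" by (auto simp: projline_def)
      then obtain \<alpha> \<beta> where v': "v = \<alpha> *s P + \<beta> *s Q" unfolding cspan2_def by blast
      have "v \<in> \<Omega>" using sat v(2,3) x by blast
      then have \<alpha>: "\<alpha> \<noteq> 0" "\<beta> / \<alpha> \<in> S" using ab by (simp_all add: \<Omega>_def v')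
      have "(1 / \<alpha>) *s v = P + (\<beta> / \<alpha>) *s Q" using \<alpha> by (simp add: v' vec_eq_iff algebra_simps)
      then have "x = proj (P + (\<beta> / \<alpha>) *s Q)" using v(2,3) \<alpha>(1) proj_smult[of "1 / \<alpha>" v] by simp
      then show "x \<in> X" using \<alpha>(2) X by blast
    qed
  qed
  ultimately show ?thesis by blast
qed

text \<open>\<open>R0\<close> is arbitrary so that a patch can also be found inside the overlap of
  two earlier pieces.\<close>

lemma local_affine_patch:
  fixes \<A> :: "('m::{t2_space, second_countable_topology}, 2) lifted_chart set"
  assumes M: "immersed_submanifold M f \<A>" and tr: "totally_real \<A>" and ac: "kaehler_almost_complex \<A>"
    and R0: "openin (top_of_set M) R0" "m \<in> R0"
  shows "\<exists>R P Q. openin (top_of_set M) R \<and> m \<in> R \<and> R \<subseteq> R0 \<and> affine_patch (f ` R) P Q \<and>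
    wedge_norm2 P Q = 3 * (cmod (contact_form Q P))\<^sup>2"
proof -
  have "m \<in> M" using R0 openin_imp_subset by blast
  then obtain V \<phi> F x where A: "(V, \<phi>, F) \<in> \<A>" and c: "lifted_chart M f (V, \<phi>, F)" and x: "x \<in> V" "\<phi> x = m"
    using immersed_submanifold_chart[OF M] by metis
  have V: "open V" "smooth_on F V" "\<phi> ` V \<subseteq> M"
    using c by (auto simp: lifted_chart_def dest: openin_imp_subset)
  have F: "norm (F y) = 1" "hopf (F y) = f (\<phi> y)" "inj (hopf_differential F y)" if "y \<in> V" for y
    using c that by (auto simp: lifted_chart_def)
  obtain T where T: "open T" "R0 = M \<inter> T" using R0(1) openin_open by metis
  define V' where "V' = V \<inter> \<phi> -` T"
  have oV': "open V'" unfolding V'_def by (rule continuous_open_preimage[OF lifted_chart_continuous(1)[OF c] V(1) T(1)])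
  have V'V: "V' \<subseteq> V" and xV': "x \<in> V'" using x R0(2) T(2) by (auto simp: V'_def)
  have sm: "smooth_on F V'" by (rule smooth_on_subset[OF V(2) V'V])
  have ac': "\<forall>y\<in>V. (\<lambda>v. \<i> *s v) ` tangent_space F y = tangent_space F y"
    using bspec[OF ac[unfolded kaehler_almost_complex_def] A] by simp
  have tr': "\<forall>y\<in>V. \<forall>X\<in>tangent_space F y. \<forall>Y\<in>tangent_space F y. nk_metric (F y) (nk_J (F y) X) Y = 0"
    using bspec[OF tr[unfolded totally_real_def] A] by simp
  have F': "norm (F y) = 1" "inj (hopf_differential F y)"
    "(\<lambda>v. \<i> *s v) ` tangent_space F y = tangent_space F y" if "y \<in> V'" for y
    using F(1,3)[OF subsetD[OF V'V that]] bspec[OF ac' subsetD[OF V'V that]] .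
  have real: "nk_metric (F y) (nk_J (F y) X) Y = 0"
    if "y \<in> V'" "X \<in> tangent_space F y" "Y \<in> tangent_space F y" for y X Y
    by (rule bspec[OF bspec[OF bspec[OF tr' subsetD[OF V'V that(1)]] that(2)] that(3)])
  obtain N S P a b Q where N: "open N" "x \<in> N" "N \<subseteq> V'" and S: "open S"
    and ab: "P $ a = 1" "P $ b = 0" "Q $ a = 0" "Q $ b = 1"
    and eq: "(\<lambda>x. hopf (F x)) ` N = (\<lambda>z. proj (P + z *s Q)) ` S"
    and w: "wedge_norm2 P Q = 3 * (cmod (contact_form Q P))\<^sup>2"
    by (rule line_chart[OF oV' xV' sm F' real])
  have NV: "N \<subseteq> V" using N V'V by blast
  have "openin (top_of_set M) (\<phi> ` N)" using lifted_chart_openin[OF c N(1) NV] .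
  moreover have "m \<in> \<phi> ` N" using x N by blast
  moreover have "\<phi> ` N \<subseteq> R0" using N(3) V(3) T(2) by (auto simp: V'_def)
  moreover have "affine_patch (f ` \<phi> ` N) P Q"
  proof -
    have "f ` \<phi> ` N = (\<lambda>x. hopf (F x)) ` N" using F(2) NV by (auto simp: image_image intro!: image_cong)
    moreover have "S \<noteq> {}" using eq N(2) by blast
    ultimately show ?thesis unfolding affine_patch_def using S ab eq by metis
  qed
  ultimately show ?thesis using w by blast
qed

text \<open>A collects the points near which f stays in the line found at \<open>m0\<close>. If the
  patch of another point meets A, a smaller patch in the overlap contains two distinct points, which
  force both lines to agree; hence the complement of A is open too. With one line for all of M,
  every patch is relatively open in it, and so is their union.\<close>

lemma image_open_in_line:
  fixes \<A> :: "('m::{t2_space, second_countable_topology}, 2) lifted_chart set"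
  assumes M: "immersed_submanifold M f \<A>" and con: "connected M" "M \<noteq> {}"
    and tr: "totally_real \<A>" and ac: "kaehler_almost_complex \<A>"
  shows "\<exists>P Q W. open W \<and> f ` M = projline P Q \<inter> W \<and> proj P \<noteq> proj Q \<and> P \<noteq> 0 \<and> Q \<noteq> 0 \<and>
    wedge_norm2 P Q = 3 * (cmod (contact_form Q P))\<^sup>2"
proof -
  note patch = local_affine_patch[OF M tr ac]
  obtain m0 where m0: "m0 \<in> M" using con by blast
  obtain R0 P Q where R0: "openin (top_of_set M) R0" "m0 \<in> R0" "affine_patch (f ` R0) P Q"
    "wedge_norm2 P Q = 3 * (cmod (contact_form Q P))\<^sup>2"
    using patch[OF openin_subtopology_self m0] by blast
  define A where "A = {m \<in> M. \<exists>R. openin (top_of_set M) R \<and> m \<in> R \<and> f ` R \<subseteq> projline P Q}"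
  have oA: "openin (top_of_set M) A"
  proof (subst openin_subopen, intro ballI)
    fix m assume "m \<in> A"
    then obtain R where R: "openin (top_of_set M) R" "m \<in> R" "f ` R \<subseteq> projline P Q" by (auto simp: A_def)
    then have "R \<subseteq> A" using openin_imp_subset[OF R(1)] by (auto simp: A_def)
    then show "\<exists>T. openin (top_of_set M) T \<and> m \<in> T \<and> T \<subseteq> A" using R by blast
  qed
  have oC: "openin (top_of_set M) (M - A)"
  proof (subst openin_subopen, intro ballI)
    fix m assume m: "m \<in> M - A"
    obtain R P' Q' where R: "openin (top_of_set M) R" "m \<in> R" "affine_patch (f ` R) P' Q'"
      using patch[OF openin_subtopology_self, of m] m by blast
    have "R \<inter> A = {}"
    proof (rule ccontr)
      assume "R \<inter> A \<noteq> {}"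
      then obtain m' where m': "m' \<in> R" "m' \<in> A" by blast
      obtain R2 P2 Q2 where R2: "openin (top_of_set M) R2" "m' \<in> R2" "R2 \<subseteq> R \<inter> A" "affine_patch (f ` R2) P2 Q2"
        using patch[OF openin_Int[OF R(1) oA], of m'] m' by blast
      obtain x y where xy: "x \<in> f ` R2" "y \<in> f ` R2" "x \<noteq> y" using affine_patch_two_points[OF R2(4)] by blast
      have "f ` R2 \<subseteq> projline P' Q'" using affine_patch_subset[OF R(3)] R2(3) by blast
      moreover have "f ` R2 \<subseteq> projline P Q" using R2(3) by (auto simp: A_def)
      ultimately have "projline P' Q' = projline P Q" using projline_unique[of x P' Q' y P Q] xy by blast
      then have "m \<in> A" using R m affine_patch_subset[OF R(3)] by (auto simp: A_def)
      then show False using m by simp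
    qed
    then show "\<exists>T. openin (top_of_set M) T \<and> m \<in> T \<and> T \<subseteq> M - A"
      using R openin_imp_subset[OF R(1)] by blast
  qed
  have "m0 \<in> A" using R0 m0 affine_patch_subset[OF R0(3)] by (auto simp: A_def)
  have "closedin (top_of_set M) A"
    using oC by (auto simp: closedin_def A_def)
  then have "A = M" using con(1) oA \<open>m0 \<in> A\<close> unfolding connected_clopen by blast
  then have sub: "f ` M \<subseteq> projline P Q" by (auto simp: A_def)
  have "\<exists>W. open W \<and> f m \<in> W \<and> projline P Q \<inter> W \<subseteq> f ` M" if m: "m \<in> M" for m
  proof -
    obtain R P' Q' where R: "openin (top_of_set M) R" "m \<in> R" "affine_patch (f ` R) P' Q'"
      using patch[OF openin_subtopology_self m] by blast
    obtain x y where xy: "x \<in> f ` R" "y \<in> f ` R" "x \<noteq> y" using affine_patch_two_points[OF R(3)] by blast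
    have RM: "f ` R \<subseteq> f ` M" using openin_imp_subset[OF R(1)] by blast
    have "projline P' Q' = projline P Q"
      using projline_unique[of x P' Q' y P Q] xy affine_patch_subset[OF R(3)] sub RM by blast
    then obtain W where "open W" "f ` R = projline P Q \<inter> W" using affine_patch_open[OF R(3)] by metis
    then show ?thesis using R(2) RM by blast
  qed
  then obtain W where W: "\<And>m. m \<in> M \<Longrightarrow> open (W m) \<and> f m \<in> W m \<and> projline P Q \<inter> W m \<subseteq> f ` M" by metis
  have "open (\<Union>m\<in>M. W m)" using W by blast
  moreover have "f ` M = projline P Q \<inter> (\<Union>m\<in>M. W m)" using W sub by blast
  moreover have "proj P \<noteq> proj Q \<and> P \<noteq> 0 \<and> Q \<noteq> 0"
  proof -
    obtain a b where ab: "P $ a = 1" "P $ b = 0" "Q $ a = 0" "Q $ b = 1" using R0(3) unfolding affine_patch_def by blast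
    then have nz: "P \<noteq> 0" "Q \<noteq> 0" by auto
    have "P \<noteq> k *s Q" for k
    proof
      assume "P = k *s Q"
      then have "P $ a = k * Q $ a" by simp
      then show False using ab by simp
    qed
    then have "proj P \<noteq> proj Q" using proj_eq_iff[OF nz(2) nz(1)] by metis
    then show ?thesis using nz by blast
  qed
  ultimately show ?thesis using R0(4) by blast
qed

section \<open>The model sphere\<close>

text \<open>Sine and cosine of the angle between the tangent plane of the model sphere and \<open>D2\<close>.\<close>

definition sc :: complex where "sc = complex_of_real (sqrt 2 / sqrt 3)"
definition cc :: complex where "cc = complex_of_real (1 / sqrt 3)"

lemma sc_cc [simp]: "cnj sc = sc" "cnj cc = cc" "cmod sc = sqrt 2 / sqrt 3"
  by (simp_all add: sc_def cc_def norm_divide del: of_real_divide)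

lemma sc_cc_mult: "sc * sc = 2 / 3" "cc * cc = 1 / 3" "sc * (sc * x) = 2 / 3 * x" "cc * (cc * x) = 1 / 3 * x"
proof -
  have "sc * sc = of_real ((sqrt 2 / sqrt 3) * (sqrt 2 / sqrt 3))" unfolding sc_def by (rule of_real_mult[symmetric])
  then show s: "sc * sc = 2 / 3" by (simp add: complex_eq_iff)
  have "cc * cc = of_real ((1 / sqrt 3) * (1 / sqrt 3))" unfolding cc_def by (rule of_real_mult[symmetric])
  then show c: "cc * cc = 1 / 3" by (simp add: complex_eq_iff)
  show "sc * (sc * x) = 2 / 3 * x" "cc * (cc * x) = 1 / 3 * x" by (simp_all add: s c flip: mult.assoc)
qed

lemma sc_cc_nonzero [simp]: "sc \<noteq> 0" "cc \<noteq> 0"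
  using sc_cc_mult(1,2) by auto

text \<open>\<open>mp\<close> and \<open>mq\<close> are the values of the model lift at u = 0 and at
  (u, v) = (\<pi>/2, 0). They are orthonormal, and \<omega>(mq, mp) = \<open>sc * \<i>\<close> is
  the value to which every other frame is adjusted.\<close>

definition mp :: "complex^4" where "mp = vector [1, 0, 0, 0]"
definition mq :: "complex^4" where "mq = vector [0, sc * \<i>, 0, cc]"

lemma model_immersion_proj:
  "model_immersion (u, v) = proj (of_real (cos u) *s mp + (cis v * of_real (sin u)) *s mq)"
  "norm (of_real (cos u) *s mp + (cis v * of_real (sin u)) *s mq) = 1"
proof -
  have eq: "vector
     [complex_of_real (cos u),
      complex_of_real (sqrt 2 / sqrt 3) * \<i> * cis v * complex_of_real (sin u), 0,
      complex_of_real (1 / sqrt 3) * cis v * complex_of_real (sin u)]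
     = of_real (cos u) *s mp + (cis v * of_real (sin u)) *s mq"
    by (simp add: vec_eq_iff forall_4 mp_def mq_def sc_def cc_def)
  have h: "herm mp mp = 1" "herm mq mq = 1" "herm mp mq = 0" "herm mq mp = 0"
    by (simp_all add: herm_def sum_4 mp_def mq_def algebra_simps sc_cc_mult)
  have c: "cis v * cnj (cis v) = 1" by (simp add: cis_cnj cis_mult)
  have "of_real ((norm (of_real (cos u) *s mp + (cis v * of_real (sin u)) *s mq))\<^sup>2)
      = of_real (cos u) * of_real (cos u) + (cis v * cnj (cis v)) * (of_real (sin u) * of_real (sin u))"
    unfolding herm_self[symmetric] by (simp add: h algebra_simps)
  also have "\<dots> = complex_of_real ((cos u)\<^sup>2 + (sin u)\<^sup>2)"
    unfolding c by (simp only: power2_eq_square of_real_add of_real_mult mult_1_left)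
  finally have "(norm (of_real (cos u) *s mp + (cis v * of_real (sin u)) *s mq))\<^sup>2 = 1"
    unfolding of_real_eq_iff by simp
  then show n: "norm (of_real (cos u) *s mp + (cis v * of_real (sin u)) *s mq) = 1"
    by (simp add: power2_eq_1_iff) (smt (verit) norm_ge_zero)
  show "model_immersion (u, v) = proj (of_real (cos u) *s mp + (cis v * of_real (sin u)) *s mq)"
    by (simp only: model_immersion_def case_prod_conv eq hopf_eq_proj[OF n])
qed

text \<open>After division by the length n the coefficients have moduli cos u and sin u with u in
  [0, \<pi>/2]. The phase of \<alpha> is absorbed by the Hopf circle, and v is the phase of \<beta>
  relative to that of \<alpha>.\<close>

lemma model_sphere_projline: "model_sphere = projline mp mq"
proof
  show "model_sphere \<subseteq> projline mp mq"
  proof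
    fix x assume "x \<in> model_sphere"
    then obtain u v where x: "x = proj (of_real (cos u) *s mp + (cis v * of_real (sin u)) *s mq)"
      unfolding model_sphere_def by (auto simp: model_immersion_proj(1))
    have "of_real (cos u) *s mp + (cis v * of_real (sin u)) *s mq \<noteq> 0"
      using model_immersion_proj(2)[of u v] by (metis norm_zero zero_neq_one)
    then show "x \<in> projline mp mq" unfolding x proj_in_projline[OF \<open>_ \<noteq> 0\<close>] cspan2_def by blast
  qed
  show "projline mp mq \<subseteq> model_sphere"
  proof
    fix x assume "x \<in> projline mp mq"
    then obtain \<alpha> \<beta> where x: "\<alpha> *s mp + \<beta> *s mq \<noteq> 0" "x = proj (\<alpha> *s mp + \<beta> *s mq)"
      unfolding projline_def cspan2_def by auto
    define n where "n = sqrt ((cmod \<alpha>)\<^sup>2 + (cmod \<beta>)\<^sup>2)"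
    have "\<alpha> \<noteq> 0 \<or> \<beta> \<noteq> 0" using x(1) by auto
    then have n: "n > 0" by (auto simp: n_def add_nonneg_pos add_pos_nonneg)
    have n2: "n\<^sup>2 = (cmod \<alpha>)\<^sup>2 + (cmod \<beta>)\<^sup>2" by (simp add: n_def)
    have "(cmod \<alpha> / n)\<^sup>2 + (cmod \<beta> / n)\<^sup>2 = 1"
      using n by (simp add: power_divide n2[symmetric] flip: add_divide_distrib)
    then obtain u where u: "0 \<le> u" "u \<le> pi / 2" "cmod \<alpha> / n = cos u" "cmod \<beta> / n = sin u"
      using sincos_total_pi_half[of "cmod \<alpha> / n" "cmod \<beta> / n"] n by auto
    \<comment> \<open>A zero coefficient has no phase; the default 1 keeps a and b
      unimodular.\<close>
    define a where "a = (if \<alpha> = 0 then 1 else sgn \<alpha>)"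
    define b where "b = (if \<beta> = 0 then 1 else sgn \<beta>)"
    have a: "\<alpha> = of_real (cmod \<alpha>) * a" "cmod a = 1" and b: "\<beta> = of_real (cmod \<beta>) * b" "cmod b = 1"
      by (auto simp: a_def b_def norm_sgn sgn_div_norm scaleR_complex norm_mult norm_inverse)
    have a0: "a \<noteq> 0" using a(2) by auto
    define v where "v = Arg2pi (b / a)"
    have v: "0 \<le> v" "v \<le> 2 * pi" "cis v = b / a"
      using Arg2pi[of "b / a"] a b by (auto simp: v_def norm_divide cis_conv_exp is_Arg_def)
    have ca: "of_real n * of_real (cos u) = complex_of_real (cmod \<alpha>)"
      and sb: "of_real n * of_real (sin u) = complex_of_real (cmod \<beta>)"
      using n by (simp_all flip: u(3,4))
    have "\<alpha> = (a * of_real n) * of_real (cos u)"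
      by (subst a(1)) (simp only: ca[symmetric] ac_simps)
    moreover have "\<beta> = (a * of_real n) * (cis v * of_real (sin u))"
    proof -
      have "\<beta> = (of_real n * of_real (sin u)) * (a * cis v)"
        unfolding sb v(3) using b(1) a0 by simp
      then show ?thesis by (simp only: ac_simps)
    qed
    ultimately have eq: "\<alpha> *s mp + \<beta> *s mq
        = (a * of_real n) *s (of_real (cos u) *s mp + (cis v * of_real (sin u)) *s mq)"
      by (simp add: vec_eq_iff algebra_simps)
    have "x = model_immersion (u, v)"
      unfolding x(2) model_immersion_proj(1) eq
    proof (rule proj_smult)
      show "a * of_real n \<noteq> 0" using a0 n by simp
      show "of_real (cos u) *s mp + (cis v * of_real (sin u)) *s mq \<noteq> 0"
        using model_immersion_proj(2)[of u v] by (metis norm_zero zero_neq_one)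
    qed
    moreover have "u \<le> pi" using u(2) pi_gt_zero by linarith
    ultimately show "x \<in> model_sphere" using u v unfolding model_sphere_def by auto
  qed
qed

lemma connected_model_sphere: "connected model_sphere"
  unfolding model_sphere_def
proof (rule connected_continuous_image)
  let ?h = "\<lambda>(u, v). of_real (cos u) *s mp + (cis v * of_real (sin u)) *s mq"
  have "continuous_on ({0..pi} \<times> {0..2*pi}) ?h"
    unfolding case_prod_beta by (intro continuous_intros)
  moreover have "?h ` ({0..pi} \<times> {0..2*pi}) \<subseteq> sphere 0 1"
    using model_immersion_proj(2) by auto
  ultimately have "continuous_on ({0..pi} \<times> {0..2*pi}) (\<lambda>x. hopf (?h x))"
    using continuous_on_compose2[OF continuous_on_hopf] by blast
  moreover have "hopf (?h x) = model_immersion x" for x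
    using model_immersion_proj by (cases x) (simp add: hopf_eq_proj)
  ultimately show "continuous_on ({0..pi} \<times> {0..2*pi}) model_immersion" by simp
  show "connected ({0..pi} \<times> {0..2*pi} :: (real \<times> real) set)"
    by (intro connected_Times connected_Icc)
qed

text \<open>A is determined by the images p and r of the first and last basis vectors, since it must
  commute with j. Solving \<open>mq\<close> = sc i e2 + cc e4 for e4 and transporting the equation
  gives r.\<close>

lemma symplectic_frame:
  assumes p: "norm p = 1" and q: "norm q = 1" "herm q p = 0" "contact_form q p = sc * \<i>"
  obtains A where "symplectic_unitary A" "A mp = p" "A mq = q"
proof -
  define r where "r = (1 / cc) *s (q - (sc * \<i>) *s quat_j p)"
  \<comment> \<open>The minus sign is forced by j e4 = - e3.\<close>
  define A where "A z = (z :: complex^4) $ 1 *s p + z $ 2 *s quat_j p - z $ 3 *s quat_j r + z $ 4 *s r" for z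
  have pp: "herm p p = 1" and qq: "herm q q = 1" using p q by (simp_all add: herm_self)
  have pj: "herm (quat_j p) (quat_j p) = 1" by (simp add: herm_quat_j_quat_j pp)
  have jp: "herm (quat_j p) p = 0" "herm p (quat_j p) = 0"
  proof -
    show "herm p (quat_j p) = 0" using contact_form_linear(8)[of p] by (simp only: contact_form_def)
    then show "herm (quat_j p) p = 0" by (subst herm_commute) simp
  qed
  have qj: "herm q (quat_j p) = sc * \<i>" "herm (quat_j p) q = - (sc * \<i>)"
    using q(3) herm_commute[of "quat_j p" q] by (simp_all add: contact_form_def)
  have rp: "herm r p = 0" "herm r (quat_j p) = 0" "herm r r = 1"
    by (simp_all add: r_def q jp qj pj qq algebra_simps sc_cc_mult divide_simps)
  have pr: "herm p r = 0" "herm (quat_j p) r = 0"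
    using rp herm_commute[of p r] herm_commute[of "quat_j p" r] by simp_all
  have jr: "herm (quat_j r) p = 0" "herm (quat_j r) (quat_j p) = 0" "herm (quat_j r) (quat_j r) = 1"
    "herm (quat_j r) r = 0" "herm r (quat_j r) = 0"
  proof -
    show "herm (quat_j r) p = 0" using herm_quat_j_quat_j[of r "quat_j p"] pr by simp
    show "herm (quat_j r) (quat_j p) = 0" "herm (quat_j r) (quat_j r) = 1"
      by (simp_all add: herm_quat_j_quat_j pr rp)
    show "herm r (quat_j r) = 0" using contact_form_linear(8)[of r] by (simp only: contact_form_def)
    then show "herm (quat_j r) r = 0" by (subst herm_commute) simp
  qed
  have rj: "herm p (quat_j r) = 0" "herm (quat_j p) (quat_j r) = 0"
    using jr(1,2) herm_commute[of p "quat_j r"] herm_commute[of "quat_j p" "quat_j r"] by simp_all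
  have "herm (A u) (A v) = herm u v" for u v
    by (simp add: A_def pp pj jp rp pr jr rj) (simp add: herm_def sum_4)
  moreover have "A (quat_j u) = quat_j (A u)" for u
  proof -
    have neg: "quat_j (- w) = - quat_j w" "quat_j (w - w') = quat_j w - quat_j w'" for w w'
      using quat_j_linear(2)[of "-1" w] quat_j_linear(1)[of w "-w'"] quat_j_linear(2)[of "-1" w']
      by (simp_all add: vec_eq_iff)
    show ?thesis unfolding A_def quat_j_linear neg quat_j_quat_j
      by (simp add: quat_j_def[of u] vec_eq_iff algebra_simps)
  qed
  ultimately have "symplectic_unitary A"
    unfolding symplectic_unitary_def by (simp add: A_def vec_eq_iff algebra_simps)
  moreover have "A mp = p" "A mq = q" by (simp_all add: A_def mp_def mq_def r_def)
  ultimately show thesis by (rule that)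
qed

text \<open>Gram-Schmidt makes the basis orthonormal, and the angle equation then gives \<omega> the
  modulus sqrt (2/3). Its phase is free, as the second vector may be multiplied by a unit scalar
  h.\<close>

lemma orthonormal_frame:
  assumes PQ: "P \<noteq> 0" "Q \<noteq> 0" "proj P \<noteq> proj Q"
    and w: "wedge_norm2 P Q = 3 * (cmod (contact_form Q P))\<^sup>2"
  obtains p q where "norm p = 1" "norm q = 1" "herm q p = 0" "contact_form q p = sc * \<i>"
    "projline P Q = projline p q"
proof -
  define k where "k = complex_of_real (1 / norm P)"
  define p where "p = k *s P"
  define q' where "q' = Q - herm Q p *s p"
  have k0: "k \<noteq> 0" using PQ(1) by (simp add: k_def)
  have p: "norm p = 1" using PQ(1) by (simp add: p_def k_def norm_divide)
  have q'p: "herm q' p = 0" by (simp add: q'_def herm_self_1[OF p])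
  have "q' \<noteq> 0"
  proof
    assume "q' = 0"
    then have "Q = (herm Q p * k) *s P" by (simp add: q'_def p_def)
    then show False using PQ proj_eq_iff by metis
  qed
  define l where "l = complex_of_real (1 / norm q')"
  define r where "r = l *s q'"
  have l0: "l \<noteq> 0" using \<open>q' \<noteq> 0\<close> by (simp add: l_def)
  have r: "norm r = 1" using \<open>q' \<noteq> 0\<close> by (simp add: r_def l_def norm_divide)
  have rp: "herm r p = 0" by (simp add: r_def q'p)
  have rPQ: "r = l *s Q + (- l * herm Q p * k) *s P"
    by (simp add: r_def q'_def p_def vec_eq_iff algebra_simps)
  have "2 = wedge_norm2 p r"
    using rp herm_commute[of p r] by (simp add: Lagrange_identity p r)
  also have "\<dots> = (cmod (k * l))\<^sup>2 * wedge_norm2 P Q"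
    unfolding p_def rPQ by (subst wedge_norm2_transform) simp
  also have "\<dots> = 3 * (cmod (contact_form r p))\<^sup>2"
    unfolding w by (simp add: p_def rPQ norm_mult power_mult_distrib)
  finally have m: "(cmod (contact_form r p))\<^sup>2 = (sqrt 2 / sqrt 3)\<^sup>2" by (simp add: power_divide)
  then have m': "cmod (contact_form r p) = sqrt 2 / sqrt 3" by (simp add: power2_eq_iff_nonneg)
  then have c0: "contact_form r p \<noteq> 0" by auto
  define h where "h = sc * \<i> / contact_form r p"
  have h: "cmod h = 1" by (simp add: h_def norm_mult norm_divide m')
  define q where "q = h *s r"
  show thesis
  proof
    show "norm p = 1" by (rule p)
    show nq: "norm q = 1" by (simp add: q_def h r)
    show "herm q p = 0" by (simp add: q_def rp)
    show "contact_form q p = sc * \<i>" using c0 by (simp add: q_def h_def)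
    have "cspan2 P Q = cspan2 p q"
    proof (rule cspan2_eq)
      have "p = k *s P + 0 *s Q" by (simp add: p_def)
      then show "p \<in> cspan2 P Q" unfolding cspan2_def by blast
      have "q = (h * (- l * herm Q p * k)) *s P + (h * l) *s Q"
        by (simp add: q_def rPQ vec_eq_iff algebra_simps)
      then show "q \<in> cspan2 P Q" unfolding cspan2_def by blast
      show p0: "p \<noteq> 0" "q \<noteq> 0" using p nq by auto
      show "proj p \<noteq> proj q"
      proof
        assume "proj p = proj q"
        then obtain t where t: "q = t *s p" using p0 proj_eq_iff by metis
        then have "t = 0" using \<open>herm q p = 0\<close> by (simp add: herm_self_1[OF p])
        then show False using t p0 by simp
      qed
    qed
    then show "projline P Q = projline p q" by (simp add: projline_def)
  qed
qed

text \<open>\<Phi> inverts the map induced by A. So the part of the sphere above the image of W is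
  the preimage under A of the part above W, and continuity of A suffices.\<close>

lemma open_image_symplectic:
  assumes A: "symplectic_unitary A" and \<Phi>: "\<And>v. v \<noteq> 0 \<Longrightarrow> \<Phi> (proj (A v)) = proj v"
    and inj: "inj \<Phi>" and W: "open W"
  shows "open (\<Phi> ` W)"
proof -
  have n: "norm (A v) = norm v" for v by (rule symplectic_unitary_norm[OF A])
  have h: "hopf p \<in> \<Phi> ` W \<longleftrightarrow> hopf (A p) \<in> W" if "norm p = 1" for p
  proof -
    have "p \<noteq> 0" using that by auto
    then have "hopf p = \<Phi> (hopf (A p))" using \<Phi> that n by (simp add: hopf_eq_proj)
    then show ?thesis using inj by (simp add: inj_image_mem_iff)
  qed
  have "openin (top_of_set (sphere 0 1)) (sphere 0 1 \<inter> A -` {p \<in> sphere 0 1. hopf p \<in> W})"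
  proof (rule continuous_openin_preimage)
    show "continuous_on (sphere 0 1) A"
      using symplectic_unitary_linear[OF A] linear_continuous_on linear_conv_bounded_linear by blast
    show "A \<in> sphere 0 1 \<rightarrow> sphere 0 1" by (simp add: n)
    show "openin (top_of_set (sphere 0 1)) {p \<in> sphere 0 1. hopf p \<in> W}"
      using W unfolding open_cp3_def .
  qed
  moreover have "sphere 0 1 \<inter> A -` {p \<in> sphere 0 1. hopf p \<in> W} = {p \<in> sphere 0 1. hopf p \<in> \<Phi> ` W}"
    using h by (auto simp: n)
  ultimately show ?thesis unfolding open_cp3_def by simp
qed

text \<open>The isometry is induced by the inverse of the element of Sp(2) that takes
  \<open>mp\<close>, \<open>mq\<close> to an adjusted frame of the line. For compact M the image is
  closed as well as open in the connected model sphere, hence all of it.\<close>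

lemma congruent_to_model_sphere:
  fixes \<A> :: "('m::{t2_space, second_countable_topology}, 2) lifted_chart set"
  assumes M: "immersed_submanifold M f \<A>" and con: "connected M" "M \<noteq> {}"
    and tr: "totally_real \<A>" and ac: "kaehler_almost_complex \<A>"
  shows "\<exists>U. openin (top_of_set model_sphere) U \<and> nk_congruent (f ` M) U"
    "compact M \<Longrightarrow> nk_congruent (f ` M) model_sphere"
proof -
  obtain P Q W where W: "open W" "f ` M = projline P Q \<inter> W" and PQ: "P \<noteq> 0" "Q \<noteq> 0" "proj P \<noteq> proj Q"
    "wedge_norm2 P Q = 3 * (cmod (contact_form Q P))\<^sup>2"
    using image_open_in_line[OF M con tr ac] by blast
  obtain p q where pq: "norm p = 1" "norm q = 1" "herm q p = 0" "contact_form q p = sc * \<i>"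
    "projline P Q = projline p q"
    by (rule orthonormal_frame[OF PQ])
  obtain A where A: "symplectic_unitary A" "A mp = p" "A mq = q" by (rule symplectic_frame[OF pq(1-4)])
  obtain \<Phi> where \<Phi>: "nk_isometry \<Phi>" "\<And>v. v \<noteq> 0 \<Longrightarrow> \<Phi> (proj v) = proj (inv A v)"
    using symplectic_unitary_nk_isometry[OF symplectic_unitary_inv[OF A(1)]] by blast
  have bij: "bij \<Phi>" using \<Phi>(1) by (simp add: nk_isometry_def)
  have A0: "A v = 0 \<longleftrightarrow> v = 0" for v by (metis A(1) norm_eq_zero symplectic_unitary_norm)
  have \<Phi>A: "\<Phi> (proj (A v)) = proj v" if "v \<noteq> 0" for v
    using \<Phi>(2)[of "A v"] that A0 symplectic_unitary_bij[OF A(1)] by (simp add: bij_is_inj inv_f_f)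
  have AL: "A (\<alpha> *s mp + \<beta> *s mq) = \<alpha> *s p + \<beta> *s q" for \<alpha> \<beta>
    using A by (simp add: symplectic_unitary_def)
  have sp: "cspan2 p q = A ` cspan2 mp mq"
    unfolding cspan2_def AL[symmetric] by blast
  have "A ` cspan2 mp mq - {0} = A ` (cspan2 mp mq - {0})" using A0 by auto
  then have "projline P Q = (\<lambda>v. proj (A v)) ` (cspan2 mp mq - {0})"
    by (simp add: pq(5)) (simp add: projline_def sp image_image)
  then have "\<Phi> ` projline P Q = (\<lambda>v. \<Phi> (proj (A v))) ` (cspan2 mp mq - {0})"
    by (simp add: image_image)
  also have "\<dots> = proj ` (cspan2 mp mq - {0})" by (rule image_cong) (auto simp: \<Phi>A)
  finally have line: "\<Phi> ` projline P Q = model_sphere"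
    by (simp add: model_sphere_projline projline_def)
  have o: "open (\<Phi> ` V)" if "open V" for V
    by (rule open_image_symplectic[OF A(1) \<Phi>A bij_is_inj[OF bij] that])
  have U: "\<Phi> ` f ` M = model_sphere \<inter> \<Phi> ` W"
    unfolding W(2) line[symmetric] by (rule image_Int[OF bij_is_inj[OF bij]])
  then have oU: "openin (top_of_set model_sphere) (\<Phi> ` f ` M)"
    using o[OF W(1)] by (auto simp: openin_open)
  then show "\<exists>U. openin (top_of_set model_sphere) U \<and> nk_congruent (f ` M) U"
    unfolding nk_congruent_def using \<Phi>(1) by blast
  assume "compact M"
  then have "compact (f ` M)" by (rule compact_continuous_image[OF immersed_submanifold_continuous[OF M]])
  then have "open (\<Phi> ` (- f ` M))" using o compact_imp_closed by blast
  then have "closed (\<Phi> ` f ` M)" using bij by (simp add: bij_image_Compl_eq closed_def)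
  then have "closedin (top_of_set model_sphere) (\<Phi> ` f ` M)" using U by (metis closed_subset inf_le1)
  then have "\<Phi> ` f ` M = model_sphere"
    using connected_model_sphere oU con(2) unfolding connected_clopen by blast
  then show "nk_congruent (f ` M) model_sphere" unfolding nk_congruent_def using \<Phi>(1) by blast
qed

section \<open>Adapted frames\<close>

text \<open>
  \<open>lag \<alpha> \<beta> m n\<close> is \<open>m W + n T W\<close>, where \<open>W = \<alpha> mp + \<beta> mq\<close> runs through the model plane and \<open>T\<close> is
  the isometry onto its orthogonal complement with \<open>T mp = (0, 0, 1, 0)\<close> and
  \<open>T mq = (0, cc, 0, \<i> sc)\<close>. For unit \<open>W\<close> the vector \<open>T W\<close> spans the complex direction in \<open>D2 W\<close>
  that is orthogonal to the model line.
\<close>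

definition lag :: "complex \<Rightarrow> complex \<Rightarrow> complex \<Rightarrow> complex \<Rightarrow> complex^4"
  where "lag \<alpha> \<beta> m n = vector [m * \<alpha>, (m * sc * \<i> + n * cc) * \<beta>, n * \<alpha>, (m * cc + n * \<i> * sc) * \<beta>]"

lemma herm_lag:
  "herm (lag \<alpha> \<beta> m n) (lag \<alpha>' \<beta>' m' n') = (\<alpha> * cnj \<alpha>' + \<beta> * cnj \<beta>') * (m * cnj m' + n * cnj n')"
  by (simp add: herm_def sum_4 lag_def algebra_simps sc_cc_mult)

text \<open>\<omega> splits into the determinant of the first pairs and a symmetric bilinear form of
  the second pairs. It vanishes between vectors with the same first pair; between vectors with the
  same second pair only the quadratic form at (m, n) matters.\<close>

lemma contact_form_lag:
  "contact_form (lag \<alpha> \<beta> m n) (lag \<alpha>' \<beta>' m' n')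
    = (\<beta> * \<alpha>' - \<alpha> * \<beta>') * (sc * \<i> * (m * m' + n * n') + cc * (m * n' + n * m'))"
  by (simp add: contact_form_expand lag_def algebra_simps)

lemma lag_smult: "lag (k * \<alpha>) (k * \<beta>) (l * m) (l * n) = (k * l) *s lag \<alpha> \<beta> m n"
  by (simp add: lag_def vec_eq_iff forall_4 algebra_simps)

lemma norm_lag: "(norm (lag \<alpha> \<beta> m n))\<^sup>2 = ((cmod \<alpha>)\<^sup>2 + (cmod \<beta>)\<^sup>2) * ((cmod m)\<^sup>2 + (cmod n)\<^sup>2)"
proof -
  have "of_real ((norm (lag \<alpha> \<beta> m n))\<^sup>2)
      = complex_of_real (((cmod \<alpha>)\<^sup>2 + (cmod \<beta>)\<^sup>2) * ((cmod m)\<^sup>2 + (cmod n)\<^sup>2))"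
    unfolding herm_self[symmetric] herm_lag by (simp add: of_real_cmod_square)
  then show ?thesis unfolding of_real_eq_iff .
qed

lemma contact_form_minus [simp]: "contact_form (- u) w = - contact_form u w"
  by (simp add: contact_form_expand)

text \<open>p is the base point, X spans the complex part of a tangent space, and E is the remaining
  direction, in \<open>D2\<close>. The value 2/3 is the totally real condition on the line of
  X.\<close>

definition adapted_frame :: "complex^4 \<Rightarrow> complex^4 \<Rightarrow> complex^4 \<Rightarrow> bool"
  where "adapted_frame p X E \<longleftrightarrow> herm p p = 1 \<and> herm X X = 1 \<and> herm E E = 1 \<and>
    herm X p = 0 \<and> herm E p = 0 \<and> herm X E = 0 \<and>
    contact_form X p * cnj (contact_form X p) = 2 / 3 \<and> contact_form E p = 0"

definition frame_space :: "complex^4 \<Rightarrow> complex^4 \<Rightarrow> (complex^4) set"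
  where "frame_space X E = {a *s X + t *\<^sub>R E | a t. True}"

lemma adapted_frame_norm: "adapted_frame p X E \<Longrightarrow> norm p = 1"
proof -
  assume "adapted_frame p X E"
  then have "complex_of_real ((norm p)\<^sup>2) = of_real 1" by (simp only: adapted_frame_def herm_self of_real_1)
  then have "(norm p)\<^sup>2 = 1" unfolding of_real_eq_iff .
  then show ?thesis by (simp add: power2_eq_1_iff) (smt (verit) norm_ge_zero)
qed

text \<open>E has contact value 0, so the contact term is 2/3 a cnj b, and 3 times 2/3 cancels the
  factor 2 of the Hermitian term. The remaining product t s is real; this is why E carries real
  coefficients only.\<close>

lemma frame_space_totally_real:
  assumes f: "adapted_frame p X E" and "Y \<in> frame_space X E" "Z \<in> frame_space X E"
  shows "nk_metric p (nk_J p Y) Z = 0"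
proof -
  obtain a t b s where YZ: "Y = a *s X + t *\<^sub>R E" "Z = b *s X + s *\<^sub>R E"
    using assms unfolding frame_space_def by blast
  have EX: "herm E X = 0" using f herm_commute[of E X] by (simp add: adapted_frame_def)
  have h: "herm Y Z = a * cnj b + of_real (t * s)"
    using f EX by (simp add: YZ adapted_frame_def)
  have "contact_form Y p * cnj (contact_form Z p) = (a * cnj b) * (contact_form X p * cnj (contact_form X p))"
    using f by (simp add: YZ adapted_frame_def algebra_simps)
  also have "\<dots> = (a * cnj b) * (2 / 3)" using f by (simp only: adapted_frame_def)
  finally have c: "contact_form Y p * cnj (contact_form Z p) = (a * cnj b) * (2 / 3)" .
  show ?thesis unfolding nk_metric_nk_J[OF adapted_frame_norm[OF f]] h c by simp
qed

text \<open>The components of X in \<open>D1\<close> and \<open>D2\<close> have squared Fubini-Study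
  lengths 2/3 and 1/3. The weights 1 and 2 of g make both 2/3, so the same r = sqrt (3/2) normalizes
  them to A and X'. Equal lengths mean the angle \<pi>/4. As J is -i on A and i on X', the second
  basis vector is a multiple of i X.\<close>

lemma frame_space_lagrangian_angle:
  assumes f: "adapted_frame p X E"
  shows "\<exists>A\<in>D1 p. \<exists>X'\<in>D2 p. \<exists>E3\<in>D2 p. nk_metric p A A = 1 \<and> nk_metric p X' X' = 1 \<and>
    nk_orthonormal_basis p (frame_space X E) (cos (pi / 4) *\<^sub>R A + sin (pi / 4) *\<^sub>R X')
      (sin (pi / 4) *\<^sub>R nk_J p A - cos (pi / 4) *\<^sub>R nk_J p X') E3"
proof -
  define \<omega> where "\<omega> = contact_form X p"
  define r where "r = sqrt 3 / sqrt 2"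
  define A where "A = r *\<^sub>R (\<omega> *s quat_j p)"
  define X' where "X' = r *\<^sub>R (X - \<omega> *s quat_j p)"
  define E3 where "E3 = (1 / sqrt 2) *\<^sub>R E"
  have np: "norm p = 1" by (rule adapted_frame_norm[OF f])
  have F: "herm X X = 1" "herm E E = 1" "herm X p = 0" "herm E p = 0" "herm X E = 0"
    "contact_form E p = 0" and \<omega>2: "\<omega> * cnj \<omega> = 2 / 3"
    using f by (simp_all add: adapted_frame_def \<omega>_def)
  have EX: "herm E X = 0" using F herm_commute[of E X] by simp
  have r2: "r * r = 3 / 2" by (simp add: r_def)
  have jj: "herm (quat_j p) (quat_j p) = 1" by (simp add: herm_quat_j_quat_j herm_self_1 np)
  have jc: "contact_form (quat_j p) p = 1" by (rule contact_form_quat_j_self[OF np])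
  have jp: "herm (quat_j p) p = 0"
    using contact_form_linear(8)[of p] herm_quat_j_left[of p p] by simp
  have Xj: "herm X (quat_j p) = \<omega>" "herm (quat_j p) X = cnj \<omega>"
    by (simp_all add: \<omega>_def contact_form_def herm_commute[of "quat_j p" X])
  have cA: "contact_form A p = of_real r * \<omega>" by (simp add: A_def jc)
  have cX': "contact_form X' p = 0" by (simp add: X'_def jc \<omega>_def)
  have hA: "herm A A = of_real (r * r) * (\<omega> * cnj \<omega>)" by (simp add: A_def jj)
  have hX': "herm X' X' = of_real (r * r) * (1 - \<omega> * cnj \<omega>)"
    by (simp add: X'_def jj Xj F algebra_simps)
  have JA: "nk_J p A = - (\<i> *s A)" 
    by (simp add: nk_J_def nk_P_contact_form cA) (simp add: A_def vec_eq_iff scaleR_complex algebra_simps)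
  have JX': "nk_J p X' = \<i> *s X'" by (simp add: nk_J_def nk_P_contact_form cX')
  \<comment> \<open>This is r times the sine and cosine of \<pi>/4. It normalizes X: g(X, X) = 2 -
    2/3 = 4/3 and c^2 = 3/4.\<close>
  define c where "c = sqrt 3 / 2"
  have c2: "c * c = 3 / 4" and c0: "c \<noteq> 0" by (simp_all add: c_def)
  have cr: "sqrt 2 / 2 * r = c" by (simp add: r_def c_def)
  have AX: "A + X' = r *\<^sub>R X" by (simp add: A_def X'_def algebra_simps)
  have E1: "cos (pi / 4) *\<^sub>R A + sin (pi / 4) *\<^sub>R X' = c *\<^sub>R X"
    unfolding cos_45 sin_45 scaleR_add_right[symmetric] AX by (simp only: scaleR_scaleR cr)
  have E2: "sin (pi / 4) *\<^sub>R nk_J p A - cos (pi / 4) *\<^sub>R nk_J p X' = c *\<^sub>R (- (\<i> *s X))"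
  proof -
    have "nk_J p A - nk_J p X' = - (\<i> *s (A + X'))" by (simp add: JA JX' vec_eq_iff algebra_simps)
    also have "\<dots> = r *\<^sub>R (- (\<i> *s X))" unfolding AX by (simp add: vec_eq_iff scaleR_complex algebra_simps)
    finally show ?thesis
      unfolding cos_45 sin_45 scaleR_diff_right[symmetric] by (simp only: scaleR_scaleR cr)
  qed
  have "A \<in> D1 p"
  proof -
    have "A = (of_real r * \<omega>) *s quat_j p" by (simp add: A_def scaleR_smult vec_eq_iff algebra_simps)
    then show ?thesis unfolding D1_eq by blast
  qed
  moreover have "X' \<in> D2 p" by (simp add: D2_eq cX') (simp add: X'_def F jp)
  moreover have "E3 \<in> D2 p" by (simp add: D2_eq E3_def F)
  moreover have "nk_metric p A A = 1"
  proof -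
    have "contact_form A p * cnj (contact_form A p) = of_real (r * r) * (\<omega> * cnj \<omega>)" by (simp add: cA)
    then show ?thesis unfolding nk_metric_herm hA by (simp only: r2 \<omega>2) simp
  qed
  moreover have "nk_metric p X' X' = 1"
    unfolding nk_metric_herm hX' cX' by (simp only: r2 \<omega>2) simp
  moreover have "nk_orthonormal_basis p (frame_space X E) (c *\<^sub>R X) (c *\<^sub>R (- (\<i> *s X))) E3"
    unfolding nk_orthonormal_basis_def
  proof (intro conjI)
    let ?B = "{c *\<^sub>R X, c *\<^sub>R (- (\<i> *s X)), E3}"
    show "span ?B = frame_space X E"
    proof
      have "subspace (frame_space X E)"
      proof -
        have "frame_space X E = (\<lambda>(a, t). a *s X + t *\<^sub>R E) ` UNIV" by (auto simp: frame_space_def)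
        moreover have "linear (\<lambda>(a, t). a *s X + t *\<^sub>R E)"
          by (rule linearI) (auto simp: vec_eq_iff scaleR_complex algebra_simps)
        ultimately show ?thesis using linear_subspace_image subspace_UNIV by metis
      qed
      moreover have "?B \<subseteq> frame_space X E"
      proof -
        have "c *\<^sub>R X = of_real c *s X + 0 *\<^sub>R E" by (simp add: scaleR_smult)
        moreover have "c *\<^sub>R (- (\<i> *s X)) = (- of_real c * \<i>) *s X + 0 *\<^sub>R E"
          by (simp add: scaleR_smult vec_eq_iff)
        moreover have "E3 = 0 *s X + (1 / sqrt 2) *\<^sub>R E" by (simp add: E3_def)
        ultimately show ?thesis unfolding frame_space_def by blast
      qed
      ultimately show "span ?B \<subseteq> frame_space X E" by (rule span_minimal[rotated])
      show "frame_space X E \<subseteq> span ?B"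
      proof
        fix Y assume "Y \<in> frame_space X E"
        then obtain a t where Y: "Y = a *s X + t *\<^sub>R E" unfolding frame_space_def by blast
        have "Y = (Re a / c) *\<^sub>R (c *\<^sub>R X) + (- Im a / c) *\<^sub>R (c *\<^sub>R (- (\<i> *s X))) + (t * sqrt 2) *\<^sub>R E3"
        proof -
          have "a *s X = Re a *\<^sub>R X + Im a *\<^sub>R (\<i> *s X)"
            by (subst complex_eq[of a]) (simp add: vec_eq_iff scaleR_complex algebra_simps)
          then show ?thesis using c0 by (simp add: Y E3_def)
        qed
        also have "\<dots> \<in> span ?B" by (intro span_add span_scale span_base) auto
        finally show "Y \<in> span ?B" .
      qed
    qed
    have ww: "Re \<omega> * Re \<omega> + Im \<omega> * Im \<omega> = 2 / 3" using arg_cong[OF \<omega>2, of Re] by simp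
    have cc': "c * (c * x) = 3 / 4 * x" for x by (simp add: c2 flip: mult.assoc)
    show "nk_metric p (c *\<^sub>R X) (c *\<^sub>R X) = 1"
      by (simp add: nk_metric_herm F \<omega>_def[symmetric] cc' c2) (use ww in \<open>simp add: algebra_simps cc'\<close>)
    show "nk_metric p (c *\<^sub>R (- (\<i> *s X))) (c *\<^sub>R (- (\<i> *s X))) = 1"
      by (simp add: nk_metric_herm F \<omega>_def[symmetric] cc' c2) (use ww in \<open>simp add: algebra_simps cc'\<close>)
    show "nk_metric p E3 E3 = 1" by (simp add: nk_metric_herm E3_def F)
    show "nk_metric p (c *\<^sub>R X) (c *\<^sub>R (- (\<i> *s X))) = 0"
      by (simp add: nk_metric_herm F \<omega>_def[symmetric])
    show "nk_metric p (c *\<^sub>R X) E3 = 0" "nk_metric p (c *\<^sub>R (- (\<i> *s X))) E3 = 0"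
      by (simp_all add: nk_metric_herm E3_def F)
  qed
  ultimately show ?thesis unfolding E1[symmetric] E2[symmetric] by blast
qed

section \<open>Normalized lifts and their differentials\<close>

definition normalized :: "('a \<Rightarrow> complex^4) \<Rightarrow> 'a \<Rightarrow> complex^4"
  where "normalized N x = (N x \<bullet> N x) powr (- (1 / 2)) *\<^sub>R N x"

lemma inner_self_powr: "(v \<bullet> v) powr (- (1 / 2)) = inverse (norm (v :: 'a::real_inner))"
  using powr_minus[of "v \<bullet> v" "1 / 2"] by (simp add: powr_half_sqrt norm_eq_sqrt_inner)

lemma normalized_eq: "N x \<noteq> 0 \<Longrightarrow> normalized N x = N x /\<^sub>R norm (N x)"
  by (simp add: normalized_def inner_self_powr)

text \<open>Writing the inverse norm as a power of the inner product reduces smoothness to that of a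
  bilinear map followed by a real power.\<close>

lemma smooth_on_normalized:
  assumes "open U" "smooth_on N U" "\<And>x. x \<in> U \<Longrightarrow> N x \<noteq> 0"
  shows "smooth_on (normalized N) U"
proof -
  have "smooth_on (\<lambda>x. N x \<bullet> N x) U"
    by (rule smooth_on_bounded_bilinear[OF assms(1) bounded_bilinear_inner assms(2,2)])
  then have "smooth_on (\<lambda>x. (N x \<bullet> N x) powr (- (1 / 2))) U"
    by (rule smooth_on_powr[OF assms(1), rotated]) (use assms(3) in simp)
  then show ?thesis unfolding normalized_def[abs_def]
    by (rule smooth_on_scaleR[OF assms(1) _ assms(2)])
qed

text \<open>Rescaling by a real function and adding a multiple of the base point are invisible downstairs.\<close>

lemma hopf_differential_normalized:
  assumes U: "open U" "x \<in> U" and N: "smooth_on N U" "\<And>y. y \<in> U \<Longrightarrow> N y \<noteq> 0"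
    and der: "(N has_derivative N') (at x)" and N': "N' v = Y + \<tau> *s N x" "herm Y (N x) = 0"
  shows "hopf_differential (normalized N) x v = Y /\<^sub>R norm (N x)"
proof -
  have nz: "N x \<noteq> 0" using N(2) U(2) .
  define \<rho> where "\<rho> y = (N y \<bullet> N y) powr (- (1 / 2))" for y
  have "smooth_on \<rho> U" unfolding \<rho>_def[abs_def]
    by (intro smooth_on_powr smooth_on_bounded_bilinear[OF _ bounded_bilinear_inner] N U) (use N in auto)
  then have der\<rho>: "(\<rho> has_derivative frechet_derivative \<rho> (at x)) (at x)"
    using smooth_on_has_derivative U(2) by blast
  have d: "(normalized N has_derivative (\<lambda>h. \<rho> x *\<^sub>R N' h + frechet_derivative \<rho> (at x) h *\<^sub>R N x)) (at x)"
    unfolding normalized_def[abs_def] \<rho>_def[symmetric] by (rule has_derivative_scaleR[OF der\<rho> der])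
  have \<rho>: "\<rho> x = inverse (norm (N x))"
    by (simp add: \<rho>_def inner_self_powr)
  define k where "k = of_real (\<rho> x) * \<tau> + of_real (frechet_derivative \<rho> (at x) v)"
  have F: "frechet_derivative (normalized N) (at x) v = Y /\<^sub>R norm (N x) + k *s N x"
    unfolding frechet_derivative_at[OF d, symmetric] N'(1) \<rho> k_def
    by (simp add: vec_eq_iff scaleR_complex algebra_simps)
  have key: "herm (N x) (normalized N x) *s normalized N x = N x"
    using nz by (simp add: normalized_eq[of N x, OF nz] herm_self scaleR_smult vec_eq_iff power2_eq_square field_simps)
  have h: "herm (Y /\<^sub>R norm (N x) + k *s N x) (normalized N x) = k * herm (N x) (normalized N x)"
    by (simp add: normalized_eq[of N x, OF nz] N'(2))
  show ?thesis
    unfolding hopf_differential_def horizontal_part_herm F h vector_smult_assoc[symmetric] key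
    by simp
qed

section \<open>Charts of the Lagrangian\<close>

text \<open>The two affine charts [1 : z] and [z : 1] of the projective line, selected by a
  flag.\<close>

definition chart_fst :: "bool \<Rightarrow> complex \<Rightarrow> complex" where "chart_fst \<epsilon> z = (if \<epsilon> then 1 else z)"
definition chart_snd :: "bool \<Rightarrow> complex \<Rightarrow> complex" where "chart_snd \<epsilon> z = (if \<epsilon> then z else 1)"

text \<open>
  The plane of the one-parameter subgroup at the angle \<open>u\<close> has \<open>(m, n) = (cos u + \<i> cc sin u, sc sin u)\<close>.
  Up to scaling this is \<open>chart_m\<close>, \<open>chart_n\<close> with \<open>t = tan u\<close> or \<open>t = cot u\<close>, and \<open>circle_m\<close>, \<open>circle_n\<close>
  below with \<open>\<sigma> = exp(2 \<i> u)\<close>: the plane has period \<open>\<pi>\<close>.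
\<close>

definition chart_m :: "bool \<Rightarrow> real \<Rightarrow> complex"
  where "chart_m \<delta> t = (if \<delta> then 1 + \<i> * cc * of_real t else of_real t + \<i> * cc)"
definition chart_n :: "bool \<Rightarrow> real \<Rightarrow> complex"
  where "chart_n \<delta> t = (if \<delta> then sc * of_real t else sc)"

definition cone :: "bool \<Rightarrow> bool \<Rightarrow> ('a \<Rightarrow> complex) \<Rightarrow> ('a \<Rightarrow> real) \<Rightarrow> 'a \<Rightarrow> complex^4"
  where "cone \<epsilon> \<delta> \<zeta> \<tau> x
    = lag (chart_fst \<epsilon> (\<zeta> x)) (chart_snd \<epsilon> (\<zeta> x)) (chart_m \<delta> (\<tau> x)) (chart_n \<delta> (\<tau> x))"

text \<open>X replaces the first factor by its orthogonal complement, E the second; the product form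
  of \<open>herm\<close> gives orthogonality. N and the direction E share the first factor, so their
  determinant is zero. Hypothesis \<open>mn\<close> makes the contact value of X equal to
  \<open>sc * \<i>\<close>.\<close>

lemma adapted_frame_lag:
  assumes S: "s = (cmod \<alpha>)\<^sup>2 + (cmod \<beta>)\<^sup>2" "s > 0" and R: "r = (cmod m)\<^sup>2 + (cmod n)\<^sup>2" "r > 0"
    and mn: "sc * \<i> * (m * m + n * n) + cc * (m * n + n * m) = sc * \<i> * of_real r"
    and N: "N = lag \<alpha> \<beta> m n"
  shows "norm N > 0"
    "adapted_frame (N /\<^sub>R norm N) (lag (- cnj \<beta>) (cnj \<alpha>) m n /\<^sub>R norm N) (lag \<alpha> \<beta> (- cnj n) (cnj m) /\<^sub>R norm N)"
proof -
  have n2: "(norm N)\<^sup>2 = s * r" by (simp add: N norm_lag S(1) R(1))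
  then have "norm N \<noteq> 0" using S(2) R(2) by auto
  then show n0: "norm N > 0" by simp
  have S': "\<alpha> * cnj \<alpha> + \<beta> * cnj \<beta> = of_real s" and R': "m * cnj m + n * cnj n = of_real r"
    by (simp_all add: S(1) R(1) of_real_cmod_square)
  have S'': "cnj \<beta> * \<beta> + cnj \<alpha> * \<alpha> = of_real s" and R'': "cnj n * n + cnj m * m = of_real r"
    using S' R' by (simp_all add: algebra_simps)
  have u: "complex_of_real (inverse (norm N)) * (complex_of_real (inverse (norm N)) * (of_real s * of_real r)) = 1"
  proof -
    have "inverse (norm N) * (inverse (norm N) * (s * r)) = 1"
      unfolding n2[symmetric] using n0 by (simp add: power2_eq_square field_simps)
    then show ?thesis unfolding of_real_mult[symmetric] by simp
  qed
  have c: "contact_form (lag (- cnj \<beta>) (cnj \<alpha>) m n) N = of_real s * (sc * \<i> * of_real r)"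
    unfolding N contact_form_lag mn using S'' by (simp add: algebra_simps)
  have c': "contact_form (lag (- cnj \<beta>) (cnj \<alpha>) m n /\<^sub>R norm N) (N /\<^sub>R norm N) = sc * \<i>"
  proof -
    have "contact_form (lag (- cnj \<beta>) (cnj \<alpha>) m n /\<^sub>R norm N) (N /\<^sub>R norm N)
      = (complex_of_real (inverse (norm N)) * (complex_of_real (inverse (norm N)) * (of_real s * of_real r))) * (sc * \<i>)"
      by (simp add: c algebra_simps)
    then show ?thesis by (simp only: u mult_1_left)
  qed
  have h: "herm (v /\<^sub>R norm N) (w /\<^sub>R norm N) = 1" if "herm v w = of_real s * of_real r" for v w :: "complex^4"
    using that u by simp
  have h0: "herm (v /\<^sub>R norm N) (w /\<^sub>R norm N) = 0" if "herm v w = 0" for v w :: "complex^4"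
    using that by simp
  show "adapted_frame (N /\<^sub>R norm N) (lag (- cnj \<beta>) (cnj \<alpha>) m n /\<^sub>R norm N) (lag \<alpha> \<beta> (- cnj n) (cnj m) /\<^sub>R norm N)"
    unfolding adapted_frame_def
  proof (intro conjI h h0)
    show "herm N N = of_real s * of_real r" unfolding N herm_lag S' R' ..
    show "herm (lag (- cnj \<beta>) (cnj \<alpha>) m n) (lag (- cnj \<beta>) (cnj \<alpha>) m n) = of_real s * of_real r"
      unfolding herm_lag R' using S'' by simp
    show "herm (lag \<alpha> \<beta> (- cnj n) (cnj m)) (lag \<alpha> \<beta> (- cnj n) (cnj m)) = of_real s * of_real r"
      unfolding herm_lag S' using R'' by simp
    show "herm (lag (- cnj \<beta>) (cnj \<alpha>) m n) N = 0" "herm (lag \<alpha> \<beta> (- cnj n) (cnj m)) N = 0"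
      "herm (lag (- cnj \<beta>) (cnj \<alpha>) m n) (lag \<alpha> \<beta> (- cnj n) (cnj m)) = 0"
      unfolding N herm_lag by (simp_all add: mult.commute)
    show "contact_form (lag (- cnj \<beta>) (cnj \<alpha>) m n /\<^sub>R norm N) (N /\<^sub>R norm N) *
      cnj (contact_form (lag (- cnj \<beta>) (cnj \<alpha>) m n /\<^sub>R norm N) (N /\<^sub>R norm N)) = 2 / 3"
      unfolding c' by (simp add: algebra_simps sc_cc_mult)
    show "contact_form (lag \<alpha> \<beta> (- cnj n) (cnj m) /\<^sub>R norm N) (N /\<^sub>R norm N) = 0"
      by (simp add: N contact_form_lag)
  qed
qed

lemma chart_fst_snd_norm: "(cmod (chart_fst \<epsilon> z))\<^sup>2 + (cmod (chart_snd \<epsilon> z))\<^sup>2 = 1 + (cmod z)\<^sup>2"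
  by (simp add: chart_fst_def chart_snd_def)

lemma chart_m_n_norm: "(cmod (chart_m \<delta> t))\<^sup>2 + (cmod (chart_n \<delta> t))\<^sup>2 = 1 + t\<^sup>2"
proof -
  have "complex_of_real ((cmod (chart_m \<delta> t))\<^sup>2 + (cmod (chart_n \<delta> t))\<^sup>2) = of_real (1 + t\<^sup>2)"
    unfolding of_real_add of_real_power of_real_cmod_square
    by (simp add: chart_m_def chart_n_def power2_eq_square algebra_simps sc_cc_mult)
  then show ?thesis unfolding of_real_eq_iff .
qed

text \<open>The symmetric form keeps the value \<open>sc * \<i>\<close> times the squared norm of
  (m, n). So all planes of the family make the same angle with \<open>D2\<close> as the model plane,
  where (m, n) = (1, 0).\<close>

lemma chart_m_n_contact:
  "sc * \<i> * (chart_m \<delta> t * chart_m \<delta> t + chart_n \<delta> t * chart_n \<delta> t)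
    + cc * (chart_m \<delta> t * chart_n \<delta> t + chart_n \<delta> t * chart_m \<delta> t) = sc * \<i> * of_real (1 + t\<^sup>2)"
  by (simp add: chart_m_def chart_n_def power2_eq_square algebra_simps sc_cc_mult)

lemma lag_linear:
  "lag (p * \<alpha> + q * \<alpha>') (p * \<beta> + q * \<beta>') m n = p *s lag \<alpha> \<beta> m n + q *s lag \<alpha>' \<beta>' m n"
  "lag \<alpha> \<beta> (p * m + q * m') (p * n + q * n') = p *s lag \<alpha> \<beta> m n + q *s lag \<alpha> \<beta> m' n'"
  by (simp_all add: lag_def vec_eq_iff forall_4 algebra_simps)

text \<open>(- cnj \<beta>, cnj \<alpha>) and (\<alpha>, \<beta>) form an orthogonal basis of the
  plane; the coefficients are a determinant and a Hermitian product. In a differential the second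
  summand is vertical and disappears.\<close>

lemma lag_split:
  assumes "\<alpha> * cnj \<alpha> + \<beta> * cnj \<beta> = s" "s \<noteq> 0"
  shows "lag \<alpha>' \<beta>' m n = ((\<alpha> * \<beta>' - \<beta> * \<alpha>') / s) *s lag (- cnj \<beta>) (cnj \<alpha>) m n
    + ((\<alpha>' * cnj \<alpha> + \<beta>' * cnj \<beta>) / s) *s lag \<alpha> \<beta> m n"
proof -
  have "\<alpha>' = (\<alpha> * \<beta>' - \<beta> * \<alpha>') / s * (- cnj \<beta>) + (\<alpha>' * cnj \<alpha> + \<beta>' * cnj \<beta>) / s * \<alpha>" (is "_ = ?a")
    and "\<beta>' = (\<alpha> * \<beta>' - \<beta> * \<alpha>') / s * cnj \<alpha> + (\<alpha>' * cnj \<alpha> + \<beta>' * cnj \<beta>) / s * \<beta>" (is "_ = ?b")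
    using assms(2) by (simp_all add: field_simps) (simp_all add: algebra_simps flip: assms(1))
  then have "lag \<alpha>' \<beta>' m n = lag ?a ?b m n" by simp
  also have "\<dots> = ((\<alpha> * \<beta>' - \<beta> * \<alpha>') / s) *s lag (- cnj \<beta>) (cnj \<alpha>) m n
    + ((\<alpha>' * cnj \<alpha> + \<beta>' * cnj \<beta>) / s) *s lag \<alpha> \<beta> m n"
    by (rule lag_linear)
  finally show ?thesis .
qed

lemma lag_split':
  assumes "m * cnj m + n * cnj n = r" "r \<noteq> 0"
  shows "lag \<alpha> \<beta> m' n' = ((m * n' - n * m') / r) *s lag \<alpha> \<beta> (- cnj n) (cnj m)
    + ((m' * cnj m + n' * cnj n) / r) *s lag \<alpha> \<beta> m n"
proof -
  have "m' = (m * n' - n * m') / r * (- cnj n) + (m' * cnj m + n' * cnj n) / r * m" (is "_ = ?a")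
    and "n' = (m * n' - n * m') / r * cnj m + (m' * cnj m + n' * cnj n) / r * n" (is "_ = ?b")
    using assms(2) by (simp_all add: field_simps) (simp_all add: algebra_simps flip: assms(1))
  then have "lag \<alpha> \<beta> m' n' = lag \<alpha> \<beta> ?a ?b" by simp
  also have "\<dots> = ((m * n' - n * m') / r) *s lag \<alpha> \<beta> (- cnj n) (cnj m)
    + ((m' * cnj m + n' * cnj n) / r) *s lag \<alpha> \<beta> m n"
    by (rule lag_linear)
  finally show ?thesis .
qed

text \<open>Expansion by bilinearity reduces smoothness and derivatives of \<open>lag\<close> to
  those of sums of products.\<close>

lemma lag_expand:
  "lag \<alpha> \<beta> m n = (\<alpha> * m) *s lag 1 0 1 0 + (\<beta> * m) *s lag 0 1 1 0 + (\<alpha> * n) *s lag 1 0 0 1 + (\<beta> * n) *s lag 0 1 0 1"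
  by (simp add: lag_def vec_eq_iff forall_4 algebra_simps)

lemma bounded_linear_smult_vec: "bounded_linear (\<lambda>c. c *s (v :: complex^'n::finite))"
  by (rule bounded_bilinear.bounded_linear_left[OF bounded_bilinear_smult])

lemma smooth_on_lag:
  assumes "open U" "smooth_on \<alpha> U" "smooth_on \<beta> U" "smooth_on m U" "smooth_on n U"
  shows "smooth_on (\<lambda>x. lag (\<alpha> x) (\<beta> x) (m x) (n x)) U"
  unfolding lag_expand[of "\<alpha> _"]
  by (intro smooth_on_add smooth_on_bounded_linear_compose[OF _ bounded_linear_smult_vec] smooth_on_mult assms)

lemma has_derivative_lag:
  assumes "(\<alpha> has_derivative \<alpha>') (at x)" "(\<beta> has_derivative \<beta>') (at x)"
    "(m has_derivative m') (at x)" "(n has_derivative n') (at x)"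
  shows "((\<lambda>x. lag (\<alpha> x) (\<beta> x) (m x) (n x)) has_derivative
    (\<lambda>v. lag (\<alpha>' v) (\<beta>' v) (m x) (n x) + lag (\<alpha> x) (\<beta> x) (m' v) (n' v))) (at x)"
proof -
  note p = bounded_linear.has_derivative[OF bounded_linear_smult_vec has_derivative_mult]
  show ?thesis unfolding lag_expand[of "\<alpha> _"]
    by (rule has_derivative_eq_rhs,
        rule has_derivative_add[OF has_derivative_add[OF has_derivative_add[OF
            p[OF assms(1,3)] p[OF assms(2,3)]] p[OF assms(1,4)]] p[OF assms(2,4)]])
      (simp add: fun_eq_iff lag_expand[of "\<alpha>' _"] vec_eq_iff algebra_simps)
qed

text \<open>By the product rule, moving the first factor gives a complex multiple of X and moving
  the second a real multiple of E, up to vertical terms. \<zeta> and \<tau> stay general so that one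
  computation serves the threefold and, with \<tau> = 0, the sphere.\<close>

lemma cone_chart:
  fixes \<zeta> :: "'a::real_normed_vector \<Rightarrow> complex" and \<tau> :: "'a \<Rightarrow> real"
    and \<epsilon> \<delta> :: bool
  assumes \<zeta>: "bounded_linear \<zeta>" and \<tau>: "bounded_linear \<tau>"
  defines "N \<equiv> cone \<epsilon> \<delta> \<zeta> \<tau>"
  shows "N x \<noteq> 0" "smooth_on N UNIV"
    "\<exists>X E k l. k \<noteq> 0 \<and> l \<noteq> 0 \<and> adapted_frame (normalized N x) X E \<and>
      (\<forall>v. hopf_differential (normalized N) x v = (of_real k * \<zeta> v) *s X + (l * \<tau> v) *\<^sub>R E)"
proof -
  have r\<tau>: "bounded_linear (\<lambda>x. complex_of_real (\<tau> x))"
    using bounded_linear_compose[OF bounded_linear_of_real \<tau>] .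
  define a b m n where "a = (\<lambda>x. chart_fst \<epsilon> (\<zeta> x))" and "b = (\<lambda>x. chart_snd \<epsilon> (\<zeta> x))"
    and "m = (\<lambda>x. chart_m \<delta> (\<tau> x))" and "n = (\<lambda>x. chart_n \<delta> (\<tau> x))"
  note abmn = a_def b_def m_def n_def
  have N: "N = (\<lambda>x. lag (a x) (b x) (m x) (n x))" by (simp add: N_def cone_def[abs_def] abmn)
  define s where "s y = 1 + (cmod (\<zeta> y))\<^sup>2" for y
  define r where "r y = 1 + (\<tau> y)\<^sup>2" for y
  have S: "s y = (cmod (a y))\<^sup>2 + (cmod (b y))\<^sup>2" "s y > 0" and R: "r y = (cmod (m y))\<^sup>2 + (cmod (n y))\<^sup>2" "r y > 0" for y
    unfolding abmn by (simp_all only: chart_fst_snd_norm chart_m_n_norm s_def r_def)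
      (simp_all add: add_pos_nonneg)
  have mn: "sc * \<i> * (m y * m y + n y * n y) + cc * (m y * n y + n y * m y) = sc * \<i> * of_real (r y)" for y
    unfolding r_def m_def n_def by (rule chart_m_n_contact)
  note frame = adapted_frame_lag[OF S R mn fun_cong[OF N]]
  show N0: "N y \<noteq> 0" for y using frame(1)[of y] by auto
  have lin: "smooth_on (\<lambda>x. u + w * \<zeta> x) UNIV" "smooth_on (\<lambda>x. u + w * of_real (\<tau> x)) UNIV"
    "((\<lambda>x. u + w * \<zeta> x) has_derivative (\<lambda>v. w * \<zeta> v)) (at x)"
    "((\<lambda>x. u + w * of_real (\<tau> x)) has_derivative (\<lambda>v. w * of_real (\<tau> v))) (at x)" for u w x
  proof -
    show "smooth_on (\<lambda>x. u + w * \<zeta> x) UNIV" "smooth_on (\<lambda>x. u + w * of_real (\<tau> x)) UNIV"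
      by (intro smooth_on_add smooth_on_mult smooth_on_const smooth_on_bounded_linear \<zeta> r\<tau> open_UNIV)+
    show "((\<lambda>x. u + w * \<zeta> x) has_derivative (\<lambda>v. w * \<zeta> v)) (at x)"
      using bounded_linear.has_derivative[OF \<zeta> has_derivative_ident] by (auto intro!: derivative_eq_intros)
    show "((\<lambda>x. u + w * of_real (\<tau> x)) has_derivative (\<lambda>v. w * of_real (\<tau> v))) (at x)"
      using bounded_linear.has_derivative[OF \<tau> has_derivative_ident] by (auto intro!: derivative_eq_intros)
  qed
  define u1 w1 u2 w2 p1 q1 p2 q2 where
    "u1 = (if \<epsilon> then 1 else 0 :: complex)" and "w1 = (if \<epsilon> then 0 else 1 :: complex)" and
    "u2 = (if \<epsilon> then 0 else 1 :: complex)" and "w2 = (if \<epsilon> then 1 else 0 :: complex)" and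
    "p1 = (if \<delta> then 1 else \<i> * cc)" and "q1 = (if \<delta> then \<i> * cc else 1)" and
    "p2 = (if \<delta> then 0 else sc)" and "q2 = (if \<delta> then sc else 0)"
  note coeff_defs = u1_def u2_def w1_def w2_def p1_def p2_def q1_def q2_def
  have eqs: "a = (\<lambda>x. u1 + w1 * \<zeta> x)" "b = (\<lambda>x. u2 + w2 * \<zeta> x)"
    "m = (\<lambda>x. p1 + q1 * of_real (\<tau> x))" "n = (\<lambda>x. p2 + q2 * of_real (\<tau> x))"
    by (simp_all add: abmn coeff_defs chart_fst_def chart_snd_def chart_m_def chart_n_def fun_eq_iff)
  show sN: "smooth_on N UNIV" unfolding N
    by (intro smooth_on_lag open_UNIV) (unfold eqs, (rule lin)+)
  define N' where "N' v = lag (w1 * \<zeta> v) (w2 * \<zeta> v) (m x) (n x)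
    + lag (a x) (b x) (q1 * of_real (\<tau> v)) (q2 * of_real (\<tau> v))" for v
  have der: "(N has_derivative N') (at x)"
    unfolding N N'_def[abs_def] by (rule has_derivative_lag) (unfold eqs, (rule lin)+)
  define X0 where "X0 = lag (- cnj (b x)) (cnj (a x)) (m x) (n x)"
  define E0 where "E0 = lag (a x) (b x) (- cnj (n x)) (cnj (m x))"
  define k where "k = (if \<epsilon> then 1 else -1) / s x"
  define l where "l = (if \<delta> then 1 else -1) * (sqrt 2 / sqrt 3) / r x"
  have "s x \<noteq> 0" "r x \<noteq> 0" using S(2)[of x] R(2)[of x] by simp_all
  then have Sc: "a x * cnj (a x) + b x * cnj (b x) = of_real (s x)" "complex_of_real (s x) \<noteq> 0"
    and Rc: "m x * cnj (m x) + n x * cnj (n x) = of_real (r x)" "complex_of_real (r x) \<noteq> 0"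
    unfolding of_real_eq_0_iff by (simp_all add: S(1) R(1) of_real_cmod_square)
  have "\<exists>\<mu>. N' v = (of_real k * \<zeta> v) *s X0 + (l * \<tau> v) *\<^sub>R E0 + \<mu> *s N x" for v
  proof -
    have 1: "(a x * (w2 * \<zeta> v) - b x * (w1 * \<zeta> v)) / of_real (s x) = of_real k * \<zeta> v"
      by (simp add: eqs k_def coeff_defs)
    \<comment> \<open>The determinant of (m, n) and its derivative is the real constant sc or - sc.
      This reality is the phase condition that confines the second factor to real multiples of
      \<open>E0\<close>.\<close>
    have 2: "(m x * (q2 * of_real (\<tau> v)) - n x * (q1 * of_real (\<tau> v))) / of_real (r x) = of_real (l * \<tau> v)"
      by (simp add: eqs l_def coeff_defs sc_def algebra_simps)
    have collect: "u + m1 *s w + (u' + m2 *s w) = u + u' + (m1 + m2) *s w" for u u' w :: "complex^4" and m1 m2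
      by (simp add: vec_eq_iff algebra_simps)
    show ?thesis
      unfolding N'_def lag_split[OF Sc, of "w1 * \<zeta> v" "w2 * \<zeta> v"] lag_split'[OF Rc, of _ _ "q1 * of_real (\<tau> v)"]
        1 2 X0_def[symmetric] E0_def[symmetric] scaleR_smult
      unfolding fun_cong[OF N, symmetric] collect by blast
  qed
  then obtain \<mu> where N': "\<And>v. N' v = (of_real k * \<zeta> v) *s X0 + (l * \<tau> v) *\<^sub>R E0 + \<mu> v *s N x" by metis
  have h0: "herm X0 (N x) = 0" "herm E0 (N x) = 0"
    by (simp_all add: X0_def E0_def N herm_lag mult.commute)
  have hd: "hopf_differential (normalized N) x v
      = (of_real k * \<zeta> v) *s (X0 /\<^sub>R norm (N x)) + (l * \<tau> v) *\<^sub>R (E0 /\<^sub>R norm (N x))" for v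
    by (subst hopf_differential_normalized[OF open_UNIV UNIV_I sN N0 der N'])
      (simp_all add: h0 vec_eq_iff scaleR_complex algebra_simps)
  have af: "adapted_frame (normalized N x) (X0 /\<^sub>R norm (N x)) (E0 /\<^sub>R norm (N x))"
    unfolding normalized_eq[of N x, OF N0] X0_def E0_def by (rule frame(2))
  have "k \<noteq> 0" "l \<noteq> 0" using S(2)[of x] R(2)[of x] by (simp_all add: k_def l_def)
  then show "\<exists>X E k l. k \<noteq> 0 \<and> l \<noteq> 0 \<and> adapted_frame (normalized N x) X E \<and>
      (\<forall>v. hopf_differential (normalized N) x v = (of_real k * \<zeta> v) *s X + (l * \<tau> v) *\<^sub>R E)"
    using hd af by blast
qed

section \<open>The Lagrangian immersion\<close>

definition esgn :: "bool \<Rightarrow> real" where "esgn b = (if b then 1 else - 1)"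

lemma esgn_simps [simp]: "esgn True = 1" "esgn False = - 1" "esgn b * esgn b = 1" "esgn b * (esgn b * x) = x"
  by (auto simp: esgn_def)

text \<open>Inverse stereographic projection from the south pole for \<open>True\<close> and from
  the north pole for \<open>False\<close>. The sign in the second coordinate makes the change of
  charts z \<mapsto> 1/z, as between [1 : z] and [z : 1].\<close>

definition stereo :: "bool \<Rightarrow> complex \<Rightarrow> real^3"
  where "stereo \<epsilon> z = vector [2 * Re z / (1 + (cmod z)\<^sup>2), esgn \<epsilon> * (2 * Im z) / (1 + (cmod z)\<^sup>2),
    esgn \<epsilon> * (1 - (cmod z)\<^sup>2) / (1 + (cmod z)\<^sup>2)]"

definition unstereo :: "bool \<Rightarrow> real^3 \<Rightarrow> complex"
  where "unstereo \<epsilon> y = Complex (y $ 1 / (1 + esgn \<epsilon> * y $ 3)) (esgn \<epsilon> * y $ 2 / (1 + esgn \<epsilon> * y $ 3))"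

text \<open>The rational parametrization of exp(2 i u) by t = tan u or t = cot u.\<close>

definition circ :: "bool \<Rightarrow> real \<Rightarrow> complex"
  where "circ \<delta> t = Complex (esgn \<delta> * (1 - t\<^sup>2) / (1 + t\<^sup>2)) (2 * t / (1 + t\<^sup>2))"

definition uncirc :: "bool \<Rightarrow> complex \<Rightarrow> real"
  where "uncirc \<delta> \<sigma> = Im \<sigma> / (1 + esgn \<delta> * Re \<sigma>)"

lemma one_plus_square [simp]: "1 + (x::real)\<^sup>2 \<noteq> 0" "1 + x\<^sup>2 > 0"
  using zero_le_power2[of x] by linarith+

lemma norm_3_eq_1: "norm (y :: real^3) = 1 \<longleftrightarrow> (y $ 1)\<^sup>2 + (y $ 2)\<^sup>2 + (y $ 3)\<^sup>2 = 1"
  by (simp add: norm_eq_1 inner_vec_def sum_3 power2_eq_square)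

lemma stereo_pole: "1 + esgn \<epsilon> * stereo \<epsilon> z $ 3 = 2 / (1 + (cmod z)\<^sup>2)"
proof -
  have "1 + (1 - x) / (1 + x) = 2 / (1 + x)" if "1 + x \<noteq> 0" for x :: real using that by (simp add: field_simps)
  from this[OF one_plus_square(1)] show ?thesis by (simp add: stereo_def times_divide_eq_right[symmetric] del: times_divide_eq_right)
qed

lemma unstereo_stereo: "unstereo \<epsilon> (stereo \<epsilon> z) = z"
  unfolding unstereo_def stereo_pole by (simp add: stereo_def complex_eq_iff)

lemma norm_stereo: "norm (stereo \<epsilon> z) = 1"
proof -
  define x where "x = 1 + (cmod z)\<^sup>2"
  have x: "x \<noteq> 0" "(cmod z)\<^sup>2 = x - 1" by (simp_all add: x_def)
  have ri: "(Re z)\<^sup>2 + (Im z)\<^sup>2 = x - 1" using x(2) by (simp add: cmod_power2)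
  have e: "(esgn \<epsilon>)\<^sup>2 = 1" by (simp add: power2_eq_square)
  have "(2 * Re z / x)\<^sup>2 + (esgn \<epsilon> * (2 * Im z) / x)\<^sup>2 + (esgn \<epsilon> * (1 - (x - 1)) / x)\<^sup>2
     = (4 * ((Re z)\<^sup>2 + (Im z)\<^sup>2) + (2 - x)\<^sup>2) / x\<^sup>2"
    by (simp add: power_divide power_mult_distrib e add_divide_distrib)
  also have "\<dots> = 1" unfolding ri using x(1) by (simp add: power2_eq_square field_simps)
  finally show ?thesis unfolding norm_3_eq_1 stereo_def vector_3 x(2) by simp
qed

text \<open>In terms of d, the equation of the sphere reads (y 1)^2 + (y 2)^2 = d (2 - d), so the
  squared modulus of the coordinate is 2/d - 1 and the rest is rational in d.\<close>

lemma stereo_unstereo: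
  assumes y: "norm y = 1" "1 + esgn \<epsilon> * y $ 3 \<noteq> 0"
  shows "stereo \<epsilon> (unstereo \<epsilon> y) = y"
proof -
  define d where "d = 1 + esgn \<epsilon> * y $ 3"
  have e: "(esgn \<epsilon>)\<^sup>2 = 1" by (simp add: power2_eq_square)
  have y3: "y $ 3 = esgn \<epsilon> * (d - 1)" by (simp add: d_def algebra_simps)
  have d: "d \<noteq> 0" using y(2) by (simp add: d_def)
  have "(y $ 1)\<^sup>2 + (y $ 2)\<^sup>2 = 1 - (y $ 3)\<^sup>2" using y(1) norm_3_eq_1 by simp
  also have "\<dots> = d * (2 - d)" unfolding y3 power_mult_distrib e by (simp add: power2_eq_square algebra_simps)
  finally have s: "(y $ 1)\<^sup>2 + (y $ 2)\<^sup>2 = d * (2 - d)" .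
  have "(cmod (unstereo \<epsilon> y))\<^sup>2 = ((y $ 1)\<^sup>2 + (y $ 2)\<^sup>2) / d\<^sup>2"
    by (simp add: unstereo_def cmod_power2 power_divide power_mult_distrib e d_def add_divide_distrib)
  also have "\<dots> = (2 - d) / d" unfolding s using d by (simp add: power2_eq_square)
  finally have c: "(cmod (unstereo \<epsilon> y))\<^sup>2 = 2 / d - 1" using d by (simp add: field_simps)
  have u: "Re (unstereo \<epsilon> y) = y $ 1 / d" "Im (unstereo \<epsilon> y) = esgn \<epsilon> * y $ 2 / d"
    by (simp_all add: unstereo_def d_def)
  have q: "1 + (2 / d - 1) = 2 / d" "1 - (2 / d - 1) = 2 * (d - 1) / d" using d by (simp_all add: field_simps)
  show ?thesis
    unfolding stereo_def c u vec_eq_iff forall_3 vector_3 q y3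
    using d by simp
qed

lemma circ_pole: "1 + esgn \<delta> * Re (circ \<delta> t) = 2 / (1 + t\<^sup>2)"
proof -
  have "1 + (1 - x) / (1 + x) = 2 / (1 + x)" if "1 + x \<noteq> 0" for x :: real using that by (simp add: field_simps)
  from this[OF one_plus_square(1)] show ?thesis by (simp add: circ_def times_divide_eq_right[symmetric] del: times_divide_eq_right)
qed

lemma uncirc_circ: "uncirc \<delta> (circ \<delta> t) = t"
  unfolding uncirc_def circ_pole by (simp add: circ_def)

lemma norm_circ: "cmod (circ \<delta> t) = 1"
proof -
  have e: "(esgn \<delta>)\<^sup>2 = 1" by (simp add: power2_eq_square)
  have "(cmod (circ \<delta> t))\<^sup>2 = ((1 - t\<^sup>2)\<^sup>2 + (2 * t)\<^sup>2) / (1 + t\<^sup>2)\<^sup>2"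
    by (simp add: circ_def cmod_power2 power_divide power_mult_distrib e add_divide_distrib)
  also have "(1 - t\<^sup>2)\<^sup>2 + (2 * t)\<^sup>2 = (1 + t\<^sup>2)\<^sup>2" by (simp add: power2_eq_square algebra_simps)
  finally have "(cmod (circ \<delta> t))\<^sup>2 = 1" by simp
  then show ?thesis by (simp add: power2_eq_1_iff) (smt (verit) norm_ge_zero)
qed

lemma circ_uncirc:
  assumes \<sigma>: "cmod \<sigma> = 1" "1 + esgn \<delta> * Re \<sigma> \<noteq> 0"
  shows "circ \<delta> (uncirc \<delta> \<sigma>) = \<sigma>"
proof -
  define d where "d = 1 + esgn \<delta> * Re \<sigma>"
  have e: "(esgn \<delta>)\<^sup>2 = 1" by (simp add: power2_eq_square)
  have r: "Re \<sigma> = esgn \<delta> * (d - 1)" by (simp add: d_def algebra_simps)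
  have d: "d \<noteq> 0" using \<sigma>(2) by (simp add: d_def)
  have "(Im \<sigma>)\<^sup>2 = 1 - (Re \<sigma>)\<^sup>2" using \<sigma>(1) cmod_power2[of \<sigma>] by simp
  also have "\<dots> = d * (2 - d)" unfolding r power_mult_distrib e by (simp add: power2_eq_square algebra_simps)
  finally have s: "(Im \<sigma>)\<^sup>2 = d * (2 - d)" .
  have "(uncirc \<delta> \<sigma>)\<^sup>2 = (Im \<sigma>)\<^sup>2 / d\<^sup>2" by (simp add: uncirc_def power_divide d_def)
  also have "\<dots> = (2 - d) / d" unfolding s using d by (simp add: power2_eq_square)
  finally have c: "(uncirc \<delta> \<sigma>)\<^sup>2 = 2 / d - 1" using d by (simp add: field_simps)
  have u: "uncirc \<delta> \<sigma> = Im \<sigma> / d" by (simp add: uncirc_def d_def)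
  have q: "1 + (2 / d - 1) = 2 / d" "1 - (2 / d - 1) = 2 * (d - 1) / d" using d by (simp_all add: field_simps)
  show ?thesis
    unfolding circ_def c complex_eq_iff complex.sel q r
    unfolding u using d by simp
qed

lemma continuous_on_stereo: "continuous_on UNIV (stereo \<epsilon>)"
proof -
  have "continuous_on UNIV (\<lambda>z. \<chi> i. stereo \<epsilon> z $ i)"
  proof (rule continuous_on_vec_lambda)
    fix i :: 3
    have "continuous_on UNIV (\<lambda>z. 2 * Re z / (1 + (cmod z)\<^sup>2))"
      "continuous_on UNIV (\<lambda>z. esgn \<epsilon> * (2 * Im z) / (1 + (cmod z)\<^sup>2))"
      "continuous_on UNIV (\<lambda>z. esgn \<epsilon> * (1 - (cmod z)\<^sup>2) / (1 + (cmod z)\<^sup>2))"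
      by (intro continuous_intros; simp)+
    then show "continuous_on UNIV (\<lambda>z. stereo \<epsilon> z $ i)"
      using exhaust_3[of i] unfolding stereo_def by (elim disjE) simp_all
  qed
  then show ?thesis by simp
qed

lemma continuous_on_circ: "continuous_on UNIV (circ \<delta>)"
  unfolding circ_def[abs_def] Complex_eq by (intro continuous_intros; simp)

text \<open>Homogeneous coordinates of a point of the sphere: [1 : z] off the south pole and [0 : 1]
  at it. The choice jumps there, but only its projective class enters, and smoothness is checked in
  charts.\<close>

definition sphere_fst :: "real^3 \<Rightarrow> complex" where "sphere_fst y = (if 1 + y $ 3 = 0 then 0 else 1)"
definition sphere_snd :: "real^3 \<Rightarrow> complex"
  where "sphere_snd y = (if 1 + y $ 3 = 0 then 1 else unstereo True y)"
definition circle_m :: "complex \<Rightarrow> complex" where "circle_m \<sigma> = ((1 + cc) * \<sigma> + (1 - cc)) / 2"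
definition circle_n :: "complex \<Rightarrow> complex" where "circle_n \<sigma> = - \<i> * sc * (\<sigma> - 1) / 2"

definition lagrangian_map :: "(real^3) \<times> complex \<Rightarrow> cp3"
  where "lagrangian_map = (\<lambda>(y, \<sigma>). proj (lag (sphere_fst y) (sphere_snd y) (circle_m \<sigma>) (circle_n \<sigma>)))"

lemma sphere_chart: "\<exists>k. k \<noteq> 0 \<and> chart_fst \<epsilon> z = k * sphere_fst (stereo \<epsilon> z) \<and> chart_snd \<epsilon> z = k * sphere_snd (stereo \<epsilon> z)"
proof (cases \<epsilon>)
  case True
  then show ?thesis
    using stereo_pole[of True z] unstereo_stereo[of True z]
    by (intro exI[of _ 1]) (simp add: chart_fst_def chart_snd_def sphere_fst_def sphere_snd_def)
next
  case False
  define y where "y = stereo False z"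
  have y3: "1 + y $ 3 = 2 * (cmod z)\<^sup>2 / (1 + (cmod z)\<^sup>2)"
    using stereo_pole[of False z] by (simp add: y_def field_simps)
  show ?thesis
  proof (cases "z = 0")
    case True
    then show ?thesis using False y3[unfolded y_def]
      by (intro exI[of _ 1]) (simp add: chart_fst_def chart_snd_def sphere_fst_def sphere_snd_def)
  next
    case z: False
    then have nz: "1 + y $ 3 \<noteq> 0" by (simp add: y3)
    have "unstereo True y = Complex (Re z / (cmod z)\<^sup>2) (- Im z / (cmod z)\<^sup>2)"
      unfolding unstereo_def using z y3 by (simp add: y_def stereo_def)
    also have "\<dots> = 1 / z" by (simp add: complex_eq_iff Re_divide Im_divide cmod_power2)
    finally show ?thesis using False nz z
      by (intro exI[of _ z]) (simp add: chart_fst_def chart_snd_def sphere_fst_def sphere_snd_def flip: y_def)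
  qed
qed

lemma circle_chart: "\<exists>l. l \<noteq> 0 \<and> chart_m \<delta> t = l * circle_m (circ \<delta> t) \<and> chart_n \<delta> t = l * circle_n (circ \<delta> t)"
proof -
  \<comment> \<open>The circle point is cnj l / l, so multiplication by l turns functions affine in
    it into functions affine in t.\<close>
  define l where "l = (if \<delta> then 1 - \<i> * of_real t else of_real t - \<i>)"
  have l0: "l \<noteq> 0" by (auto simp: l_def complex_eq_iff)
  have c: "l * circ \<delta> t = cnj l"
    by (cases \<delta>) (simp_all add: l_def circ_def complex_eq_iff divide_simps, simp_all add: power2_eq_square algebra_simps)
  have "l * circle_m (circ \<delta> t) = ((1 + cc) * (l * circ \<delta> t) + (1 - cc) * l) / 2"
    by (simp add: circle_m_def algebra_simps)
  also have "\<dots> = chart_m \<delta> t" unfolding c by (simp add: l_def chart_m_def algebra_simps)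
  finally have m: "chart_m \<delta> t = l * circle_m (circ \<delta> t)" ..
  have "l * circle_n (circ \<delta> t) = - \<i> * sc * (l * circ \<delta> t - l) / 2"
    by (simp add: circle_n_def algebra_simps)
  also have "\<dots> = chart_n \<delta> t" unfolding c by (simp add: l_def chart_n_def algebra_simps)
  finally have n: "chart_n \<delta> t = l * circle_n (circ \<delta> t)" ..
  show ?thesis using l0 m n by blast
qed

lemma lagrangian_map_chart:
  assumes "bounded_linear \<zeta>" "bounded_linear \<tau>"
  shows "hopf (normalized (cone \<epsilon> \<delta> \<zeta> \<tau>) x) = lagrangian_map (stereo \<epsilon> (\<zeta> x), circ \<delta> (\<tau> x))"
proof -
  let ?N = "cone \<epsilon> \<delta> \<zeta> \<tau>"
  have N0: "?N x \<noteq> 0" by (rule cone_chart(1)[OF assms])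
  obtain k l where kl: "k \<noteq> 0" "l \<noteq> 0" "chart_fst \<epsilon> (\<zeta> x) = k * sphere_fst (stereo \<epsilon> (\<zeta> x))"
    "chart_snd \<epsilon> (\<zeta> x) = k * sphere_snd (stereo \<epsilon> (\<zeta> x))"
    "chart_m \<delta> (\<tau> x) = l * circle_m (circ \<delta> (\<tau> x))" "chart_n \<delta> (\<tau> x) = l * circle_n (circ \<delta> (\<tau> x))"
    using sphere_chart circle_chart by metis
  define w where "w = lag (sphere_fst (stereo \<epsilon> (\<zeta> x))) (sphere_snd (stereo \<epsilon> (\<zeta> x)))
    (circle_m (circ \<delta> (\<tau> x))) (circle_n (circ \<delta> (\<tau> x)))"
  have N: "?N x = (k * l) *s w" unfolding cone_def kl(3-6) lag_smult w_def ..
  then have "w \<noteq> 0" using N0 by auto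
  have "hopf (normalized ?N x) = proj (?N x)" unfolding normalized_eq[of ?N x, OF N0] proj_def ..
  also have "\<dots> = proj w" unfolding N using kl(1,2) \<open>w \<noteq> 0\<close> by (intro proj_smult) simp_all
  finally show ?thesis by (simp add: lagrangian_map_def w_def)
qed

section \<open>Injectivity of the Lagrangian map\<close>

lemma circle_m_nonzero: "cmod \<sigma> = 1 \<Longrightarrow> circle_m \<sigma> \<noteq> 0"
proof
  assume \<sigma>: "cmod \<sigma> = 1" and "circle_m \<sigma> = 0"
  then have "(1 + cc) * \<sigma> = - (1 - cc)" unfolding circle_m_def by (simp add: add_eq_0_iff)
  then have "cmod ((1 + cc) * \<sigma>) = cmod (1 - cc)" by (metis norm_minus_cancel)
  then have e: "cmod (1 + cc) = cmod (1 - cc)" by (simp add: norm_mult \<sigma>)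
  have "1 + cc = of_real (1 + 1 / sqrt 3)" "1 - cc = of_real (1 - 1 / sqrt 3)" by (simp_all add: cc_def)
  then have "\<bar>1 + 1 / sqrt 3\<bar> = \<bar>1 - 1 / sqrt 3\<bar>" using e by (simp only: norm_of_real)
  moreover have "1 / sqrt 3 > 0" by simp
  ultimately show False by linarith
qed

lemma lag_sphere_circle_nonzero:
  assumes "cmod \<sigma> = 1"
  shows "lag (sphere_fst y) (sphere_snd y) (circle_m \<sigma>) (circle_n \<sigma>) \<noteq> 0" (is "?v \<noteq> 0")
proof
  assume "?v = 0"
  then have "((cmod (sphere_fst y))\<^sup>2 + (cmod (sphere_snd y))\<^sup>2) * ((cmod (circle_m \<sigma>))\<^sup>2 + (cmod (circle_n \<sigma>))\<^sup>2) = 0"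
    by (simp only: norm_lag[symmetric]) simp
  moreover have "(cmod (sphere_fst y))\<^sup>2 + (cmod (sphere_snd y))\<^sup>2 > 0"
    by (simp add: sphere_fst_def sphere_snd_def add_pos_nonneg)
  moreover have "(cmod (circle_m \<sigma>))\<^sup>2 + (cmod (circle_n \<sigma>))\<^sup>2 > 0"
    using circle_m_nonzero[OF assms] by (simp add: add_pos_nonneg)
  ultimately show False by (metis mult_pos_pos less_irrefl)
qed

text \<open>\<open>lag\<close> is an invertible linear function of the four products m a, n a, m b,
  n b, so proportional values have proportional products.\<close>

lemma lag_tensor:
  assumes "lag a' b' m' n' = k *s lag a b m n"
  shows "m' * a' = k * (m * a)" "n' * a' = k * (n * a)" "m' * b' = k * (m * b)" "n' * b' = k * (n * b)"
proof -
  have c: "lag a' b' m' n' $ i = k * lag a b m n $ i" for i using assms by simp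
  show "m' * a' = k * (m * a)" "n' * a' = k * (n * a)"
    using c[of 1] c[of 3] by (simp_all add: lag_def)
  \<comment> \<open>This inverts the block with rows (i sc, cc) and (cc, i sc), which is unitary
    because sc^2 + cc^2 = 1.\<close>
  have r: "cc * (lag a b m n $ 4) - \<i> * sc * (lag a b m n $ 2) = m * b"
    "cc * (lag a b m n $ 2) - \<i> * sc * (lag a b m n $ 4) = n * b" for a b m n
    by (simp_all add: lag_def algebra_simps sc_cc_mult)
  have "m' * b' = cc * (lag a' b' m' n' $ 4) - \<i> * sc * (lag a' b' m' n' $ 2)" by (simp only: r)
  also have "\<dots> = k * (cc * (lag a b m n $ 4) - \<i> * sc * (lag a b m n $ 2))" unfolding c by (simp add: algebra_simps)
  finally show "m' * b' = k * (m * b)" by (simp only: r)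
  have "n' * b' = cc * (lag a' b' m' n' $ 2) - \<i> * sc * (lag a' b' m' n' $ 4)" by (simp only: r)
  also have "\<dots> = k * (cc * (lag a b m n $ 2) - \<i> * sc * (lag a b m n $ 4))" unfolding c by (simp add: algebra_simps)
  finally show "n' * b' = k * (n * b)" by (simp only: r)
qed

text \<open>A nonzero decomposable tensor determines its factors up to scalars. The first factor
  gives the point of the sphere and the ratio m : n the point of the circle.\<close>

lemma inj_lagrangian_map: "inj_on lagrangian_map (sphere 0 1 \<times> sphere 0 1)"
proof (rule inj_onI, clarify)
  fix y y' :: "real^3" and \<sigma> \<sigma>' :: complex
  assume "y \<in> sphere 0 1" "\<sigma> \<in> sphere 0 1" "y' \<in> sphere 0 1" "\<sigma>' \<in> sphere 0 1"
  then have n: "norm y = 1" "cmod \<sigma> = 1" "norm y' = 1" "cmod \<sigma>' = 1" by simp_all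
  assume "lagrangian_map (y, \<sigma>) = lagrangian_map (y', \<sigma>')"
  then obtain k where k: "lag (sphere_fst y') (sphere_snd y') (circle_m \<sigma>') (circle_n \<sigma>')
      = k *s lag (sphere_fst y) (sphere_snd y) (circle_m \<sigma>) (circle_n \<sigma>)"
    using proj_eq_iff[OF lag_sphere_circle_nonzero[OF n(2)] lag_sphere_circle_nonzero[OF n(4)]]
    by (auto simp: lagrangian_map_def)
  note t = lag_tensor[OF k]
  have m0: "circle_m \<sigma> \<noteq> 0" "circle_m \<sigma>' \<noteq> 0" using circle_m_nonzero n by blast+
  have k0: "k \<noteq> 0" using k lag_sphere_circle_nonzero[OF n(4), of y'] by auto
  have ab: "sphere_fst u = 0 \<and> sphere_snd u = 1 \<and> 1 + u $ 3 = 0 \<or> sphere_fst u = 1 \<and> sphere_snd u = unstereo True u \<and> 1 + u $ 3 \<noteq> 0" for u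
    by (simp add: sphere_fst_def sphere_snd_def)
  have "y = y' \<and> circle_m \<sigma>' = k * circle_m \<sigma> \<and> circle_n \<sigma>' = k * circle_n \<sigma>"
  proof (cases "1 + y $ 3 = 0")
    case True
    then have "sphere_fst y = 0" "sphere_snd y = 1" using ab[of y] by auto
    moreover then have "sphere_fst y' = 0" using t(1) m0 by simp
    moreover then have "sphere_snd y' = 1" "1 + y' $ 3 = 0" using ab[of y'] by auto
    moreover have pole: "u $ 1 = 0 \<and> u $ 2 = 0 \<and> u $ 3 = - 1" if "1 + u $ 3 = 0" "norm u = 1" for u :: "real^3"
    proof -
      have "u $ 3 = - 1" using that(1) by simp
      then have "(u $ 1)\<^sup>2 + (u $ 2)\<^sup>2 = 0" using that(2) unfolding norm_3_eq_1 by simp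
      then show ?thesis using \<open>u $ 3 = - 1\<close> by (simp add: sum_power2_eq_zero_iff)
    qed
    ultimately show ?thesis using t(3,4) True n by (simp add: vec_eq_iff forall_3 pole[of y] pole[of y'])
  next
    case False
    then have y: "sphere_fst y = 1" "sphere_snd y = unstereo True y" using ab[of y] by auto
    then have "sphere_fst y' \<noteq> 0" using t(1) m0 k0 by auto
    then have y': "sphere_fst y' = 1" "sphere_snd y' = unstereo True y'" "1 + y' $ 3 \<noteq> 0" using ab[of y'] by auto
    have mn: "circle_m \<sigma>' = k * circle_m \<sigma>" "circle_n \<sigma>' = k * circle_n \<sigma>" using t(1,2) y y' by simp_all
    then have "unstereo True y' = unstereo True y" using t(3) m0 k0 unfolding y y' by simp
    then have "y' = y" using stereo_unstereo[of y True] stereo_unstereo[of y' True] n False y'(3) by simp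
    then show ?thesis using mn by simp
  qed
  then have yy: "y = y'" and mn: "circle_n \<sigma>' * circle_m \<sigma> = circle_n \<sigma> * circle_m \<sigma>'" by simp_all
  \<comment> \<open>\<open>circle_m\<close> and \<open>circle_n\<close> are affine in the circle
    point with nonzero determinant, so the mixed determinant is a constant times \<sigma>' -
    \<sigma>; the factor \<open>sc\<close> clears the square root.\<close>
  have "sc * (circle_n \<sigma>' * circle_m \<sigma> - circle_n \<sigma> * circle_m \<sigma>') = - \<i> * (\<sigma>' - \<sigma>) / 3"
    by (simp add: circle_n_def circle_m_def algebra_simps sc_cc_mult) (simp add: field_simps)
  then have "\<sigma>' = \<sigma>" using mn by simp
  then show "y = y' \<and> \<sigma> = \<sigma>'" using yy by simp
qed

section \<open>The atlases of the Lagrangian and of its spherical slice\<close>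

lemma homeomorphism_onto_image:
  assumes "\<And>x. g (f x) = x" "continuous_on UNIV f" "continuous_on (range f) g"
  shows "homeomorphism UNIV (range f) f g"
  using assms by (auto simp: homeomorphism_def image_iff)

definition zeta3 :: "real^3 \<Rightarrow> complex" where "zeta3 x = Complex (x $ 1) (x $ 2)"
definition zeta2 :: "real^2 \<Rightarrow> complex" where "zeta2 x = Complex (x $ 1) (x $ 2)"

lemma bounded_linear_zeta: "bounded_linear zeta3" "bounded_linear zeta2"
  unfolding linear_conv_bounded_linear[symmetric]
  by (rule linearI; simp add: zeta3_def zeta2_def complex_eq_iff)+

definition lagrangian_chart :: "bool \<Rightarrow> bool \<Rightarrow> ((real^3) \<times> complex, 3) lifted_chart"
  where "lagrangian_chart \<epsilon> \<delta>
    = (UNIV, \<lambda>x. (stereo \<epsilon> (zeta3 x), circ \<delta> (x $ 3)), normalized (cone \<epsilon> \<delta> zeta3 (\<lambda>x. x $ 3)))"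

text \<open>Flag \<open>True\<close> and \<tau> = 0 freeze (m, n) at (1, 0), that is, at the point 1
  of the circle.\<close>

definition sphere_chart_lift :: "bool \<Rightarrow> (real^3, 2) lifted_chart"
  where "sphere_chart_lift \<epsilon>
    = (UNIV, \<lambda>x. stereo \<epsilon> (zeta2 x), normalized (cone \<epsilon> True zeta2 (\<lambda>x. 0)))"

lemma adapted_frame_coordinates:
  assumes "adapted_frame p X E"
  shows "herm (a *s X + t *\<^sub>R E) X = a" "herm (a *s X + t *\<^sub>R E) E = of_real t"
  using assms herm_commute[of E X] by (simp_all add: adapted_frame_def)

text \<open>k and l are nonzero, so (\<zeta>, \<tau>) are rescaled coordinates of the frame space.
  Hermitian products with X and E recover them, which gives injectivity.\<close>

lemma lagrangian_chart_tangent: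
  "\<exists>X E. adapted_frame (normalized (cone \<epsilon> \<delta> zeta3 (\<lambda>x. x $ 3)) x) X E \<and>
    tangent_space (normalized (cone \<epsilon> \<delta> zeta3 (\<lambda>x. x $ 3))) x = frame_space X E \<and>
    inj (hopf_differential (normalized (cone \<epsilon> \<delta> zeta3 (\<lambda>x. x $ 3))) x)"
proof -
  let ?F = "normalized (cone \<epsilon> \<delta> zeta3 (\<lambda>x. x $ 3))"
  obtain X E k l where kl: "k \<noteq> 0" "l \<noteq> 0" and af: "adapted_frame (?F x) X E"
    and hd: "\<And>v. hopf_differential ?F x v = (of_real k * zeta3 v) *s X + (l * v $ 3) *\<^sub>R E"
    using cone_chart(3)[OF bounded_linear_zeta(1) bounded_linear_vec_nth, of \<epsilon> \<delta> 3 x] by blast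
  have "range (hopf_differential ?F x) = frame_space X E"
  proof (intro equalityI subsetI)
    fix Y assume "Y \<in> frame_space X E"
    then obtain a t where Y: "Y = a *s X + t *\<^sub>R E" unfolding frame_space_def by blast
    define v :: "real^3" where "v = vector [Re a / k, Im a / k, t / l]"
    have "of_real k * zeta3 v = a" "l * v $ 3 = t"
      using kl by (simp_all add: v_def zeta3_def complex_eq_iff)
    then have "Y = hopf_differential ?F x v" by (simp add: hd Y)
    then show "Y \<in> range (hopf_differential ?F x)" by blast
  qed (auto simp: hd frame_space_def)
  moreover have "inj (hopf_differential ?F x)"
  proof (rule injI)
    fix v w assume "hopf_differential ?F x v = hopf_differential ?F x w"
    then have eq: "(of_real k * zeta3 v) *s X + (l * v $ 3) *\<^sub>R E = (of_real k * zeta3 w) *s X + (l * w $ 3) *\<^sub>R E"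
      by (simp only: hd)
    have "of_real k * zeta3 v = of_real k * zeta3 w"
      using arg_cong[OF eq, of "\<lambda>u. herm u X"] unfolding adapted_frame_coordinates[OF af] .
    moreover have "complex_of_real (l * v $ 3) = of_real (l * w $ 3)"
      using arg_cong[OF eq, of "\<lambda>u. herm u E"] unfolding adapted_frame_coordinates[OF af] .
    ultimately show "v = w" using kl by (simp add: zeta3_def vec_eq_iff forall_3)
  qed
  ultimately show ?thesis using af by blast
qed

lemma sphere_chart_tangent:
  "\<exists>X E. adapted_frame (normalized (cone \<epsilon> True zeta2 (\<lambda>x. 0)) x) X E \<and>
    tangent_space (normalized (cone \<epsilon> True zeta2 (\<lambda>x. 0))) x = range (\<lambda>a. a *s X) \<and>
    inj (hopf_differential (normalized (cone \<epsilon> True zeta2 (\<lambda>x. 0))) x)"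
proof -
  let ?F = "normalized (cone \<epsilon> True zeta2 (\<lambda>x. 0))"
  obtain X E k l where kl: "k \<noteq> 0" "l \<noteq> (0::real)" and af: "adapted_frame (?F x) X E"
    and hd: "\<And>v. hopf_differential ?F x v = (of_real k * zeta2 v) *s X + (l * 0) *\<^sub>R E"
    using cone_chart(3)[OF bounded_linear_zeta(2) bounded_linear_zero, of \<epsilon> True x] by blast
  have "range (hopf_differential ?F x) = range (\<lambda>a. a *s X)"
  proof (intro equalityI subsetI)
    fix Y assume "Y \<in> range (\<lambda>a. a *s X)"
    then obtain a where Y: "Y = a *s X" by blast
    define v :: "real^2" where "v = vector [Re a / k, Im a / k]"
    have "of_real k * zeta2 v = a"
      using kl by (simp add: v_def zeta2_def complex_eq_iff)
    then have "Y = hopf_differential ?F x v" by (simp add: hd Y)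
    then show "Y \<in> range (hopf_differential ?F x)" by blast
  qed (auto simp: hd)
  moreover have "inj (hopf_differential ?F x)"
  proof (rule injI)
    fix v w assume "hopf_differential ?F x v = hopf_differential ?F x w"
    then have eq: "(of_real k * zeta2 v) *s X + (l * 0) *\<^sub>R E = (of_real k * zeta2 w) *s X + (l * 0) *\<^sub>R E"
      by (simp only: hd)
    have "of_real k * zeta2 v = of_real k * zeta2 w"
      using arg_cong[OF eq, of "\<lambda>u. herm u X"] unfolding adapted_frame_coordinates[OF af] .
    then show "v = w" using kl by (simp add: zeta2_def vec_eq_iff forall_2)
  qed
  ultimately show ?thesis using af by blast
qed

lemma range_lagrangian_parametrization:
  "range (\<lambda>x. (stereo \<epsilon> (zeta3 x), circ \<delta> (x $ 3)))
    = (sphere 0 1 \<times> sphere 0 1) \<inter> {p. 1 + esgn \<epsilon> * fst p $ 3 \<noteq> 0 \<and> 1 + esgn \<delta> * Re (snd p) \<noteq> 0}"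
    (is "range ?\<phi> = ?R")
proof (intro equalityI subsetI)
  fix p assume "p \<in> ?R"
  then obtain y \<sigma> where p: "p = (y, \<sigma>)" "norm y = 1" "cmod \<sigma> = 1" "1 + esgn \<epsilon> * y $ 3 \<noteq> 0" "1 + esgn \<delta> * Re \<sigma> \<noteq> 0"
    by (cases p) auto
  define x :: "real^3" where "x = vector [Re (unstereo \<epsilon> y), Im (unstereo \<epsilon> y), uncirc \<delta> \<sigma>]"
  have "p = ?\<phi> x" using p by (simp add: x_def zeta3_def stereo_unstereo circ_uncirc)
  then show "p \<in> range ?\<phi>" by (rule range_eqI)
qed (auto simp: norm_stereo norm_circ stereo_pole circ_pole add_nonneg_eq_0_iff)

lemma range_sphere_parametrization:
  "range (\<lambda>x. stereo \<epsilon> (zeta2 x)) = sphere 0 1 \<inter> {y. 1 + esgn \<epsilon> * y $ 3 \<noteq> 0}" (is "range ?\<phi> = ?R")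
proof (intro equalityI subsetI)
  fix y assume y: "y \<in> ?R"
  define x :: "real^2" where "x = vector [Re (unstereo \<epsilon> y), Im (unstereo \<epsilon> y)]"
  have "y = ?\<phi> x" using y by (simp add: x_def zeta2_def stereo_unstereo)
  then show "y \<in> range ?\<phi>" by (rule range_eqI)
qed (auto simp: norm_stereo stereo_pole add_nonneg_eq_0_iff)

lemma lifted_chart_lagrangian:
  "lifted_chart (sphere 0 1 \<times> sphere 0 1) lagrangian_map (lagrangian_chart \<epsilon> \<delta>)"
proof -
  let ?F = "normalized (cone \<epsilon> \<delta> zeta3 (\<lambda>x. x $ 3))"
  let ?\<phi> = "\<lambda>x. (stereo \<epsilon> (zeta3 x), circ \<delta> (x $ 3))"
  let ?\<psi> = "\<lambda>p. vector [Re (unstereo \<epsilon> (fst p)), Im (unstereo \<epsilon> (fst p)), uncirc \<delta> (snd p)] :: real^3"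
  note bl = bounded_linear_zeta(1) bounded_linear_vec_nth[of 3]
  have "openin (top_of_set (sphere 0 1 \<times> sphere 0 1)) (range ?\<phi>)"
    unfolding range_lagrangian_parametrization
    by (intro openin_open_Int open_Collect_conj open_Collect_neq continuous_intros)
  moreover have "homeomorphism UNIV (range ?\<phi>) ?\<phi> ?\<psi>"
  proof (rule homeomorphism_onto_image)
    show "?\<psi> (?\<phi> x) = x" for x
      by (simp add: unstereo_stereo uncirc_circ zeta3_def vec_eq_iff forall_3)
    show "continuous_on UNIV ?\<phi>"
      by (intro continuous_intros continuous_on_compose2[OF continuous_on_stereo]
          continuous_on_compose2[OF continuous_on_circ] linear_continuous_on bl) auto
    have "continuous_on (range ?\<phi>) (\<lambda>p. \<chi> i. ?\<psi> p $ i)"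
    proof (rule continuous_on_vec_lambda)
      fix i :: 3
      have nz: "1 + esgn \<epsilon> * fst p $ 3 \<noteq> 0" "1 + esgn \<delta> * Re (snd p) \<noteq> 0" if "p \<in> range ?\<phi>" for p
        using that unfolding range_lagrangian_parametrization by simp_all
      have "continuous_on (range ?\<phi>) (\<lambda>p. Re (unstereo \<epsilon> (fst p)))"
        "continuous_on (range ?\<phi>) (\<lambda>p. Im (unstereo \<epsilon> (fst p)))"
        "continuous_on (range ?\<phi>) (\<lambda>p. uncirc \<delta> (snd p))"
        unfolding unstereo_def uncirc_def complex.sel
        by (intro continuous_intros ballI nz; assumption)+
      then show "continuous_on (range ?\<phi>) (\<lambda>p. ?\<psi> p $ i)"
        using exhaust_3[of i] by (elim disjE) simp_all
    qed
    then show "continuous_on (range ?\<phi>) ?\<psi>" by simp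
  qed
  moreover have "smooth_on ?F UNIV"
    by (intro smooth_on_normalized open_UNIV cone_chart bl)
  moreover have "norm (?F x) = 1 \<and> hopf (?F x) = lagrangian_map (?\<phi> x) \<and> inj (hopf_differential ?F x)" for x
  proof -
    obtain X E where "adapted_frame (?F x) X E" "inj (hopf_differential ?F x)"
      using lagrangian_chart_tangent[of \<epsilon> \<delta> x] by blast
    moreover have "hopf (?F x) = lagrangian_map (?\<phi> x)" by (rule lagrangian_map_chart[OF bl])
    ultimately show ?thesis using adapted_frame_norm by blast
  qed
  ultimately show ?thesis unfolding lifted_chart_def lagrangian_chart_def by auto
qed

lemma lifted_chart_sphere:
  "lifted_chart (sphere 0 1) (\<lambda>y. lagrangian_map (y, 1)) (sphere_chart_lift \<epsilon>)"
proof -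
  let ?F = "normalized (cone \<epsilon> True zeta2 (\<lambda>x. 0))"
  let ?\<phi> = "\<lambda>x. stereo \<epsilon> (zeta2 x)"
  let ?\<psi> = "\<lambda>y. vector [Re (unstereo \<epsilon> y), Im (unstereo \<epsilon> y)] :: real^2"
  note bl = bounded_linear_zeta(2) bounded_linear_zero
  have "openin (top_of_set (sphere 0 1)) (range ?\<phi>)"
    unfolding range_sphere_parametrization
    by (intro openin_open_Int open_Collect_neq continuous_intros)
  moreover have "homeomorphism UNIV (range ?\<phi>) ?\<phi> ?\<psi>"
  proof (rule homeomorphism_onto_image)
    show "?\<psi> (?\<phi> x) = x" for x
      by (simp add: unstereo_stereo zeta2_def vec_eq_iff forall_2)
    show "continuous_on UNIV ?\<phi>"
      by (intro continuous_on_compose2[OF continuous_on_stereo] linear_continuous_on bl) auto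
    have "continuous_on (range ?\<phi>) (\<lambda>p. \<chi> i. ?\<psi> p $ i)"
    proof (rule continuous_on_vec_lambda)
      fix i :: 2
      have nz: "1 + esgn \<epsilon> * p $ 3 \<noteq> 0" if "p \<in> range ?\<phi>" for p
        using that unfolding range_sphere_parametrization by simp
      have "continuous_on (range ?\<phi>) (\<lambda>p. Re (unstereo \<epsilon> p))"
        "continuous_on (range ?\<phi>) (\<lambda>p. Im (unstereo \<epsilon> p))"
        unfolding unstereo_def complex.sel
        by (intro continuous_intros ballI nz; assumption)+
      then show "continuous_on (range ?\<phi>) (\<lambda>p. ?\<psi> p $ i)"
        using exhaust_2[of i] by (elim disjE) simp_all
    qed
    then show "continuous_on (range ?\<phi>) ?\<psi>" by simp
  qed
  moreover have "smooth_on ?F UNIV"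
    by (intro smooth_on_normalized open_UNIV cone_chart bl)
  moreover have "norm (?F x) = 1 \<and> hopf (?F x) = lagrangian_map (?\<phi> x, 1) \<and> inj (hopf_differential ?F x)" for x
  proof -
    obtain X E where "adapted_frame (?F x) X E" "inj (hopf_differential ?F x)"
      using sphere_chart_tangent[of \<epsilon> x] by blast
    moreover have "hopf (?F x) = lagrangian_map (?\<phi> x, circ True 0)" by (rule lagrangian_map_chart[OF bl])
    moreover have "circ True 0 = 1" by (simp add: circ_def complex_eq_iff)
    ultimately show ?thesis using adapted_frame_norm by auto
  qed
  ultimately show ?thesis unfolding lifted_chart_def sphere_chart_lift_def by auto
qed

definition lagrangian_atlas :: "((real^3) \<times> complex, 3) lifted_chart set"
  where "lagrangian_atlas = range (\<lambda>(\<epsilon>, \<delta>). lagrangian_chart \<epsilon> \<delta>)"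

definition sphere_atlas :: "(real^3, 2) lifted_chart set"
  where "sphere_atlas = range sphere_chart_lift"

text \<open>Each chart omits one pole of the sphere and one point of the circle. A coordinate cannot
  take both excluded values, so the four sign choices cover the product.\<close>

lemma esgn_cover: "\<exists>\<epsilon>. 1 + esgn \<epsilon> * x \<noteq> 0"
proof (cases "x = - 1")
  case True
  then show ?thesis by (intro exI[of _ False]) simp
next
  case False
  then show ?thesis by (intro exI[of _ True]) simp
qed

lemma immersed_submanifold_lagrangian:
  "immersed_submanifold (sphere 0 1 \<times> sphere 0 1) lagrangian_map lagrangian_atlas"
proof -
  have "sphere 0 1 \<times> sphere 0 1 = (\<Union>\<epsilon> \<delta>. range (\<lambda>x. (stereo \<epsilon> (zeta3 x), circ \<delta> (x $ 3))))"
    unfolding range_lagrangian_parametrization using esgn_cover by fastforce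
  then show ?thesis unfolding immersed_submanifold_def lagrangian_atlas_def
    using lifted_chart_lagrangian by (fastforce simp: lagrangian_chart_def)
qed

lemma immersed_submanifold_sphere:
  "immersed_submanifold (sphere 0 1) (\<lambda>y. lagrangian_map (y, 1)) sphere_atlas"
proof -
  have "sphere 0 1 = (\<Union>\<epsilon>. range (\<lambda>x. stereo \<epsilon> (zeta2 x)))"
    unfolding range_sphere_parametrization using esgn_cover by fastforce
  then show ?thesis unfolding immersed_submanifold_def sphere_atlas_def
    using lifted_chart_sphere by (fastforce simp: sphere_chart_lift_def)
qed

lemma totally_real_lagrangian_atlas: "totally_real lagrangian_atlas"
  unfolding totally_real_def
proof (rule ballI)
  fix c assume "c \<in> lagrangian_atlas"
  then obtain \<epsilon> \<delta> where c: "c = lagrangian_chart \<epsilon> \<delta>" by (auto simp: lagrangian_atlas_def)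
  show "case c of (V, \<phi>, F) \<Rightarrow> \<forall>x\<in>V. \<forall>X\<in>tangent_space F x. \<forall>Y\<in>tangent_space F x.
      nk_metric (F x) (nk_J (F x) X) Y = 0"
    unfolding c lagrangian_chart_def prod.case
  proof (rule ballI)
    let ?F = "normalized (cone \<epsilon> \<delta> zeta3 (\<lambda>x. x $ 3))"
    fix x :: "real^3"
    obtain X E where af: "adapted_frame (?F x) X E" and T: "tangent_space ?F x = frame_space X E"
      using lagrangian_chart_tangent[of \<epsilon> \<delta> x] by blast
    show "\<forall>X\<in>tangent_space ?F x. \<forall>Y\<in>tangent_space ?F x. nk_metric (?F x) (nk_J (?F x) X) Y = 0"
      unfolding T by (intro ballI frame_space_totally_real[OF af])
  qed
qed

lemma lagrangian_angle_lagrangian_atlas: "has_lagrangian_angle lagrangian_atlas (\<lambda>_. pi / 4)"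
  unfolding has_lagrangian_angle_def
proof (rule ballI)
  fix c assume "c \<in> lagrangian_atlas"
  then obtain \<epsilon> \<delta> where c: "c = lagrangian_chart \<epsilon> \<delta>" by (auto simp: lagrangian_atlas_def)
  show "case c of (V, \<phi>, F) \<Rightarrow> \<forall>x\<in>V. pi / 4 \<in> {0..pi/4} \<and>
     (\<exists>A\<in>D1 (F x). \<exists>X\<in>D2 (F x). \<exists>E3\<in>D2 (F x).
        nk_metric (F x) A A = 1 \<and> nk_metric (F x) X X = 1 \<and>
        nk_orthonormal_basis (F x) (tangent_space F x)
          (cos (pi / 4) *\<^sub>R A + sin (pi / 4) *\<^sub>R X)
          (sin (pi / 4) *\<^sub>R nk_J (F x) A - cos (pi / 4) *\<^sub>R nk_J (F x) X) E3)"
    unfolding c lagrangian_chart_def prod.case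
  proof (intro ballI conjI)
    let ?F = "normalized (cone \<epsilon> \<delta> zeta3 (\<lambda>x. x $ 3))"
    fix x :: "real^3"
    obtain X E where af: "adapted_frame (?F x) X E" and T: "tangent_space ?F x = frame_space X E"
      using lagrangian_chart_tangent[of \<epsilon> \<delta> x] by blast
    show "\<exists>A\<in>D1 (?F x). \<exists>X\<in>D2 (?F x). \<exists>E3\<in>D2 (?F x).
        nk_metric (?F x) A A = 1 \<and> nk_metric (?F x) X X = 1 \<and>
        nk_orthonormal_basis (?F x) (tangent_space ?F x)
          (cos (pi / 4) *\<^sub>R A + sin (pi / 4) *\<^sub>R X)
          (sin (pi / 4) *\<^sub>R nk_J (?F x) A - cos (pi / 4) *\<^sub>R nk_J (?F x) X) E3"
      unfolding T by (rule frame_space_lagrangian_angle[OF af])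
  qed simp
qed

lemma sphere_atlas_complex_totally_real: "totally_real sphere_atlas" "kaehler_almost_complex sphere_atlas"
proof -
  have t: "\<exists>\<epsilon>. c = sphere_chart_lift \<epsilon>" if "c \<in> sphere_atlas" for c
    using that by (auto simp: sphere_atlas_def)
  show "totally_real sphere_atlas"
    unfolding totally_real_def
  proof (rule ballI)
    fix c assume "c \<in> sphere_atlas"
    then obtain \<epsilon> where c: "c = sphere_chart_lift \<epsilon>" using t by blast
    show "case c of (V, \<phi>, F) \<Rightarrow> \<forall>x\<in>V. \<forall>X\<in>tangent_space F x. \<forall>Y\<in>tangent_space F x.
        nk_metric (F x) (nk_J (F x) X) Y = 0"
      unfolding c sphere_chart_lift_def prod.case
    proof (rule ballI)
      let ?F = "normalized (cone \<epsilon> True zeta2 (\<lambda>x. 0))"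
      fix x :: "real^2"
      obtain X E where af: "adapted_frame (?F x) X E" and T: "tangent_space ?F x = range (\<lambda>a. a *s X)"
        using sphere_chart_tangent[of \<epsilon> x] by blast
      have "a *s X \<in> frame_space X E" for a
        unfolding frame_space_def by (rule CollectI, rule exI[of _ a], rule exI[of _ 0]) simp
      then show "\<forall>X\<in>tangent_space ?F x. \<forall>Y\<in>tangent_space ?F x. nk_metric (?F x) (nk_J (?F x) X) Y = 0"
        unfolding T using frame_space_totally_real[OF af] by auto
    qed
  qed
  show "kaehler_almost_complex sphere_atlas"
    unfolding kaehler_almost_complex_def
  proof (rule ballI)
    fix c assume "c \<in> sphere_atlas"
    then obtain \<epsilon> where c: "c = sphere_chart_lift \<epsilon>" using t by blast
    show "case c of (V, \<phi>, F) \<Rightarrow> \<forall>x\<in>V. (\<lambda>v. \<i> *s v) ` tangent_space F x = tangent_space F x"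
      unfolding c sphere_chart_lift_def prod.case
    proof (rule ballI)
      let ?F = "normalized (cone \<epsilon> True zeta2 (\<lambda>x. 0))"
      fix x :: "real^2"
      obtain X E where T: "tangent_space ?F x = range (\<lambda>a. a *s X)"
        using sphere_chart_tangent[of \<epsilon> x] by blast
      have "(\<lambda>v. \<i> *s v) ` range (\<lambda>a. a *s X) = range (\<lambda>a. a *s X)"
      proof (intro equalityI subsetI)
        fix Y assume "Y \<in> range (\<lambda>a. a *s X)"
        then obtain a where "Y = a *s X" by blast
        then have "Y = \<i> *s ((- \<i> * a) *s X)" by (simp add: vec_eq_iff)
        then show "Y \<in> (\<lambda>v. \<i> *s v) ` range (\<lambda>a. a *s X)" by blast
      next
        fix Y assume "Y \<in> (\<lambda>v. \<i> *s v) ` range (\<lambda>a. a *s X)"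
        then obtain a where "Y = \<i> *s (a *s X)" by blast
        then have "Y = (\<i> * a) *s X" by simp
        then show "Y \<in> range (\<lambda>a. a *s X)" by blast
      qed
      then show "(\<lambda>v. \<i> *s v) ` tangent_space ?F x = tangent_space ?F x"
        unfolding T .
    qed
  qed
qed

text \<open>At the circle point 1 the second factor is (1, 0) and \<open>lag\<close> becomes
  \<alpha> mp + \<beta> mq, so the slice runs through the model line; the south pole supplies the
  point of \<open>mq\<close>.\<close>

lemma lagrangian_slice: "(\<lambda>y. lagrangian_map (y, 1)) ` sphere 0 1 = model_sphere"
proof -
  have lag1: "lag a b (circle_m 1) (circle_n 1) = a *s mp + b *s mq" for a b
    by (simp add: lag_def circle_m_def circle_n_def mp_def mq_def vec_eq_iff forall_4)
  show ?thesis unfolding model_sphere_projline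
  proof (intro equalityI subsetI)
    fix x assume "x \<in> (\<lambda>y. lagrangian_map (y, 1)) ` sphere 0 1"
    then obtain y where x: "x = proj (sphere_fst y *s mp + sphere_snd y *s mq)"
      by (auto simp: lagrangian_map_def lag1)
    have "sphere_fst y *s mp + sphere_snd y *s mq \<noteq> 0"
      using lag_sphere_circle_nonzero[of 1 y] by (simp add: lag1)
    then show "x \<in> projline mp mq" unfolding x proj_in_projline[OF \<open>_ \<noteq> 0\<close>] cspan2_def by blast
  next
    fix x assume "x \<in> projline mp mq"
    then obtain \<alpha> \<beta> where x: "\<alpha> *s mp + \<beta> *s mq \<noteq> 0" "x = proj (\<alpha> *s mp + \<beta> *s mq)"
      unfolding projline_def cspan2_def by auto
    show "x \<in> (\<lambda>y. lagrangian_map (y, 1)) ` sphere 0 1"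
    proof (cases "\<alpha> = 0")
      case True
      define y :: "real^3" where "y = vector [0, 0, -1]"
      have y: "norm y = 1" "sphere_fst y = 0" "sphere_snd y = 1"
        by (simp_all add: y_def norm_3_eq_1 sphere_fst_def sphere_snd_def)
      have "x = proj (\<beta> *s mq)" "\<beta> \<noteq> 0" "mq \<noteq> 0" using x True by auto
      then have "x = lagrangian_map (y, 1)" by (simp add: lagrangian_map_def y lag1 proj_smult)
      then show ?thesis using y(1) by auto
    next
      case False
      define y where "y = stereo True (\<beta> / \<alpha>)"
      have y: "norm y = 1" "sphere_fst y = 1" "sphere_snd y = \<beta> / \<alpha>"
        using stereo_pole[of True "\<beta> / \<alpha>"]
        by (simp_all add: y_def norm_stereo sphere_fst_def sphere_snd_def unstereo_stereo)
      have eq: "\<alpha> *s mp + \<beta> *s mq = \<alpha> *s (1 *s mp + (\<beta> / \<alpha>) *s mq)"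
        using False by (simp add: vec_eq_iff algebra_simps)
      have "1 *s mp + (\<beta> / \<alpha>) *s mq \<noteq> 0"
        using x(1) unfolding eq vector_mul_eq_0 by blast
      then have "x = proj (1 *s mp + (\<beta> / \<alpha>) *s mq)"
        unfolding x(2) eq using False by (intro proj_smult)
      then have "x = lagrangian_map (y, 1)" by (simp only: lagrangian_map_def prod.case y lag1)
      then show ?thesis using y(1) by auto
    qed
  qed
qed

text \<open>Without compactness an open piece of the model sphere is all that can be claimed, as a
  small disc in the line shows. The last part places the model sphere in an injectively immersed
  Lagrangian of constant angle \<pi>/4, as a slice with an atlas that is itself totally real and
  almost complex.\<close>

theorem theorem6p1:
  fixes M :: "'m::{t2_space, second_countable_topology} set"
    and f :: "'m \<Rightarrow> cp3"
    and \<A> :: "('m, 2) lifted_chart set"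
  assumes "immersed_submanifold M f \<A>"
    and "connected M" and "M \<noteq> {}"
    and "totally_real \<A>"
    and "kaehler_almost_complex \<A>"
  shows "(\<exists>U. openin (top_of_set model_sphere) U \<and> nk_congruent (f ` M) U) \<and>
    (compact M \<longrightarrow> nk_congruent (f ` M) model_sphere) \<and>
    (\<exists>(\<Lambda> :: (real^3) \<times> complex \<Rightarrow> cp3) (\<L> :: ((real^3) \<times> complex, 3) lifted_chart set)
        (\<S> :: (real^3, 2) lifted_chart set).
       inj_on \<Lambda> (sphere 0 1 \<times> sphere 0 1) \<and>
       lagrangian_submanifold (sphere 0 1 \<times> sphere 0 1) \<Lambda> \<L> \<and>
       has_lagrangian_angle \<L> (\<lambda>_. pi / 4) \<and>
       (\<exists>s\<in>sphere 0 1.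
          (\<lambda>y. \<Lambda> (y, s)) ` sphere 0 1 = model_sphere \<and>
          immersed_submanifold (sphere 0 1) (\<lambda>y. \<Lambda> (y, s)) \<S> \<and>
          totally_real \<S> \<and> kaehler_almost_complex \<S>))"
proof (intro conjI impI)
  show "\<exists>U. openin (top_of_set model_sphere) U \<and> nk_congruent (f ` M) U"
    by (rule congruent_to_model_sphere(1)[OF assms])
  show "nk_congruent (f ` M) model_sphere" if "compact M"
    using congruent_to_model_sphere(2)[OF assms that] .
  show "\<exists>(\<Lambda> :: (real^3) \<times> complex \<Rightarrow> cp3) (\<L> :: ((real^3) \<times> complex, 3) lifted_chart set)
        (\<S> :: (real^3, 2) lifted_chart set).
       inj_on \<Lambda> (sphere 0 1 \<times> sphere 0 1) \<and>
       lagrangian_submanifold (sphere 0 1 \<times> sphere 0 1) \<Lambda> \<L> \<and>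
       has_lagrangian_angle \<L> (\<lambda>_. pi / 4) \<and>
       (\<exists>s\<in>sphere 0 1.
          (\<lambda>y. \<Lambda> (y, s)) ` sphere 0 1 = model_sphere \<and>
          immersed_submanifold (sphere 0 1) (\<lambda>y. \<Lambda> (y, s)) \<S> \<and>
          totally_real \<S> \<and> kaehler_almost_complex \<S>)"
    using immersed_submanifold_lagrangian totally_real_lagrangian_atlas
    by (intro exI[of _ lagrangian_map] exI[of _ lagrangian_atlas] exI[of _ sphere_atlas] conjI
        bexI[of _ "1::complex"] inj_lagrangian_map lagrangian_angle_lagrangian_atlas lagrangian_slice
        immersed_submanifold_sphere sphere_atlas_complex_totally_real)
      (simp_all add: lagrangian_submanifold_def)
qed

end
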